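(* Let $p$ be a prime and let $\Psi=(\psi_1,\ldots,\psi_t)$ be a system of $t$ linear forms over $\mathbb{F}_p$ whose image has codimension two in $\mathbb{F}_p^t$ (i.e. $\operatorname{Im}\Psi=\ker M$ for a $2\times t$ matrix $M$ over $\mathbb{F}_p$ of rank two), and suppose $\Psi$ is linearly generic. Then $\Psi$ is not locally Sidorenko (and hence not Sidorenko). Furthermore, if $\Psi$ is weakly locally Sidorenko then $t$ is odd, and if in addition $p$ is sufficiently large in terms of $t$, then $\Psi$ contains an additive $(t-1)$-tuple.
   Context: A system of linear forms $\Psi=(\psi_1,\ldots,\psi_t)$ consists of $\mathbb{F}_p$-linear maps $\psi_i:\mathbb{F}_p^D\to\mathbb{F}_p$ (with $D\le t$ and $x\mapsto(\psi_1(x),\ldots,\psi_t(x))$ injective). Each $\psi_i(x)=\sum_j c_{ij}x_j$ also induces a map $(\mathbb{F}_p^n)^D\to\mathbb{F}_p^n$ by the same formula. The image of $\Psi$ is $\operatorname{Im}\Psi=\{(\psi_1(x),\ldots,\psi_t(x)):x\in\mathbb{F}_p^D\}\le\mathbb{F}_p^t$. For $f:\mathbb{F}_p^n\to\mathbb{C}$ define $T_\Psi(f)=p^{-nD}\sum_{x\in(\mathbb{F}_p^n)^D}\prod_{i=1}^t f(\psi_i(x))$. For $S\subseteq[t]$, $\Psi(S)=(\psi_i)_{i\in S}$. $\Psi$ is locally Sidorenko if for every $\alpha\in[0,1]$ there is $\varepsilon>0$ such that for all $n\ge1$ and all $f:\mathbb{F}_p^n\to[-\alpha,1-\alpha]$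 with $\mathbb{E}_xf(x)=0$ we have $T_\Psi(\alpha+\varepsilon f)\ge\alpha^t$. $\Psi$ is weakly locally Sidorenko if for all $n\ge1$, all $\alpha\in[0,1]$ and all $f:\mathbb{F}_p^n\to[-\alpha,1-\alpha]$ with $\mathbb{E}_xf(x)=0$ there is $\varepsilon_f>0$ such that $T_\Psi(\alpha+\varepsilon f)\ge\alpha^t$ for all $0<\varepsilon<\varepsilon_f$. $\Psi$ is Sidorenko if for all $n\ge1$ and all $f:\mathbb{F}_p^n\to[0,1]$, $T_\Psi(f)\ge(\mathbb{E}_xf(x))^t$. A codimension-two system with $\operatorname{Im}\Psi=\ker M$, $M$ a $2\times t$ matrix, is linearly generic if every $2\times2$ minor of $M$ has nonzero determinant. $\Psi$ contains an additive $k$-tuple if there is $S\subseteq[t]$ with $|S|=k$ such that, after reordering the indices of $S$, $\operatorname{Im}\Psi(S)=\{y\in\mathbb{F}_p^k: y_1-y_2+y_3-\cdots+(-1)^{k+1}y_k=0\}$.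
   Formalization: "Not locally Sidorenko (and hence not Sidorenko)" excludes t = 3 with three equal forms, where it fails: (x,x,x) is linearly generic of codimension two, but T(f) = E f^3 >= (E f)^3, so it is Sidorenko. *)

theory Defs
  imports Complex_Main "HOL-Library.FuncSet" "HOL-Computational_Algebra.Primes" "HOL-Number_Theory.Cong"
begin

text \<open>
  The threshold on \<open>p\<close> in the theorem depends on the number of forms only, so \<open>p\<close> is a number
  and not a type: \<open>F\<^sub>p\<close> is \<open>{0..<int p}\<close> with arithmetic modulo \<open>p\<close>.
  Coefficients of forms and entries of matrices are arbitrary integers standing for their residue
  classes. Indices \<open>1, \<dots>, t\<close> are shifted to \<open>0, \<dots>, t - 1\<close>.
\<close>

definition Fp_vec :: "nat \<Rightarrow> nat \<Rightarrow> (nat \<Rightarrow> int) set" where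
  "Fp_vec p n = {..<n} \<rightarrow>\<^sub>E {0..<int p}"

definition form_eval :: "nat \<Rightarrow> nat \<Rightarrow> (nat \<Rightarrow> int) \<Rightarrow> (nat \<Rightarrow> int) \<Rightarrow> int" where
  "form_eval p D a x = (\<Sum>j<D. a j * x j) mod int p"

text \<open>The map \<open>(F\<^sub>p\<^sup>n)\<^sup>D \<rightarrow> F\<^sub>p\<^sup>n\<close> induced by a form; \<open>x j k\<close> is the \<open>k\<close>-th coordinate of the vector \<open>x j\<close>.\<close>

definition form_eval_vec ::
    "nat \<Rightarrow> nat \<Rightarrow> nat \<Rightarrow> (nat \<Rightarrow> int) \<Rightarrow> (nat \<Rightarrow> nat \<Rightarrow> int) \<Rightarrow> (nat \<Rightarrow> int)" where
  "form_eval_vec p n D a x = (\<lambda>k\<in>{..<n}. form_eval p D a (\<lambda>j. x j k))"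

text \<open>A family of \<open>t\<close> forms in \<open>D\<close> variables is given by \<open>\<Psi> :: nat \<Rightarrow> nat \<Rightarrow> int\<close>, where \<open>\<Psi> i j\<close>
  (for \<open>i < t\<close>, \<open>j < D\<close>) is the coefficient \<open>c\<^sub>i\<^sub>j\<close>.\<close>

definition joint_map :: "nat \<Rightarrow> nat \<Rightarrow> nat \<Rightarrow> (nat \<Rightarrow> nat \<Rightarrow> int) \<Rightarrow> (nat \<Rightarrow> int) \<Rightarrow> (nat \<Rightarrow> int)" where
  "joint_map p t D \<Psi> x = (\<lambda>i\<in>{..<t}. form_eval p D (\<Psi> i) x)"

definition linear_system :: "nat \<Rightarrow> nat \<Rightarrow> nat \<Rightarrow> (nat \<Rightarrow> nat \<Rightarrow> int) \<Rightarrow> bool" where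
  "linear_system p t D \<Psi> \<longleftrightarrow> D \<le> t \<and> inj_on (joint_map p t D \<Psi>) (Fp_vec p D)"

definition Im_forms :: "nat \<Rightarrow> nat \<Rightarrow> nat \<Rightarrow> (nat \<Rightarrow> nat \<Rightarrow> int) \<Rightarrow> (nat \<Rightarrow> int) set" where
  "Im_forms p t D \<Psi> = joint_map p t D \<Psi> ` Fp_vec p D"

definition average :: "nat \<Rightarrow> nat \<Rightarrow> ((nat \<Rightarrow> int) \<Rightarrow> 'a::field_char_0) \<Rightarrow> 'a" where
  "average p n f = (\<Sum>x\<in>Fp_vec p n. f x) / of_nat p ^ n"

definition T_count ::
    "nat \<Rightarrow> nat \<Rightarrow> nat \<Rightarrow> (nat \<Rightarrow> nat \<Rightarrow> int) \<Rightarrow> nat \<Rightarrow> ((nat \<Rightarrow> int) \<Rightarrow> 'a::field_char_0) \<Rightarrow> 'a" where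
  "T_count p t D \<Psi> n f =
     (\<Sum>x\<in>{..<D} \<rightarrow>\<^sub>E Fp_vec p n. \<Prod>i<t. f (form_eval_vec p n D (\<Psi> i) x)) / of_nat p ^ (n * D)"

text \<open>Functions on \<open>F\<^sub>p\<^sup>n\<close> are total functions of which only the values on \<open>Fp_vec p n\<close> matter.\<close>

definition admissible :: "nat \<Rightarrow> nat \<Rightarrow> real \<Rightarrow> ((nat \<Rightarrow> int) \<Rightarrow> real) \<Rightarrow> bool" where
  "admissible p n \<alpha> f \<longleftrightarrow> (\<forall>x\<in>Fp_vec p n. f x \<in> {-\<alpha>..1 - \<alpha>}) \<and> average p n f = 0"

definition locally_Sidorenko :: "nat \<Rightarrow> nat \<Rightarrow> nat \<Rightarrow> (nat \<Rightarrow> nat \<Rightarrow> int) \<Rightarrow> bool" where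
  "locally_Sidorenko p t D \<Psi> \<longleftrightarrow>
     (\<forall>\<alpha>\<in>{0..1}. \<exists>\<epsilon>>0. \<forall>n\<ge>1. \<forall>f. admissible p n \<alpha> f \<longrightarrow>
        T_count p t D \<Psi> n (\<lambda>x. \<alpha> + \<epsilon> * f x) \<ge> \<alpha> ^ t)"

definition weakly_locally_Sidorenko :: "nat \<Rightarrow> nat \<Rightarrow> nat \<Rightarrow> (nat \<Rightarrow> nat \<Rightarrow> int) \<Rightarrow> bool" where
  "weakly_locally_Sidorenko p t D \<Psi> \<longleftrightarrow>
     (\<forall>n\<ge>1. \<forall>\<alpha>\<in>{0..1}. \<forall>f. admissible p n \<alpha> f \<longrightarrow>
        (\<exists>\<epsilon>f>0. \<forall>\<epsilon>. 0 < \<epsilon> \<and> \<epsilon> < \<epsilon>f \<longrightarrow>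
           T_count p t D \<Psi> n (\<lambda>x. \<alpha> + \<epsilon> * f x) \<ge> \<alpha> ^ t))"

definition Sidorenko :: "nat \<Rightarrow> nat \<Rightarrow> nat \<Rightarrow> (nat \<Rightarrow> nat \<Rightarrow> int) \<Rightarrow> bool" where
  "Sidorenko p t D \<Psi> \<longleftrightarrow>
     (\<forall>n\<ge>1. \<forall>f :: (nat \<Rightarrow> int) \<Rightarrow> real. (\<forall>x\<in>Fp_vec p n. f x \<in> {0..1}) \<longrightarrow>
        T_count p t D \<Psi> n f \<ge> average p n f ^ t)"

text \<open>\<open>M r i\<close> with \<open>r < 2\<close> and \<open>i < t\<close> are the entries of a \<open>2 \<times> t\<close> matrix.\<close>

definition kernel_mat :: "nat \<Rightarrow> nat \<Rightarrow> (nat \<Rightarrow> nat \<Rightarrow> int) \<Rightarrow> (nat \<Rightarrow> int) set" where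
  "kernel_mat p t M = {y \<in> Fp_vec p t. \<forall>r<2. [(\<Sum>i<t. M r i * y i) = 0] (mod int p)}"

definition rank_two :: "nat \<Rightarrow> nat \<Rightarrow> (nat \<Rightarrow> nat \<Rightarrow> int) \<Rightarrow> bool" where
  "rank_two p t M \<longleftrightarrow>
     (\<forall>a b. (\<forall>i<t. [a * M 0 i + b * M 1 i = 0] (mod int p)) \<longrightarrow>
        [a = 0] (mod int p) \<and> [b = 0] (mod int p))"

definition cut_out_by :: "nat \<Rightarrow> nat \<Rightarrow> nat \<Rightarrow> (nat \<Rightarrow> nat \<Rightarrow> int) \<Rightarrow> (nat \<Rightarrow> nat \<Rightarrow> int) \<Rightarrow> bool" where
  "cut_out_by p t D \<Psi> M \<longleftrightarrow> rank_two p t M \<and> Im_forms p t D \<Psi> = kernel_mat p t M"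

definition codimension_two :: "nat \<Rightarrow> nat \<Rightarrow> nat \<Rightarrow> (nat \<Rightarrow> nat \<Rightarrow> int) \<Rightarrow> bool" where
  "codimension_two p t D \<Psi> \<longleftrightarrow> (\<exists>M. cut_out_by p t D \<Psi> M)"

text \<open>Two choices of \<open>M\<close> differ by an invertible \<open>2 \<times> 2\<close> matrix acting on the rows, so quantifying
  \<open>M\<close> existentially or universally makes no difference.\<close>

definition linearly_generic :: "nat \<Rightarrow> nat \<Rightarrow> nat \<Rightarrow> (nat \<Rightarrow> nat \<Rightarrow> int) \<Rightarrow> bool" where
  "linearly_generic p t D \<Psi> \<longleftrightarrow>
     (\<exists>M. cut_out_by p t D \<Psi> M \<and>
        (\<forall>j<t. \<forall>i<j. \<not> [M 0 i * M 1 j - M 0 j * M 1 i = 0] (mod int p)))"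

text \<open>The bijection \<open>\<sigma>\<close> orders the index set \<open>S\<close>.\<close>

definition contains_additive_tuple :: "nat \<Rightarrow> nat \<Rightarrow> nat \<Rightarrow> (nat \<Rightarrow> nat \<Rightarrow> int) \<Rightarrow> nat \<Rightarrow> bool" where
  "contains_additive_tuple p t D \<Psi> k \<longleftrightarrow>
     (\<exists>S \<subseteq> {..<t}. card S = k \<and> (\<exists>\<sigma>. bij_betw \<sigma> {..<k} S \<and>
        Im_forms p k D (\<lambda>i. \<Psi> (\<sigma> i)) =
          {y \<in> Fp_vec p k. [(\<Sum>i<k. (-1) ^ i * y i) = 0] (mod int p)}))"

text \<open>
  The system \<open>(\<psi>, \<psi>, \<psi>)\<close>, up to a change of variable \<open>(x, x, x)\<close>. It is cut out by
  \<open>y\<^sub>1 - y\<^sub>2 = y\<^sub>2 - y\<^sub>3 = 0\<close>, which is linearly generic, while \<open>T\<^sub>\<Psi>(f)\<close> is the average of \<open>f\<^sup>3\<close>, so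
  by Jensen's inequality the system is Sidorenko, and locally Sidorenko with \<open>\<epsilon> = 1\<close>.
  It is therefore excluded from the assertion that a linearly generic system is not (locally)
  Sidorenko.
\<close>

definition form_thrice :: "nat \<Rightarrow> nat \<Rightarrow> nat \<Rightarrow> (nat \<Rightarrow> nat \<Rightarrow> int) \<Rightarrow> bool" where
  "form_thrice p t D \<Psi> \<longleftrightarrow>
     t = 3 \<and> (\<forall>i<t. \<forall>x\<in>Fp_vec p D. form_eval p D (\<Psi> i) x = form_eval p D (\<Psi> 0) x)"

end

theory Submission imports Defs begin

text \<open>
  Write \<open>v\<^sub>i\<close> for the columns of \<open>M\<close>. If \<open>f\<close> has Fourier coefficients \<open>z\<close>, then \<open>T\<^sub>\<Psi>(f)\<close> is the
  sum of \<open>\<Prod>\<^sub>i z(v\<^sub>i \<cdot> \<Xi>)\<close> over pairs \<open>\<Xi>\<close> of frequencies. As the \<open>v\<^sub>i\<close> are pairwise independent,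
  for \<open>f\<close> of mean zero this gives \<open>T\<^sub>\<Psi>(\<alpha> + \<epsilon> f) = \<alpha>\<^sup>t + \<alpha> \<epsilon>\<^sup>t\<^sup>-\<^sup>1 Q(f) + \<epsilon>\<^sup>t T\<^sub>\<Psi>(f)\<close>, where \<open>Q(f)\<close> sums over the
  nonzero \<open>\<Xi>\<close> killed by one \<open>v\<^sub>i\<close>. For even \<open>t\<close>, a negated point mass has \<open>Q < 0\<close>. Three forms have
  a one-dimensional image, and a difference of two point masses works unless the forms coincide.

  Let \<open>t \<ge> 5\<close> be odd, so \<open>p \<ge> 5\<close>. If some \<open>\<Xi>\<close> over the prime field has \<open>v\<^sub>i \<cdot> \<Xi> = 0\<close> and all other
  \<open>v\<^sub>j \<cdot> \<Xi> = \<plusminus>1\<close>, but never with equally many signs of each kind (which would be an additive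
  tuple), a single-frequency \<open>f\<close> makes \<open>Q\<close> negative. Otherwise let \<open>z\<close> be supported on frequencies
  that begin with some \<open>\<plusminus>v\<^sub>l\<close>, with value a bilinear phase of coefficient \<open>\<plusminus>s\<^sub>l\<close> in the remaining
  coordinates, where all \<open>s\<^sub>l\<close> are nonzero and \<open>\<Sum>\<^sub>l s\<^sub>l v\<^sub>l \<otimes> v\<^sub>l = 0\<close>. The phases cancel on a positive
  proportion of the pairs and every other choice of leading coordinates contributes a nonnegative
  amount, so \<open>T\<^sub>\<Psi>(f)\<close> is large compared with \<open>Q(f)\<close>, and \<open>Q(f) = 0\<close> if no \<open>\<Xi>\<close> as above exists.
  Since \<open>t\<close> is odd, \<open>-f\<close> violates the inequality.
\<close>

subsection \<open>Characters and the annihilator of the image\<close>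

definition ep :: "nat \<Rightarrow> int \<Rightarrow> complex" where
  "ep p x = cis (2 * pi * of_int x / of_nat p)"

lemma ep_add: "ep p (x + y) = ep p x * ep p y"
  by (simp add: ep_def cis_mult algebra_simps add_divide_distrib)

lemma ep_0 [simp]: "ep p 0 = 1"
  by (simp add: ep_def)

lemma norm_ep [simp]: "norm (ep p x) = 1"
  by (simp add: ep_def)

lemma cnj_ep: "cnj (ep p x) = ep p (- x)"
  by (simp add: ep_def cis_cnj)

lemma ep_sum: "ep p (\<Sum>i\<in>A. g i) = (\<Prod>i\<in>A. ep p (g i))"
  by (induction A rule: infinite_finite_induct) (simp_all add: ep_add)

lemma ep_eq_1_iff: "p > 0 \<Longrightarrow> ep p x = 1 \<longleftrightarrow> int p dvd x"
proof -
  assume p: "p > 0"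
  have "ep p x = 1 \<longleftrightarrow> cos (2 * pi * of_int x / of_nat p) = 1"
  proof
    assume "cos (2 * pi * of_int x / of_nat p) = (1::real)"
    then show "ep p x = 1"
      unfolding ep_def using sin_cos_squared_add[of "2 * pi * of_int x / of_nat p"]
      by (simp add: complex_eq_iff)
  qed (simp add: ep_def complex_eq_iff)
  also have "\<dots> \<longleftrightarrow> (\<exists>n::int. 2 * pi * of_int x / of_nat p = n * 2 * pi)"
    by (rule cos_one_2pi_int)
  also have "\<dots> \<longleftrightarrow> (\<exists>n::int. of_int x = (of_int (int p * n) :: real))"
    using p by (simp add: field_simps)
  also have "\<dots> \<longleftrightarrow> int p dvd x"
    by (auto simp only: of_int_eq_iff dvd_def)
  finally show ?thesis .
qed

lemma ep_cong: "p > 0 \<Longrightarrow> [x = y] (mod int p) \<Longrightarrow> ep p x = ep p y"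
  using ep_eq_1_iff[of p "x - y"] ep_add[of p "x - y" y] by (simp add: cong_iff_dvd_diff)

lemma sum_ep:
  assumes "p > 0"
  shows "(\<Sum>x\<in>{0..<int p}. ep p (c * x)) = (if int p dvd c then of_nat p else 0)"
proof -
  have pow: "ep p (c * int k) = ep p c ^ k" for k
    by (induction k) (simp_all add: ep_add algebra_simps)
  have "(\<Sum>x\<in>{0..<int p}. ep p (c * x)) = (\<Sum>k<p. ep p c ^ k)"
    by (rule sum.reindex_bij_witness[of _ int nat]) (auto simp flip: pow)
  also have "\<dots> = (if int p dvd c then of_nat p else 0)"
  proof (cases "int p dvd c")
    case True
    then have "ep p c = 1" using ep_eq_1_iff assms by blast
    then show ?thesis using True by simp
  next
    case False
    then have "ep p c \<noteq> 1" using ep_eq_1_iff assms by blast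
    moreover have "ep p c ^ p = 1" using pow[of p] ep_eq_1_iff[of p "c * int p"] assms by simp
    ultimately show ?thesis using False by (simp add: geometric_sum)
  qed
  finally show ?thesis .
qed

lemma finite_Fp_vec [simp, intro]: "finite (Fp_vec p n)"
  by (simp add: Fp_vec_def finite_PiE)

lemma card_Fp_vec: "card (Fp_vec p n) = p ^ n"
  by (simp add: Fp_vec_def card_PiE)

lemma sum_ep_vec:
  assumes "p > 0"
  shows "(\<Sum>x\<in>Fp_vec p n. ep p (\<Sum>k<n. c k * x k)) =
    (if \<forall>k<n. int p dvd c k then of_nat p ^ n else 0)"
proof -
  have "(\<Sum>x\<in>Fp_vec p n. ep p (\<Sum>k<n. c k * x k)) = (\<Prod>k<n. \<Sum>x\<in>{0..<int p}. ep p (c k * x))"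
    unfolding Fp_vec_def ep_sum by (subst prod_sum_PiE) auto
  also have "\<dots> = (if \<forall>k<n. int p dvd c k then of_nat p ^ n else 0)"
    using assms by (auto simp: sum_ep)
  finally show ?thesis .
qed

text \<open>Vectors are extensional functions with values in a fixed set of representatives, so
  computations run on plain integer functions and \<open>red\<close> returns to
  \<open>Fp_vec\<close> at the end.\<close>

definition red :: "nat \<Rightarrow> nat \<Rightarrow> (nat \<Rightarrow> int) \<Rightarrow> nat \<Rightarrow> int" where
  "red p n a = (\<lambda>k\<in>{..<n}. a k mod int p)"

lemma red_in [simp, intro]: "p > 0 \<Longrightarrow> red p n a \<in> Fp_vec p n"
  by (auto simp: red_def Fp_vec_def)

lemma red_apply [simp]: "k < n \<Longrightarrow> red p n a k = a k mod int p"
  by (simp add: red_def)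

lemma Fp_vec_range: "x \<in> Fp_vec p n \<Longrightarrow> k < n \<Longrightarrow> 0 \<le> x k \<and> x k < int p"
  by (auto simp: Fp_vec_def PiE_def Pi_def)

lemma Fp_vec_eqI:
  "x \<in> Fp_vec p n \<Longrightarrow> y \<in> Fp_vec p n \<Longrightarrow> (\<And>k. k < n \<Longrightarrow> [x k = y k] (mod int p)) \<Longrightarrow> x = y"
  unfolding Fp_vec_def by (rule PiE_ext) (auto simp: PiE_def Pi_def cong_def)

lemma red_ident [simp]: "x \<in> Fp_vec p n \<Longrightarrow> red p n x = x"
  by (rule Fp_vec_eqI[of _ p n]) (auto simp: red_def Fp_vec_def PiE_def Pi_def cong_def)

lemma red_cong: "(\<And>k. k < n \<Longrightarrow> [a k = b k] (mod int p)) \<Longrightarrow> red p n a = red p n b"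
  unfolding red_def cong_def by (rule restrict_ext) auto

lemma red_eq_iff: "red p n a = red p n b \<longleftrightarrow> (\<forall>k<n. [a k = b k] (mod int p))"
proof
  assume eq: "red p n a = red p n b"
  show "\<forall>k<n. [a k = b k] (mod int p)"
  proof (intro allI impI)
    fix k assume "k < n"
    then show "[a k = b k] (mod int p)"
      using fun_cong[OF eq, of k] by (simp add: cong_def)
  qed
qed (blast intro: red_cong)

lemma form_eval_cong: "[form_eval p D a x = (\<Sum>j<D. a j * x j)] (mod int p)"
  by (simp add: form_eval_def cong_def)

section \<open>Linear algebra of a generic 2 x t matrix over the prime field\<close>

locale generic_system =
  fixes p t D :: nat and \<Psi> M :: "nat \<Rightarrow> nat \<Rightarrow> int"
  assumes prime: "prime p"
    and cut: "cut_out_by p t D \<Psi> M"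
    and generic: "\<forall>j<t. \<forall>i<j. \<not> [M 0 i * M 1 j - M 0 j * M 1 i = 0] (mod int p)"
begin

lemma p_pos [simp]: "p > 0" using prime by (simp add: prime_gt_0_nat)

lemma prime_int: "Factorial_Ring.prime (int p)" using prime by simp

definition minor :: "nat \<Rightarrow> nat \<Rightarrow> int" where
  "minor i j = M 0 i * M 1 j - M 0 j * M 1 i"

lemma minor_ndvd: "i < t \<Longrightarrow> j < t \<Longrightarrow> i \<noteq> j \<Longrightarrow> \<not> int p dvd minor i j"
proof -
  assume ij: "i < t" "j < t" "i \<noteq> j"
  have "minor i j = - minor j i" by (simp add: minor_def)
  moreover have "\<not> int p dvd minor a b" if "a < b" "b < t" for a b
    using generic that by (simp add: minor_def cong_iff_dvd_diff)
  ultimately show ?thesis using ij by (metis dvd_minus_iff nat_neq_iff)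
qed

lemma image_eq_kernel: "Im_forms p t D \<Psi> = kernel_mat p t M"
  using cut by (simp add: cut_out_by_def)

text \<open>With at most one column the two rows of \<open>M\<close> are dependent, against rank
  two. For a single column, the relation with coefficients \<open>M 1 0\<close> and
  \<open>- M 0 0\<close> forces the column to vanish, which is absurd as well.\<close>

lemma two_le_t: "t \<ge> 2"
proof (rule ccontr)
  assume "\<not> t \<ge> 2"
  then have t: "t = 0 \<or> t = 1" by auto
  have rk: "int p dvd a \<and> int p dvd b" if "\<And>i. i < t \<Longrightarrow> int p dvd a * M 0 i + b * M 1 i" for a b
  proof -
    have "rank_two p t M" using cut by (simp add: cut_out_by_def)
    then have "(\<forall>i<t. [a * M 0 i + b * M 1 i = 0] (mod int p)) \<longrightarrow>
        [a = 0] (mod int p) \<and> [b = 0] (mod int p)" unfolding rank_two_def by blast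
    then show ?thesis using that unfolding cong_0_iff by blast
  qed
  have no1: "\<not> int p dvd 1" using prime_int not_prime_unit by blast
  from t show False
  proof
    assume "t = 0" then show False using rk[of 1 0] no1 by simp
  next
    assume t: "t = 1"
    have "int p dvd M 1 0 \<and> int p dvd - M 0 0" by (rule rk) (simp add: t)
    then show False using rk[of 1 0] no1 t by simp
  qed
qed

lemma kernel_form_eval:
  assumes "r < 2"
  shows "int p dvd (\<Sum>i<t. M r i * (\<Sum>j<D. \<Psi> i j * x j))"
proof -
  let ?x = "red p D x"
  have "joint_map p t D \<Psi> ?x \<in> kernel_mat p t M"
    unfolding image_eq_kernel[symmetric] Im_forms_def by auto
  then have "[(\<Sum>i<t. M r i * joint_map p t D \<Psi> ?x i) = 0] (mod int p)"
    using assms by (simp add: kernel_mat_def)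
  moreover have "[(\<Sum>i<t. M r i * joint_map p t D \<Psi> ?x i) = (\<Sum>i<t. M r i * (\<Sum>j<D. \<Psi> i j * x j))] (mod int p)"
  proof (intro cong_sum cong_mult cong_refl)
    fix i assume "i \<in> {..<t}"
    then have "joint_map p t D \<Psi> ?x i = form_eval p D (\<Psi> i) ?x" by (simp add: joint_map_def)
    also have "[\<dots> = (\<Sum>j<D. \<Psi> i j * ?x j)] (mod int p)" by (rule form_eval_cong)
    also have "[(\<Sum>j<D. \<Psi> i j * ?x j) = (\<Sum>j<D. \<Psi> i j * x j)] (mod int p)"
      by (intro cong_sum cong_mult cong_refl) (simp add: cong_def)
    finally show "[joint_map p t D \<Psi> ?x i = (\<Sum>j<D. \<Psi> i j * x j)] (mod int p)" .
  qed
  ultimately show ?thesis by (meson cong_0_iff cong_sym cong_trans)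
qed

text \<open>The double annihilator of the row space of \<open>M\<close>, made explicit: test vectors
  in the kernel supported on three indices determine each \<open>a i\<close> from \<open>a 0\<close>
  and \<open>a 1\<close>.\<close>

lemma annihilator_image:
  "(\<forall>j<D. int p dvd (\<Sum>i<t. a i * \<Psi> i j)) \<longleftrightarrow>
    (\<exists>\<xi>\<in>{0..<int p}. \<exists>\<eta>\<in>{0..<int p}. \<forall>i<t. [a i = M 0 i * \<xi> + M 1 i * \<eta>] (mod int p))"
proof
  assume "\<exists>\<xi>\<in>{0..<int p}. \<exists>\<eta>\<in>{0..<int p}. \<forall>i<t. [a i = M 0 i * \<xi> + M 1 i * \<eta>] (mod int p)"
  then obtain \<xi> \<eta> where a: "\<And>i. i < t \<Longrightarrow> [a i = M 0 i * \<xi> + M 1 i * \<eta>] (mod int p)" by blast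
  show "\<forall>j<D. int p dvd (\<Sum>i<t. a i * \<Psi> i j)"
  proof (intro allI impI)
    fix j assume j: "j < D"
    have *: "int p dvd (\<Sum>i<t. M r i * \<Psi> i j)" if "r < 2" for r
      using kernel_form_eval[OF that, of "\<lambda>k. if k = j then 1 else 0"] j by (simp add: if_distrib cong: if_cong)
    have "[(\<Sum>i<t. a i * \<Psi> i j) = (\<Sum>i<t. (M 0 i * \<xi> + M 1 i * \<eta>) * \<Psi> i j)] (mod int p)"
      using a by (intro cong_sum cong_mult cong_refl) auto
    also have "(\<Sum>i<t. (M 0 i * \<xi> + M 1 i * \<eta>) * \<Psi> i j) =
        \<xi> * (\<Sum>i<t. M 0 i * \<Psi> i j) + \<eta> * (\<Sum>i<t. M 1 i * \<Psi> i j)"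
      by (simp add: sum_distrib_left flip: sum.distrib) (simp add: algebra_simps)
    finally show "int p dvd (\<Sum>i<t. a i * \<Psi> i j)"
      using *[of 0] *[of 1] cong_dvd_iff by fastforce
  qed
next
  assume ann: "\<forall>j<D. int p dvd (\<Sum>i<t. a i * \<Psi> i j)"
  have ker: "int p dvd (\<Sum>i<t. a i * y i)"
    if y: "\<And>r. r < 2 \<Longrightarrow> int p dvd (\<Sum>i<t. M r i * y i)" for y
  proof -
    have "[(\<Sum>i<t. M r i * red p t y i) = (\<Sum>i<t. M r i * y i)] (mod int p)" for r
      by (intro cong_sum cong_mult cong_refl) (simp add: cong_def)
    then have "int p dvd (\<Sum>i<t. M r i * red p t y i)" if "r < 2" for r
      using y[OF that] cong_dvd_iff by blast
    then have "red p t y \<in> Im_forms p t D \<Psi>"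
      unfolding image_eq_kernel kernel_mat_def by (simp add: cong_0_iff)
    then obtain x where x: "red p t y = joint_map p t D \<Psi> x" by (auto simp: Im_forms_def)
    have "[(\<Sum>i<t. a i * y i) = (\<Sum>i<t. a i * (\<Sum>j<D. \<Psi> i j * x j))] (mod int p)"
    proof (intro cong_sum cong_mult cong_refl)
      fix i assume "i \<in> {..<t}"
      then have "[y i = form_eval p D (\<Psi> i) x] (mod int p)"
        using fun_cong[OF x, of i] by (simp add: joint_map_def form_eval_def cong_def)
      then show "[y i = (\<Sum>j<D. \<Psi> i j * x j)] (mod int p)"
        using form_eval_cong cong_trans by blast
    qed
    also have "(\<Sum>i<t. a i * (\<Sum>j<D. \<Psi> i j * x j)) = (\<Sum>j<D. (\<Sum>i<t. a i * \<Psi> i j) * x j)"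
      unfolding sum_distrib_left sum_distrib_right by (subst sum.swap) (simp add: mult.assoc)
    finally show ?thesis
      using ann by (subst cong_dvd_iff) (auto intro!: dvd_sum)
  qed
  define d where "d = minor 0 1"
  have "coprime d (int p)"
    using minor_ndvd[of 0 1] two_le_t prime_imp_coprime[OF prime_int, of d] by (auto simp: d_def coprime_commute)
  then obtain e where e: "[d * e = 1] (mod int p)" using cong_solve_coprime_int by blast
  \<comment> \<open>Cramer's rule for the equations at columns 0 and 1, with \<open>e\<close> the
    inverse of the determinant \<open>d\<close>.\<close>
  define \<xi> \<eta> where "\<xi> = e * (a 0 * M 1 1 - a 1 * M 1 0)" and "\<eta> = e * (M 0 0 * a 1 - M 0 1 * a 0)"
  have "[a i = M 0 i * \<xi> + M 1 i * \<eta>] (mod int p)" if i: "i < t" for i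
  proof -
    have dv: "int p dvd a 0 * minor 1 i - a 1 * minor 0 i + a i * d"
    proof (cases "i < 2")
      case True
      then have "i = 0 \<or> i = 1" by auto
      then show ?thesis by (auto simp: d_def minor_def algebra_simps)
    next
      case False
      \<comment> \<open>The entries are the coefficients of the linear dependence between columns 0,
        1 and i of \<open>M\<close>, so \<open>y\<close> lies in the kernel.\<close>
      define y where "y = (\<lambda>k. if k = 0 then minor 1 i else if k = 1 then - minor 0 i else if k = i then d else 0)"
      have S: "(\<Sum>k<t. b k * y k) = b 0 * minor 1 i - b 1 * minor 0 i + b i * d" for b
      proof -
        have "(\<Sum>k<t. b k * y k) = (\<Sum>k\<in>{0,1,i}. b k * y k)"
          using i two_le_t by (intro sum.mono_neutral_right) (auto simp: y_def)
        also have "\<dots> = b 0 * minor 1 i - b 1 * minor 0 i + b i * d" using False by (simp add: y_def)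
        finally show ?thesis .
      qed
      have "int p dvd (\<Sum>k<t. a k * y k)"
      proof (rule ker)
        fix r :: nat assume "r < 2"
        then have "r = 0 \<or> r = 1" by auto
        then show "int p dvd (\<Sum>k<t. M r k * y k)"
          unfolding S by (auto simp: d_def minor_def algebra_simps)
      qed
      then show ?thesis by (simp add: S)
    qed
    have "a i - (M 0 i * \<xi> + M 1 i * \<eta>) =
        e * (a 0 * minor 1 i - a 1 * minor 0 i + a i * d) - a i * (d * e - 1)"
      by (simp add: \<xi>_def \<eta>_def minor_def algebra_simps)
    also have "int p dvd \<dots>"
      using dv e by (simp add: cong_iff_dvd_diff)
    finally show ?thesis by (simp add: cong_iff_dvd_diff)
  qed
  moreover have "[M 0 i * \<xi> + M 1 i * \<eta> = M 0 i * (\<xi> mod int p) + M 1 i * (\<eta> mod int p)] (mod int p)" for i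
    by (intro cong_add cong_mult cong_refl) (simp_all add: cong_def)
  ultimately have "\<forall>i<t. [a i = M 0 i * (\<xi> mod int p) + M 1 i * (\<eta> mod int p)] (mod int p)"
    using cong_trans by blast
  moreover have "\<xi> mod int p \<in> {0..<int p}" "\<eta> mod int p \<in> {0..<int p}" by auto
  ultimately show "\<exists>\<xi>\<in>{0..<int p}. \<exists>\<eta>\<in>{0..<int p}. \<forall>i<t. [a i = M 0 i * \<xi> + M 1 i * \<eta>] (mod int p)"
    by blast
qed

end

subsection \<open>Fourier expansion of the counting form\<close>

text \<open>Fourier inversion: \<open>z\<close> is the family of Fourier coefficients, and most test
  functions below are prescribed through it.\<close>

definition trig :: "nat \<Rightarrow> nat \<Rightarrow> ((nat \<Rightarrow> int) \<Rightarrow> complex) \<Rightarrow> (nat \<Rightarrow> int) \<Rightarrow> complex" where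
  "trig p n z y = (\<Sum>a\<in>Fp_vec p n. z a * ep p (\<Sum>k<n. a k * y k))"

abbreviation zero_vec :: "nat \<Rightarrow> nat \<Rightarrow> nat \<Rightarrow> int" where
  "zero_vec p n \<equiv> red p n (\<lambda>_. 0)"

text \<open>The symmetry of Fourier coefficients that makes \<open>trig\<close> real-valued.\<close>

definition hermitian :: "nat \<Rightarrow> nat \<Rightarrow> ((nat \<Rightarrow> int) \<Rightarrow> complex) \<Rightarrow> bool" where
  "hermitian p n z \<longleftrightarrow> (\<forall>a\<in>Fp_vec p n. z (red p n (\<lambda>k. - a k)) = cnj (z a))"

lemma trig_real:
  assumes "p > 0" "hermitian p n z"
  shows "of_real (Re (trig p n z y)) = trig p n z y"
proof -
  let ?neg = "\<lambda>a. red p n (\<lambda>k. - a k)"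
  have inv: "?neg (?neg a) = a" if "a \<in> Fp_vec p n" for a
    using that assms(1) by (intro Fp_vec_eqI[of _ p n]) (auto simp: cong_def mod_minus_eq)
  have "cnj (trig p n z y) = (\<Sum>a\<in>Fp_vec p n. cnj (z a) * ep p (- (\<Sum>k<n. a k * y k)))"
    by (simp add: trig_def cnj_ep)
  also have "\<dots> = (\<Sum>a\<in>Fp_vec p n. z a * ep p (\<Sum>k<n. a k * y k))"
  proof (rule sum.reindex_bij_witness[of _ ?neg ?neg])
    fix a assume a: "a \<in> Fp_vec p n"
    have "[(\<Sum>k<n. ?neg a k * y k) = (\<Sum>k<n. - a k * y k)] (mod int p)"
      by (intro cong_sum cong_mult cong_refl) (simp add: cong_def)
    then have "ep p (\<Sum>k<n. ?neg a k * y k) = ep p (\<Sum>k<n. - a k * y k)"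
      using ep_cong assms(1) by blast
    then show "z (?neg a) * ep p (\<Sum>k<n. ?neg a k * y k) = cnj (z a) * ep p (- (\<Sum>k<n. a k * y k))"
      using assms(2) a by (simp add: hermitian_def sum_negf)
  qed (use assms(1) inv in auto)
  also have "\<dots> = trig p n z y" by (simp add: trig_def)
  finally have "trig p n z y \<in> \<real>" by (simp add: Reals_cnj_iff)
  then show ?thesis by simp
qed

lemma sum_trig:
  assumes "p > 0" "z (zero_vec p n) = 0"
  shows "(\<Sum>y\<in>Fp_vec p n. trig p n z y) = 0"
proof -
  have "(\<Sum>y\<in>Fp_vec p n. trig p n z y) =
      (\<Sum>a\<in>Fp_vec p n. z a * (\<Sum>y\<in>Fp_vec p n. ep p (\<Sum>k<n. a k * y k)))"
    unfolding trig_def sum_distrib_left by (rule sum.swap)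
  also have "\<dots> = 0"
  proof (intro sum.neutral ballI)
    fix a assume a: "a \<in> Fp_vec p n"
    have "a = zero_vec p n" if "\<forall>k<n. int p dvd a k"
      using that a assms(1) by (intro Fp_vec_eqI[of _ p n]) (auto simp: cong_def)
    then show "z a * (\<Sum>y\<in>Fp_vec p n. ep p (\<Sum>k<n. a k * y k)) = 0"
      using assms by (auto simp: sum_ep_vec)
  qed
  finally show ?thesis .
qed

lemma average_Re_trig:
  assumes "p > 0" "z (zero_vec p n) = 0"
  shows "average p n (\<lambda>y. Re (trig p n z y) / c) = 0"
proof -
  have "(\<Sum>y\<in>Fp_vec p n. Re (trig p n z y)) = 0"
    using sum_trig[of p z n] assms by (simp flip: Re_sum)
  then show ?thesis by (simp add: average_def flip: sum_divide_distrib)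
qed

text \<open>The divisor \<open>2 * B\<close> brings the values into [-1/2, 1/2], the range allowed
  at density 1/2; the mean is the coefficient at frequency zero.\<close>

lemma admissible_trig:
  assumes "p > 0" "z (zero_vec p n) = 0" "B > 0" "\<And>y. y \<in> Fp_vec p n \<Longrightarrow> norm (trig p n z y) \<le> B"
  shows "admissible p n (1/2) (\<lambda>y. Re (trig p n z y) / (2 * B))"
proof -
  have "\<bar>Re (trig p n z y)\<bar> \<le> B" if "y \<in> Fp_vec p n" for y
    using abs_Re_le_cmod[of "trig p n z y"] assms(4)[OF that] by linarith
  then show ?thesis
    unfolding admissible_def using assms average_Re_trig[of p z n "2 * B"]
    by (fastforce simp: field_simps abs_le_iff)
qed

text \<open>Only the coefficient at frequency zero sees the added constant.\<close>

lemma trig_perturb: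
  assumes "p > 0" "z (zero_vec p n) = 0"
  shows "trig p n (\<lambda>a. if a = zero_vec p n then c else e * z a) y = c + e * trig p n z y"
proof -
  let ?V = "Fp_vec p n" and ?o = "zero_vec p n"
  have e0: "ep p (\<Sum>k<n. ?o k * y k) = 1" by simp
  have "trig p n z y = (\<Sum>a\<in>?V - {?o}. z a * ep p (\<Sum>k<n. a k * y k))"
    unfolding trig_def using assms by (subst sum.remove[of _ ?o]) auto
  moreover have "trig p n (\<lambda>a. if a = ?o then c else e * z a) y =
      c + (\<Sum>a\<in>?V - {?o}. e * z a * ep p (\<Sum>k<n. a k * y k))"
    unfolding trig_def using assms e0
    by (subst sum.remove[of _ ?o]) (auto intro!: sum.cong simp del: red_apply)
  ultimately show ?thesis by (simp add: sum_distrib_left mult.assoc)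
qed

lemma T_count_of_real:
  "of_real (T_count p t D \<Psi> n f) = T_count p t D \<Psi> n (\<lambda>y. of_real (f y) :: complex)"
  by (simp add: T_count_def)

section \<open>The counting form as a sum over pairs of frequencies\<close>

context generic_system begin

lemma independent:
  assumes "i < t" "j < t" "i \<noteq> j" "int p dvd M 0 i * a + M 1 i * b" "int p dvd M 0 j * a + M 1 j * b"
  shows "int p dvd a \<and> int p dvd b"
proof -
  have "minor i j * a = M 1 j * (M 0 i * a + M 1 i * b) - M 1 i * (M 0 j * a + M 1 j * b)"
    "minor i j * b = M 0 i * (M 0 j * a + M 1 j * b) - M 0 j * (M 0 i * a + M 1 i * b)"
    by (simp_all add: minor_def algebra_simps)
  then have "int p dvd minor i j * a" "int p dvd minor i j * b" using assms by auto
  then show ?thesis using minor_ndvd[OF assms(1-3)] prime_dvd_mult_iff[OF prime_int] by auto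
qed

text \<open>The frequency that the \<open>i\<close>-th factor of the counting form receives from the
  pair, written v_i . Xi in the overview.\<close>

definition pt :: "nat \<Rightarrow> (nat \<Rightarrow> int) \<times> (nat \<Rightarrow> int) \<Rightarrow> nat \<Rightarrow> nat \<Rightarrow> int" where
  "pt n \<Xi> i = red p n (\<lambda>k. M 0 i * fst \<Xi> k + M 1 i * snd \<Xi> k)"

abbreviation pairs :: "nat \<Rightarrow> ((nat \<Rightarrow> int) \<times> (nat \<Rightarrow> int)) set" where
  "pairs n \<equiv> Fp_vec p n \<times> Fp_vec p n"

lemma pt_in [simp, intro]: "pt n \<Xi> i \<in> Fp_vec p n"
  by (simp add: pt_def)

text \<open>Two columns of \<open>M\<close> are independent, so two of the combinations recover the
  pair.\<close>

lemma pt_inj: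
  assumes "\<Xi> \<in> pairs n" "\<Theta> \<in> pairs n" "i < t" "j < t" "i \<noteq> j" "pt n \<Xi> i = pt n \<Theta> i" "pt n \<Xi> j = pt n \<Theta> j"
  shows "\<Xi> = \<Theta>"
proof -
  have "int p dvd (fst \<Xi> k - fst \<Theta> k) \<and> int p dvd (snd \<Xi> k - snd \<Theta> k)" if "k < n" for k
    using assms that
    by (intro independent[of i j]) (auto simp: pt_def red_eq_iff cong_iff_dvd_diff algebra_simps)
  then have "fst \<Xi> = fst \<Theta>" "snd \<Xi> = snd \<Theta>"
    using assms by (auto intro!: Fp_vec_eqI[of _ p n] simp: cong_iff_dvd_diff)
  then show ?thesis by (simp add: prod_eq_iff)
qed

text \<open>Expanding the product gives a sum over t-tuples of frequencies. Averaging over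
  \<open>x\<close> keeps those whose coordinates all annihilate the image, and
  \<open>annihilator_image\<close> parametrizes these by pairs of frequencies.\<close>

lemma T_count_trig:
  "T_count p t D \<Psi> n (trig p n z) = (\<Sum>\<Xi>\<in>pairs n. \<Prod>i<t. z (pt n \<Xi> i))"
proof -
  let ?V = "Fp_vec p n"
  let ?A = "{..<t} \<rightarrow>\<^sub>E ?V" and ?X = "{..<D} \<rightarrow>\<^sub>E ?V"
  let ?c = "\<lambda>a j k. \<Sum>i<t. a i k * \<Psi> i j"
  let ?good = "\<lambda>a. \<forall>j<D. \<forall>k<n. int p dvd ?c a j k"
  have expand: "(\<Prod>i<t. trig p n z (form_eval_vec p n D (\<Psi> i) x)) =
      (\<Sum>a\<in>?A. (\<Prod>i<t. z (a i)) * (\<Prod>j<D. ep p (\<Sum>k<n. ?c a j k * x j k)))" for x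
  proof -
    have "(\<Prod>i<t. trig p n z (form_eval_vec p n D (\<Psi> i) x)) =
        (\<Sum>a\<in>?A. \<Prod>i<t. z (a i) * ep p (\<Sum>k<n. a i k * form_eval_vec p n D (\<Psi> i) x k))"
      unfolding trig_def by (subst prod_sum_PiE) auto
    also have "\<dots> = (\<Sum>a\<in>?A. (\<Prod>i<t. z (a i)) * (\<Prod>j<D. ep p (\<Sum>k<n. ?c a j k * x j k)))"
    proof (rule sum.cong[OF refl])
      fix a
      have "[(\<Sum>i<t. \<Sum>k<n. a i k * form_eval_vec p n D (\<Psi> i) x k) =
          (\<Sum>i<t. \<Sum>k<n. a i k * (\<Sum>j<D. \<Psi> i j * x j k))] (mod int p)"
        by (intro cong_sum cong_mult cong_refl) (simp add: form_eval_vec_def form_eval_def cong_def)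
      moreover have "(\<Sum>i<t. \<Sum>k<n. a i k * (\<Sum>j<D. \<Psi> i j * x j k)) =
          (\<Sum>j<D. \<Sum>k<n. ?c a j k * x j k)"
      proof -
        have "(\<Sum>i<t. \<Sum>k<n. a i k * (\<Sum>j<D. \<Psi> i j * x j k)) =
            (\<Sum>i<t. \<Sum>k<n. \<Sum>j<D. a i k * \<Psi> i j * x j k)"
          by (simp add: sum_distrib_left mult.assoc)
        also have "\<dots> = (\<Sum>i<t. \<Sum>j<D. \<Sum>k<n. a i k * \<Psi> i j * x j k)"
          by (intro sum.cong refl sum.swap)
        also have "\<dots> = (\<Sum>j<D. \<Sum>i<t. \<Sum>k<n. a i k * \<Psi> i j * x j k)"
          by (rule sum.swap)
        also have "\<dots> = (\<Sum>j<D. \<Sum>k<n. \<Sum>i<t. a i k * \<Psi> i j * x j k)"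
          by (intro sum.cong refl sum.swap)
        finally show ?thesis by (simp add: sum_distrib_right)
      qed
      ultimately have "ep p (\<Sum>i<t. \<Sum>k<n. a i k * form_eval_vec p n D (\<Psi> i) x k) =
          ep p (\<Sum>j<D. \<Sum>k<n. ?c a j k * x j k)"
        by (simp add: ep_cong)
      then show "(\<Prod>i<t. z (a i) * ep p (\<Sum>k<n. a i k * form_eval_vec p n D (\<Psi> i) x k)) =
          (\<Prod>i<t. z (a i)) * (\<Prod>j<D. ep p (\<Sum>k<n. ?c a j k * x j k))"
        by (simp add: prod.distrib flip: ep_sum)
    qed
    finally show ?thesis .
  qed
  have orth: "(\<Sum>x\<in>?X. \<Prod>j<D. ep p (\<Sum>k<n. ?c a j k * x j k)) =
      (if ?good a then of_nat p ^ (n * D) else 0)" for a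
  proof -
    have "(\<Sum>x\<in>?X. \<Prod>j<D. ep p (\<Sum>k<n. ?c a j k * x j k)) =
        (\<Prod>j<D. \<Sum>v\<in>?V. ep p (\<Sum>k<n. ?c a j k * v k))"
      by (subst prod_sum_PiE) auto
    also have "\<dots> = (\<Prod>j<D. if \<forall>k<n. int p dvd ?c a j k then of_nat p ^ n else 0)"
      by (simp add: sum_ep_vec)
    also have "\<dots> = (if ?good a then of_nat p ^ (n * D) else 0)"
    proof (cases "?good a")
      case True then show ?thesis by (simp add: power_mult)
    next
      case False then show ?thesis by auto
    qed
    finally show ?thesis .
  qed
  let ?emb = "\<lambda>\<Xi>. \<lambda>i\<in>{..<t}. pt n \<Xi> i"
  have inj: "inj_on ?emb (pairs n)"
  proof (rule inj_onI)
    fix \<Xi> \<Theta> assume *: "\<Xi> \<in> pairs n" "\<Theta> \<in> pairs n" "?emb \<Xi> = ?emb \<Theta>"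
    have "pt n \<Xi> i = pt n \<Theta> i" if "i < t" for i
      using fun_cong[OF *(3), of i] that by simp
    then show "\<Xi> = \<Theta>" using pt_inj[OF *(1,2), of 0 1] two_le_t by simp
  qed
  \<comment> \<open>The annihilator lemma is applied in each of the n coordinates, and its witnesses
    are collected into two vectors.\<close>
  have img: "?emb ` pairs n = {a \<in> ?A. ?good a}"
  proof (intro equalityI subsetI)
    fix a assume "a \<in> ?emb ` pairs n"
    then obtain \<Xi> where \<Xi>: "\<Xi> \<in> pairs n" "a = ?emb \<Xi>" by blast
    have "int p dvd ?c a j k" if "j < D" "k < n" for j k
    proof -
      have "\<forall>i<t. [a i k = M 0 i * fst \<Xi> k + M 1 i * snd \<Xi> k] (mod int p)"
        using \<Xi> that by (simp add: pt_def cong_def)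
      moreover have "fst \<Xi> k \<in> {0..<int p}" "snd \<Xi> k \<in> {0..<int p}"
        using \<Xi> that by (auto simp: mem_Times_iff Fp_vec_range)
      ultimately show ?thesis using annihilator_image[of "\<lambda>i. a i k"] that by blast
    qed
    then show "a \<in> {a \<in> ?A. ?good a}" using \<Xi>(2) by auto
  next
    fix a assume "a \<in> {a \<in> ?A. ?good a}"
    then have a: "a \<in> ?A" "?good a" by auto
    have "\<forall>k<n. \<exists>\<xi>\<in>{0..<int p}. \<exists>\<eta>\<in>{0..<int p}. \<forall>i<t. [a i k = M 0 i * \<xi> + M 1 i * \<eta>] (mod int p)"
    proof (intro allI impI)
      fix k assume "k < n"
      then show "\<exists>\<xi>\<in>{0..<int p}. \<exists>\<eta>\<in>{0..<int p}. \<forall>i<t. [a i k = M 0 i * \<xi> + M 1 i * \<eta>] (mod int p)"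
        using a(2) annihilator_image[of "\<lambda>i. a i k"] by blast
    qed
    then obtain \<xi> \<eta> where w: "\<And>k. k < n \<Longrightarrow> \<xi> k \<in> {0..<int p} \<and> \<eta> k \<in> {0..<int p} \<and>
        (\<forall>i<t. [a i k = M 0 i * \<xi> k + M 1 i * \<eta> k] (mod int p))" by metis
    let ?\<Xi> = "(restrict \<xi> {..<n}, restrict \<eta> {..<n})"
    have "?\<Xi> \<in> pairs n" using w by (auto simp: Fp_vec_def)
    moreover have "a = ?emb ?\<Xi>"
    proof (rule PiE_ext[OF a(1)])
      fix i assume i: "i \<in> {..<t}"
      then have "a i \<in> ?V" using a(1) by auto
      then have "a i = pt n ?\<Xi> i"
        using w i by (intro Fp_vec_eqI[of _ p n]) (auto simp: pt_def cong_def)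
      then show "a i = ?emb ?\<Xi> i" using i by simp
    qed auto
    ultimately show "a \<in> ?emb ` pairs n" by blast
  qed
  have "T_count p t D \<Psi> n (trig p n z) =
      (\<Sum>a\<in>?A. (\<Prod>i<t. z (a i)) * (\<Sum>x\<in>?X. \<Prod>j<D. ep p (\<Sum>k<n. ?c a j k * x j k))) / of_nat p ^ (n * D)"
    unfolding T_count_def expand sum_distrib_left by (subst sum.swap) simp
  also have "\<dots> = (\<Sum>a\<in>?A. if ?good a then \<Prod>i<t. z (a i) else 0)"
    unfolding orth sum_divide_distrib by (intro sum.cong refl) auto
  also have "\<dots> = (\<Sum>a\<in>{a\<in>?A. ?good a}. \<Prod>i<t. z (a i))"
    by (rule sum.inter_filter[symmetric]) (simp add: finite_PiE)
  also have "\<dots> = (\<Sum>\<Xi>\<in>pairs n. \<Prod>i<t. z (pt n \<Xi> i))"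
    unfolding img[symmetric] by (subst sum.reindex[OF inj]) simp
  finally show ?thesis .
qed

text \<open>Expanding \<open>T(\<alpha> + \<epsilon> f)\<close>, a nonzero pair of frequencies has at most one vanishing combination
  with a column of \<open>M\<close>. Pairs with exactly one contribute \<open>\<alpha> \<epsilon>\<^sup>t\<^sup>-\<^sup>1 Qsum\<close>, those with none
  \<open>\<epsilon>\<^sup>t Rsum\<close>.\<close>

definition Zset :: "nat \<Rightarrow> nat \<Rightarrow> ((nat \<Rightarrow> int) \<times> (nat \<Rightarrow> int)) set" where
  "Zset n i = {\<Xi> \<in> pairs n. \<Xi> \<noteq> (zero_vec p n, zero_vec p n) \<and> pt n \<Xi> i = zero_vec p n}"

definition Qsum :: "nat \<Rightarrow> ((nat \<Rightarrow> int) \<Rightarrow> complex) \<Rightarrow> complex" where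
  "Qsum n z = (\<Sum>i<t. \<Sum>\<Xi>\<in>Zset n i. \<Prod>j\<in>{..<t}-{i}. z (pt n \<Xi> j))"

definition Rsum :: "nat \<Rightarrow> ((nat \<Rightarrow> int) \<Rightarrow> complex) \<Rightarrow> complex" where
  "Rsum n z = (\<Sum>\<Xi>\<in>pairs n. \<Prod>i<t. z (pt n \<Xi> i))"

lemma finite_Zset [simp]: "finite (Zset n i)"
  by (simp add: Zset_def)

lemma pt_zero: "pt n (zero_vec p n, zero_vec p n) i = zero_vec p n"
  by (auto simp: pt_def intro: red_cong)

lemma Zset_pt_nonzero:
  assumes "\<Xi> \<in> Zset n i" "i < t" "j < t" "j \<noteq> i"
  shows "pt n \<Xi> j \<noteq> zero_vec p n"
proof
  assume "pt n \<Xi> j = zero_vec p n"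
  then have "\<Xi> = (zero_vec p n, zero_vec p n)"
    using assms by (intro pt_inj[of _ n _ i j]) (auto simp: Zset_def pt_zero)
  then show False using assms by (simp add: Zset_def)
qed

lemma T_count_perturb:
  assumes z0: "z (zero_vec p n) = 0"
  shows "T_count p t D \<Psi> n (\<lambda>y. c + e * trig p n z y) = c ^ t + c * e ^ (t - 1) * Qsum n z + e ^ t * Rsum n z"
proof -
  let ?o = "zero_vec p n"
  define w where "w = (\<lambda>a. if a = ?o then c else e * z a)"
  let ?F = "\<lambda>\<Xi>. \<Prod>i<t. w (pt n \<Xi> i)"
  let ?O = "(?o, ?o)"
  let ?G = "{\<Xi> \<in> pairs n. \<forall>i<t. pt n \<Xi> i \<noteq> ?o}"
  have "T_count p t D \<Psi> n (\<lambda>y. c + e * trig p n z y) = (\<Sum>\<Xi>\<in>pairs n. ?F \<Xi>)"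
  proof -
    have "trig p n w = (\<lambda>y. c + e * trig p n z y)"
      unfolding w_def by (rule ext) (rule trig_perturb[of p z n c e, OF p_pos z0])
    then show ?thesis using T_count_trig[of n w] by simp
  qed
  \<comment> \<open>Three disjoint classes: the zero pair, the pairs with exactly one vanishing
    combination, and those with none.\<close>
  also have "pairs n = insert ?O ((\<Union>i\<in>{..<t}. Zset n i) \<union> ?G)"
    by (auto simp: Zset_def)
  also have "sum ?F \<dots> = ?F ?O + (sum ?F (\<Union>i\<in>{..<t}. Zset n i) + sum ?F ?G)"
  proof -
    have "?O \<notin> (\<Union>i\<in>{..<t}. Zset n i) \<union> ?G"
      using two_le_t by (auto simp: Zset_def pt_zero intro!: exI[of _ "0::nat"])
    moreover have "(\<Union>i\<in>{..<t}. Zset n i) \<inter> ?G = {}" by (auto simp: Zset_def)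
    ultimately show ?thesis by (subst sum.insert) (auto intro!: sum.union_disjoint)
  qed
  also have "?F ?O = c ^ t" by (simp add: pt_zero w_def)
  also have "sum ?F (\<Union>i\<in>{..<t}. Zset n i) = (\<Sum>i<t. sum ?F (Zset n i))"
  proof (rule sum.UNION_disjoint)
    show "\<forall>i\<in>{..<t}. \<forall>j\<in>{..<t}. i \<noteq> j \<longrightarrow> Zset n i \<inter> Zset n j = {}"
      using Zset_pt_nonzero by (fastforce simp: Zset_def)
  qed auto
  also have "\<dots> = c * e ^ (t - 1) * Qsum n z"
  proof -
    have "?F \<Xi> = c * e ^ (t - 1) * (\<Prod>j\<in>{..<t}-{i}. z (pt n \<Xi> j))" if "i < t" "\<Xi> \<in> Zset n i" for i \<Xi>
    proof -
      have "?F \<Xi> = w (pt n \<Xi> i) * (\<Prod>j\<in>{..<t}-{i}. w (pt n \<Xi> j))"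
        using that by (subst prod.remove[of _ i]) auto
      also have "w (pt n \<Xi> i) = c" using that by (simp add: w_def Zset_def)
      also have "(\<Prod>j\<in>{..<t}-{i}. w (pt n \<Xi> j)) = (\<Prod>j\<in>{..<t}-{i}. e * z (pt n \<Xi> j))"
        using Zset_pt_nonzero[OF that(2,1)] by (intro prod.cong) (auto simp: w_def)
      finally show ?thesis using that by (simp add: prod.distrib card_Diff_singleton)
    qed
    then show ?thesis by (simp add: Qsum_def sum_distrib_left)
  qed
  also have "sum ?F ?G = e ^ t * Rsum n z"
  proof -
    have "sum ?F ?G = (\<Sum>\<Xi>\<in>?G. e ^ t * (\<Prod>i<t. z (pt n \<Xi> i)))"
      by (intro sum.cong refl) (simp add: w_def prod.distrib)
    \<comment> \<open>The additional pairs contribute 0 since \<open>z\<close> vanishes at frequency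
      zero.\<close>
    also have "\<dots> = (\<Sum>\<Xi>\<in>pairs n. e ^ t * (\<Prod>i<t. z (pt n \<Xi> i)))"
    proof (rule sum.mono_neutral_left)
      show "\<forall>\<Xi>\<in>pairs n - ?G. e ^ t * (\<Prod>i<t. z (pt n \<Xi> i)) = 0"
      proof
        fix \<Xi> assume "\<Xi> \<in> pairs n - ?G"
        then obtain i where "i < t" "pt n \<Xi> i = ?o" by auto
        then show "e ^ t * (\<Prod>i<t. z (pt n \<Xi> i)) = 0" using z0 by (auto intro!: bexI[of _ i])
      qed
    qed auto
    finally show ?thesis by (simp add: Rsum_def sum_distrib_left)
  qed
  finally show ?thesis by (simp add: algebra_simps)
qed

section \<open>Criteria for failing the two local conditions\<close>

lemma T_count_Re_trig:
  assumes "z (zero_vec p n) = 0" "hermitian p n z"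
  shows "T_count p t D \<Psi> n (\<lambda>y. c + e * Re (trig p n z y)) =
    c ^ t + c * e ^ (t - 1) * Re (Qsum n z) + e ^ t * Re (Rsum n z)"
proof -
  have "complex_of_real (T_count p t D \<Psi> n (\<lambda>y. c + e * Re (trig p n z y))) =
      of_real c ^ t + of_real c * of_real e ^ (t - 1) * Qsum n z + of_real e ^ t * Rsum n z"
    unfolding T_count_of_real using T_count_perturb[of z n "of_real c" "of_real e"] assms
    by (simp add: trig_real)
  then have "T_count p t D \<Psi> n (\<lambda>y. c + e * Re (trig p n z y)) =
      Re (of_real (c ^ t) + of_real (c * e ^ (t - 1)) * Qsum n z + of_real (e ^ t) * Rsum n z)"
    by (metis Re_complex_of_real of_real_mult of_real_power)
  then show ?thesis by simp
qed

text \<open>At density 1/2 and amplitude \<open>e\<close> the excess over (1/2)^t is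
  \<open>e ^ (t - 1) * (q / 2 + e * r)\<close>, where q and r are the real parts of
  \<open>Qsum\<close> and \<open>Rsum\<close>. For small \<open>e\<close> its sign is that of q, or
  that of r if q vanishes.\<close>

lemma not_weakly_if:
  assumes n: "n \<ge> 1" and z: "z (zero_vec p n) = 0" "hermitian p n z"
    and neg: "Re (Qsum n z) < 0 \<or> (Re (Qsum n z) = 0 \<and> Re (Rsum n z) < 0)"
  shows "\<not> weakly_locally_Sidorenko p t D \<Psi>"
proof
  assume W: "weakly_locally_Sidorenko p t D \<Psi>"
  \<comment> \<open>The sum of the moduli of the coefficients bounds the function; the summand 1
    keeps \<open>B\<close> positive when \<open>z\<close> vanishes.\<close>
  define B where "B = 1 + (\<Sum>a\<in>Fp_vec p n. norm (z a))"
  have B: "B > 0" by (simp add: B_def add_pos_nonneg sum_nonneg)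
  have "norm (trig p n z y) \<le> B" for y
  proof -
    have "norm (trig p n z y) \<le> (\<Sum>a\<in>Fp_vec p n. norm (z a * ep p (\<Sum>k<n. a k * y k)))"
      unfolding trig_def by (rule norm_sum)
    then show ?thesis by (simp add: B_def norm_mult)
  qed
  then have "admissible p n (1/2) (\<lambda>y. Re (trig p n z y) / (2 * B))"
    using B z by (intro admissible_trig) auto
  then have "\<exists>d>0. \<forall>\<epsilon>. 0 < \<epsilon> \<and> \<epsilon> < d \<longrightarrow>
      T_count p t D \<Psi> n (\<lambda>y. 1/2 + \<epsilon> * (Re (trig p n z y) / (2 * B))) \<ge> (1/2) ^ t"
    using W[unfolded weakly_locally_Sidorenko_def, rule_format, OF n, of "1/2" "\<lambda>y. Re (trig p n z y) / (2 * B)"]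
    by simp
  then obtain d where d: "d > 0" and
    T: "\<And>\<epsilon>. 0 < \<epsilon> \<Longrightarrow> \<epsilon> < d \<Longrightarrow>
      T_count p t D \<Psi> n (\<lambda>y. 1/2 + \<epsilon> * (Re (trig p n z y) / (2 * B))) \<ge> (1/2) ^ t"
    by blast
  define q r where "q = Re (Qsum n z)" and "r = Re (Rsum n z)"
  obtain e where e: "0 < e" "2 * B * e < d" "q / 2 + e * r < 0"
  proof (cases "q < 0")
    case True
    \<comment> \<open>The first bound gives \<open>2 * B * e < d\<close>, the second gives
      \<open>e * \<bar>r\<bar> \<le> - q / 4\<close>.\<close>
    define e where "e = min (d / (4 * B)) (- q / (4 * (\<bar>r\<bar> + 1)))"
    have e0: "0 < e" using True d B by (simp add: e_def field_simps add_pos_nonneg)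
    have "e \<le> d / (4 * B)" by (simp add: e_def)
    then have "4 * B * e \<le> d" using B by (simp add: field_simps)
    moreover have "2 * B * e > 0" using B e0 by simp
    ultimately have e1: "2 * B * e < d" by linarith
    have "e \<le> - q / (4 * (\<bar>r\<bar> + 1))" by (simp add: e_def)
    then have "4 * e * (\<bar>r\<bar> + 1) \<le> - q" by (simp add: field_simps)
    moreover have "e * r \<le> e * (\<bar>r\<bar> + 1)" using e0 by (intro mult_left_mono) auto
    ultimately have "q / 2 + e * r < 0" using True by linarith
    then show ?thesis using that e0 e1 by blast
  next
    case False
    then have "q = 0" "r < 0" using neg by (auto simp: q_def r_def)
    then show ?thesis using that[of "d / (4 * B)"] d B by (simp add: mult_pos_neg field_simps)
  qed
  have "(1/2) ^ t \<le> T_count p t D \<Psi> n (\<lambda>y. 1/2 + (2 * B * e) * (Re (trig p n z y) / (2 * B)))"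
    using e B by (intro T) auto
  also have "\<dots> = T_count p t D \<Psi> n (\<lambda>y. 1/2 + e * Re (trig p n z y))"
    using B by (simp add: mult.assoc)
  also have "\<dots> = (1/2) ^ t + e ^ (t - 1) * (q / 2 + e * r)"
  proof -
    have "e ^ t = e ^ (t - 1) * e" using two_le_t by (simp flip: power_Suc2)
    then show ?thesis by (simp add: T_count_Re_trig z q_def r_def algebra_simps)
  qed
  also have "\<dots> < (1/2) ^ t" using e by (simp add: mult_pos_neg)
  finally show False by simp
qed

text \<open>Here \<open>\<epsilon>\<close> is fixed and the dimension may depend on it, so the
  quality of the sup bound \<open>B\<close> matters: the admissible function is \<open>trig\<close>
  divided by \<open>2 * B\<close>, and the amplitude in front of \<open>trig\<close> becomes
  \<open>\<epsilon> / (2 * B)\<close>.\<close>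

lemma not_locally_if:
  assumes "\<And>\<epsilon>::real. \<epsilon> > 0 \<Longrightarrow> \<exists>n\<ge>1. \<exists>z B. z (zero_vec p n) = 0 \<and> hermitian p n z \<and> B > 0 \<and>
      (\<forall>y. norm (trig p n z y) \<le> B) \<and> B * Re (Qsum n z) + \<epsilon> * Re (Rsum n z) < 0"
  shows "\<not> locally_Sidorenko p t D \<Psi>"
proof
  assume "locally_Sidorenko p t D \<Psi>"
  then have "\<exists>\<epsilon>>0. \<forall>n\<ge>1. \<forall>f. admissible p n (1/2) f \<longrightarrow>
      T_count p t D \<Psi> n (\<lambda>x. 1/2 + \<epsilon> * f x) \<ge> (1/2) ^ t"
    unfolding locally_Sidorenko_def by (rule bspec) simp
  then obtain \<epsilon> where \<epsilon>: "\<epsilon> > 0" and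
    T: "\<And>n f. n \<ge> 1 \<Longrightarrow> admissible p n (1/2) f \<Longrightarrow> T_count p t D \<Psi> n (\<lambda>y. 1/2 + \<epsilon> * f y) \<ge> (1/2) ^ t"
    by blast
  from assms[OF \<epsilon>] obtain n z B where n: "n \<ge> 1" and z: "z (zero_vec p n) = 0" "hermitian p n z"
    and B: "B > 0" "\<And>y. norm (trig p n z y) \<le> B" and neg: "B * Re (Qsum n z) + \<epsilon> * Re (Rsum n z) < 0"
    by blast
  define e where "e = \<epsilon> / (2 * B)"
  have e: "e > 0" using \<epsilon> B by (simp add: e_def)
  have "(1/2) ^ t \<le> T_count p t D \<Psi> n (\<lambda>y. 1/2 + \<epsilon> * (Re (trig p n z y) / (2 * B)))"
    using n z B by (intro T admissible_trig) auto
  also have "\<dots> = T_count p t D \<Psi> n (\<lambda>y. 1/2 + e * Re (trig p n z y))"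
    by (simp add: e_def)
  also have "\<dots> = (1/2) ^ t + e ^ (t - 1) * (Re (Qsum n z) / 2 + e * Re (Rsum n z))"
  proof -
    have "e ^ t = e ^ (t - 1) * e" using two_le_t by (simp flip: power_Suc2)
    then show ?thesis by (simp add: T_count_Re_trig z algebra_simps)
  qed
  also have "Re (Qsum n z) / 2 + e * Re (Rsum n z) = (B * Re (Qsum n z) + \<epsilon> * Re (Rsum n z)) / (2 * B)"
    using B by (simp add: e_def field_simps)
  also have "(1/2) ^ t + e ^ (t - 1) * \<dots> < (1/2) ^ t"
    using neg e B by (simp add: mult_pos_neg divide_neg_pos)
  finally show False by simp
qed

end

text \<open>The interval of admissible values contains 0, so \<open>f\<close> may be scaled by
  \<open>\<epsilon> / d\<close>; the constant \<open>d\<close> applied to the scaled function covers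
  every smaller \<open>\<epsilon>\<close>.\<close>

lemma locally_imp_weakly:
  assumes "locally_Sidorenko p t D \<Psi>"
  shows "weakly_locally_Sidorenko p t D \<Psi>"
  unfolding weakly_locally_Sidorenko_def
proof (intro allI impI ballI)
  fix n :: nat and \<alpha> :: real and f
  assume n: "1 \<le> n" and \<alpha>: "\<alpha> \<in> {0..1}" and f: "admissible p n \<alpha> f"
  obtain d where d: "d > 0" and
    T: "\<And>f. admissible p n \<alpha> f \<Longrightarrow> T_count p t D \<Psi> n (\<lambda>x. \<alpha> + d * f x) \<ge> \<alpha> ^ t"
    using assms n \<alpha> unfolding locally_Sidorenko_def by metis
  show "\<exists>\<epsilon>f>0. \<forall>\<epsilon>. 0 < \<epsilon> \<and> \<epsilon> < \<epsilon>f \<longrightarrow> T_count p t D \<Psi> n (\<lambda>x. \<alpha> + \<epsilon> * f x) \<ge> \<alpha> ^ t"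
  proof (intro exI[of _ d] conjI d allI impI)
    fix \<epsilon> assume \<epsilon>: "0 < \<epsilon> \<and> \<epsilon> < d"
    have "admissible p n \<alpha> (\<lambda>x. \<epsilon> / d * f x)"
      unfolding admissible_def
    proof (intro conjI ballI)
      fix x assume "x \<in> Fp_vec p n"
      then have fx: "- \<alpha> \<le> f x" "f x \<le> 1 - \<alpha>" using f by (auto simp: admissible_def)
      have s: "0 \<le> \<epsilon> / d" "\<epsilon> / d \<le> 1" using \<epsilon> d by auto
      have "\<epsilon> / d * f x \<le> \<epsilon> / d * (1 - \<alpha>)" using fx s by (intro mult_left_mono) auto
      also have "\<dots> \<le> 1 - \<alpha>" using s \<alpha> by (intro mult_left_le_one_le) auto
      finally have 1: "\<epsilon> / d * f x \<le> 1 - \<alpha>" .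
      have "\<epsilon> / d * (- f x) \<le> \<epsilon> / d * \<alpha>" using fx s by (intro mult_left_mono) auto
      also have "\<dots> \<le> \<alpha>" using s \<alpha> by (intro mult_left_le_one_le) auto
      finally show "\<epsilon> / d * f x \<in> {- \<alpha>..1 - \<alpha>}" using 1 by simp
    next
      show "average p n (\<lambda>x. \<epsilon> / d * f x) = 0"
        using f by (auto simp: admissible_def average_def simp flip: sum_divide_distrib sum_distrib_left)
    qed
    from T[OF this] show "T_count p t D \<Psi> n (\<lambda>x. \<alpha> + \<epsilon> * f x) \<ge> \<alpha> ^ t" using d by simp
  qed
qed

text \<open>The choice \<open>\<epsilon> = 1\<close> works since \<open>\<alpha> + f\<close> takes
  values in [0, 1] and has mean \<open>\<alpha>\<close>.\<close>

lemma Sidorenko_imp_locally: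
  assumes "p > 0" "Sidorenko p t D \<Psi>"
  shows "locally_Sidorenko p t D \<Psi>"
  unfolding locally_Sidorenko_def
proof (intro ballI exI[of _ "1::real"] conjI allI impI)
  fix \<alpha> :: real and n :: nat and f
  assume n: "1 \<le> n" and f: "admissible p n \<alpha> f"
  have "average p n (\<lambda>x. \<alpha> + 1 * f x) = \<alpha>"
    using f assms(1) by (simp add: admissible_def average_def sum.distrib card_Fp_vec)
  moreover have "\<forall>x\<in>Fp_vec p n. \<alpha> + 1 * f x \<in> {0..1}" using f by (auto simp: admissible_def)
  ultimately show "T_count p t D \<Psi> n (\<lambda>x. \<alpha> + 1 * f x) \<ge> \<alpha> ^ t"
    using assms(2) n unfolding Sidorenko_def by metis
qed simp

subsection \<open>Even systems and additive tuples\<close>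

text \<open>Phrased as an equivalence over the representatives, so that sums of indicators of
  congruences collapse to one term.\<close>

lemma solve_linear_mod:
  fixes x y :: int
  assumes "prime p" "\<not> int p dvd x"
  obtains d where "d \<in> {0..<int p}" "\<And>l. l \<in> {0..<int p} \<Longrightarrow> [x * l = y] (mod int p) \<longleftrightarrow> l = d"
proof -
  have pr: "Factorial_Ring.prime (int p)" using assms by simp
  have p: "p > 0" using assms(1) by (simp add: prime_gt_0_nat)
  have "coprime x (int p)" using prime_imp_coprime[OF pr assms(2)] by (simp add: coprime_commute)
  then obtain e where e: "[x * e = 1] (mod int p)" using cong_solve_coprime_int by blast
  define d where "d = (e * y) mod int p"
  have d: "d \<in> {0..<int p}" using p by (simp add: d_def)
  have "[x * d = x * (e * y)] (mod int p)" by (intro cong_mult cong_refl) (simp add: d_def cong_def)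
  also have "x * (e * y) = (x * e) * y" by simp
  also have "[(x * e) * y = 1 * y] (mod int p)" by (intro cong_mult cong_refl e)
  finally have xd: "[x * d = y] (mod int p)" by simp
  have "l = d" if l: "l \<in> {0..<int p}" "[x * l = y] (mod int p)" for l
  proof -
    have "[x * l = x * d] (mod int p)" using l(2) xd cong_sym cong_trans by blast
    then have "int p dvd x * (l - d)" by (simp add: cong_iff_dvd_diff algebra_simps)
    then have "[l = d] (mod int p)"
      using assms(2) prime_dvd_mult_iff[OF pr] by (simp add: cong_iff_dvd_diff)
    then show ?thesis using l(1) d by (simp add: cong_def)
  qed
  then show ?thesis using that[OF d] xd by blast
qed

text \<open>The vectors (a, b) and (A, B) are both orthogonal to a nonzero vector, hence
  proportional. This later supplies the missing coordinate of a kernel vector.\<close>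

lemma dependent_scalar:
  fixes a b A B \<xi> \<eta> :: int
  assumes "prime p" "int p dvd \<xi> * a + \<eta> * b" "int p dvd \<xi> * A + \<eta> * B"
    "\<not> int p dvd \<xi> \<or> \<not> int p dvd \<eta>" "\<not> int p dvd a \<or> \<not> int p dvd b"
  shows "\<exists>y. int p dvd a * y + A \<and> int p dvd b * y + B"
proof -
  have pr: "Factorial_Ring.prime (int p)" using assms by simp
  have "\<xi> * (a * B - b * A) = B * (\<xi> * a + \<eta> * b) - b * (\<xi> * A + \<eta> * B)"
    "\<eta> * (a * B - b * A) = a * (\<xi> * A + \<eta> * B) - A * (\<xi> * a + \<eta> * b)"
    by (simp_all add: algebra_simps)
  then have "int p dvd \<xi> * (a * B - b * A)" "int p dvd \<eta> * (a * B - b * A)"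
    using assms(2,3) by auto
  then have det: "int p dvd a * B - b * A"
    using assms(4) prime_dvd_mult_iff[OF pr] by blast
  show ?thesis
  proof (cases "int p dvd a")
    case False
    obtain y where y: "y \<in> {0..<int p}" "\<And>l. l \<in> {0..<int p} \<Longrightarrow> [a * l = - A] (mod int p) \<longleftrightarrow> l = y"
      using solve_linear_mod[OF assms(1) False] by blast
    then have y1: "int p dvd a * y + A" using y(2)[OF y(1)] by (simp add: cong_iff_dvd_diff)
    have "a * (b * y + B) = b * (a * y + A) + (a * B - b * A)" by (simp add: algebra_simps)
    then have "int p dvd a * (b * y + B)" using y1 det by simp
    then show ?thesis using y1 False prime_dvd_mult_iff[OF pr] by blast
  next
    case True
    then have F: "\<not> int p dvd b" using assms(5) by blast
    obtain y where y: "y \<in> {0..<int p}" "\<And>l. l \<in> {0..<int p} \<Longrightarrow> [b * l = - B] (mod int p) \<longleftrightarrow> l = y"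
      using solve_linear_mod[OF assms(1) F] by blast
    then have y1: "int p dvd b * y + B" using y(2)[OF y(1)] by (simp add: cong_iff_dvd_diff)
    have "b * (a * y + A) = a * (b * y + B) - (a * B - b * A)" by (simp add: algebra_simps)
    then have "int p dvd b * (a * y + A)" using y1 det by simp
    then show ?thesis using y1 F prime_dvd_mult_iff[OF pr] by blast
  qed
qed

lemma sum_diff_delta:
  assumes "finite I" "a \<in> I" "b \<in> I" "c \<in> I" "d \<in> I"
  shows "(\<Sum>l\<in>I. (of_bool (l = a) - of_bool (l = b)) * (of_bool (l = c) - of_bool (l = d) :: real)) =
    of_bool (a = c) - of_bool (a = d) - of_bool (b = c) + of_bool (b = d)"
proof -
  have *: "(\<Sum>l\<in>I. of_bool (l = u) * of_bool (l = v) :: real) = of_bool (u = v)" if "u \<in> I" for u v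
  proof -
    have "(\<Sum>l\<in>I. of_bool (l = u) * of_bool (l = v) :: real) = (\<Sum>l\<in>I. if l = u then of_bool (u = v) else 0)"
      by (intro sum.cong) auto
    then show ?thesis using that assms(1) by simp
  qed
  show ?thesis
    using assms by (simp add: algebra_simps sum.distrib sum_subtractf *)
qed

text \<open>Supplies the test function for three forms: \<open>x\<close>, \<open>y\<close>, \<open>z\<close> are the coordinates, in some order,
  of a vector spanning the image. The sign of \<open>S3\<close> does not matter since \<open>g\<close> may be negated.\<close>

lemma point_mass_difference:
  fixes x y z :: int
  assumes p: "prime p" and x: "\<not> int p dvd x" and y: "\<not> int p dvd y" and z: "\<not> int p dvd z"
    and xy: "\<not> [x = y] (mod int p)"
  defines "g \<equiv> \<lambda>c. of_bool [c = x] (mod int p) - of_bool [c = y] (mod int p) :: real"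
  defines "S2 \<equiv> \<Sum>l\<in>{0..<int p}. g (x * l) * g (y * l) + g (x * l) * g (z * l) + g (y * l) * g (z * l)"
  defines "S3 \<equiv> \<Sum>l\<in>{0..<int p}. g (x * l) * g (y * l) * g (z * l)"
  shows "S2 < 0 \<or> S2 = 0 \<and> S3 \<noteq> 0"
proof -
  let ?I = "{0..<int p}"
  have pr: "Factorial_Ring.prime (int p)" using p by simp
  \<comment> \<open>Modulo p these are y/x, x/y and, below, x/z and y/z: the parameters at which the
    point masses at \<open>x\<close> and \<open>y\<close> are hit along the line.\<close>
  obtain d where d: "d \<in> ?I" "\<And>l. l \<in> ?I \<Longrightarrow> [x * l = y] (mod int p) \<longleftrightarrow> l = d"
    using solve_linear_mod[OF p x] by blast
  obtain d' where d': "d' \<in> ?I" "\<And>l. l \<in> ?I \<Longrightarrow> [y * l = x] (mod int p) \<longleftrightarrow> l = d'"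
    using solve_linear_mod[OF p y] by blast
  obtain c where c: "c \<in> ?I" "\<And>l. l \<in> ?I \<Longrightarrow> [z * l = x] (mod int p) \<longleftrightarrow> l = c"
    using solve_linear_mod[OF p z] by blast
  obtain c' where c': "c' \<in> ?I" "\<And>l. l \<in> ?I \<Longrightarrow> [z * l = y] (mod int p) \<longleftrightarrow> l = c'"
    using solve_linear_mod[OF p z] by blast
  have one: "1 \<in> ?I" using prime_gt_1_nat[OF p] by simp
  have xx: "[x * l = x] (mod int p) \<longleftrightarrow> l = 1" if "l \<in> ?I" for l
    using solve_linear_mod[OF p x, of x] one that by (metis cong_refl mult.right_neutral)
  have yy: "[y * l = y] (mod int p) \<longleftrightarrow> l = 1" if "l \<in> ?I" for l
    using solve_linear_mod[OF p y, of y] one that by (metis cong_refl mult.right_neutral)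
  have d1: "d \<noteq> 1" using d(2)[OF one] xy by auto
  have d'1: "d' \<noteq> 1" using d'(2)[OF one] xy by (auto dest: cong_sym)
  have cc: "c \<noteq> c'" using c c' xy cong_sym cong_trans by blast
  \<comment> \<open>Both sides say that z = x modulo p; in the same way \<open>c'1\<close> is about
    z = y.\<close>
  have c1: "c = 1 \<longleftrightarrow> c' = d"
  proof
    assume "c = 1"
    then have "[z = x] (mod int p)" using c(2)[OF one] by simp
    then have "[z * d = x * d] (mod int p)" by (intro cong_mult cong_refl)
    then show "c' = d" using d c' cong_trans by blast
  next
    assume "c' = d"
    then have "[z * d = y] (mod int p)" "[x * d = y] (mod int p)" using d c' by auto
    then have "[z * d = x * d] (mod int p)" using cong_sym cong_trans by blast
    then have "int p dvd (z - x) * d" by (simp add: cong_iff_dvd_diff algebra_simps)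
    moreover have "\<not> int p dvd d"
      using y \<open>[x * d = y] (mod int p)\<close> by (metis cong_dvd_iff dvd_mult)
    ultimately have "[z * 1 = x] (mod int p)"
      using prime_dvd_mult_iff[OF pr] by (auto simp: cong_iff_dvd_diff)
    then show "c = 1" using c(2)[OF one] by simp
  qed
  have c'1: "c' = 1 \<longleftrightarrow> c = d'"
  proof
    assume "c' = 1"
    then have "[z = y] (mod int p)" using c'(2)[OF one] by simp
    then have "[z * d' = y * d'] (mod int p)" by (intro cong_mult cong_refl)
    then show "c = d'" using d' c cong_trans by blast
  next
    assume "c = d'"
    then have "[z * d' = x] (mod int p)" "[y * d' = x] (mod int p)" using d' c by auto
    then have "[z * d' = y * d'] (mod int p)" using cong_sym cong_trans by blast
    then have "int p dvd (z - y) * d'" by (simp add: cong_iff_dvd_diff algebra_simps)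
    moreover have "\<not> int p dvd d'"
      using x \<open>[y * d' = x] (mod int p)\<close> by (metis cong_dvd_iff dvd_mult)
    ultimately have "[z * 1 = y] (mod int p)"
      using prime_dvd_mult_iff[OF pr] by (auto simp: cong_iff_dvd_diff)
    then show "c' = 1" using c'(2)[OF one] by simp
  qed
  have g1: "g (x * l) = of_bool (l = 1) - of_bool (l = d)" if "l \<in> ?I" for l
    using that by (simp add: g_def xx d)
  have g2: "g (y * l) = of_bool (l = d') - of_bool (l = 1)" if "l \<in> ?I" for l
    using that by (simp add: g_def yy d')
  have g3: "g (z * l) = of_bool (l = c) - of_bool (l = c')" if "l \<in> ?I" for l
    using that by (simp add: g_def c c')
  \<comment> \<open>Inner products of differences of point masses. The coincidences
    \<open>1 = c\<close> and \<open>1 = c'\<close> cancel between the two sums involving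
    \<open>z\<close>.\<close>
  have S2: "S2 = - 1 - of_bool (d = d') - of_bool (d = c) + of_bool (d = c') + of_bool (d' = c) - of_bool (d' = c')"
  proof -
    have fin: "finite ?I" by simp
    have "(\<Sum>l\<in>?I. g (x * l) * g (y * l)) =
        of_bool (1 = d') - of_bool ((1::int) = 1) - of_bool (d = d') + of_bool (d = 1)"
      unfolding sum_diff_delta[OF fin one d(1) d'(1) one, symmetric] by (intro sum.cong refl) (simp only: g1 g2)
    moreover have "(\<Sum>l\<in>?I. g (x * l) * g (z * l)) =
        of_bool (1 = c) - of_bool (1 = c') - of_bool (d = c) + of_bool (d = c')"
      unfolding sum_diff_delta[OF fin one d(1) c(1) c'(1), symmetric] by (intro sum.cong refl) (simp only: g1 g3)
    moreover have "(\<Sum>l\<in>?I. g (y * l) * g (z * l)) =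
        of_bool (d' = c) - of_bool (d' = c') - of_bool (1 = c) + of_bool (1 = c')"
      unfolding sum_diff_delta[OF fin d'(1) one c(1) c'(1), symmetric] by (intro sum.cong refl) (simp only: g2 g3)
    ultimately show ?thesis using d1 d'1 by (simp add: S2_def sum.distrib)
  qed
  show ?thesis
  \<comment> \<open>If d = d' then \<open>S2 = - 2\<close>. Otherwise only z = x or z = y can raise
    \<open>S2\<close> from a negative value to 0, and then exactly one term of \<open>S3\<close>
    survives.\<close>
  proof (cases "d = d'")
    case True
    then show ?thesis using S2 cc c1 c'1 d1 by (auto simp: of_bool_def)
  next
    case False
    show ?thesis
    proof (cases "c = 1 \<or> c' = 1")
      case no: False
      then show ?thesis using S2 c1 c'1 by (auto simp: of_bool_def)
    next
      case yes: True
      then consider "c = 1" "c' = d" | "c' = 1" "c = d'" using c1 c'1 by auto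
      then show ?thesis
      proof cases
        case 1
        have "S3 = (\<Sum>l\<in>?I. - of_bool (l = 1))"
          unfolding S3_def using 1 False d1 d'1 by (intro sum.cong refl) (auto simp: g1 g2 g3)
        also have "\<dots> = - 1" using one by (simp add: sum_negf of_bool_def)
        finally show ?thesis using S2 1 False d1 d'1 by (auto simp: of_bool_def)
      next
        case 2
        have "S3 = (\<Sum>l\<in>?I. of_bool (l = 1))"
          unfolding S3_def using 2 False d1 d'1 by (intro sum.cong refl) (auto simp: g1 g2 g3)
        also have "\<dots> = 1" using one by (simp add: of_bool_def)
        finally show ?thesis using S2 2 False d1 d'1 by (auto simp: of_bool_def)
      qed
    qed
  qed
qed

lemma neg_eq_zero_vec_iff:
  assumes "p > 0" "a \<in> Fp_vec p n"
  shows "red p n (\<lambda>k. - a k) = zero_vec p n \<longleftrightarrow> a = zero_vec p n"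
proof -
  have "a = zero_vec p n \<longleftrightarrow> red p n a = zero_vec p n" using assms by simp
  then show ?thesis unfolding red_eq_iff by (simp add: cong_0_iff)
qed

context generic_system begin

lemma pt_red: "pt n (red p n a, red p n b) i = red p n (\<lambda>k. M 0 i * a k + M 1 i * b k)"
  unfolding pt_def by (intro red_cong cong_add cong_mult cong_refl) (simp_all add: cong_def)

lemma column_nonzero: "i < t \<Longrightarrow> \<not> (int p dvd M 0 i \<and> int p dvd M 1 i)"
proof
  assume i: "i < t" and d: "int p dvd M 0 i \<and> int p dvd M 1 i"
  obtain j where j: "j < t" "j \<noteq> i"
    using two_le_t by (metis less_le_trans one_less_numeral_iff pos2 semiring_norm(76) zero_neq_one)
  have "int p dvd minor i j" using d by (auto simp: minor_def)
  then show False using minor_ndvd[of i j] i j by auto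
qed

text \<open>The coefficient -1 at all nonzero frequencies gives a negated, centered point mass. For
  even t each product in \<open>Qsum\<close> has an odd number of factors -1, so \<open>Qsum\<close>
  is minus the number of its terms.\<close>

lemma weakly_imp_odd:
  assumes "weakly_locally_Sidorenko p t D \<Psi>"
  shows "odd t"
proof
  assume ev: "even t"
  define z where "z = (\<lambda>a. if a = zero_vec p 1 then 0 else - 1 :: complex)"
  have z0: "z (zero_vec p 1) = 0" by (simp add: z_def)
  have herm: "hermitian p 1 z"
    by (simp add: hermitian_def z_def neg_eq_zero_vec_iff)
  have prod: "(\<Prod>j\<in>{..<t}-{i}. z (pt 1 \<Xi> j)) = - 1" if "i < t" "\<Xi> \<in> Zset 1 i" for i \<Xi>
  proof -
    have "(\<Prod>j\<in>{..<t}-{i}. z (pt 1 \<Xi> j)) = (\<Prod>j\<in>{..<t}-{i}. - 1)"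
      using Zset_pt_nonzero[OF that(2,1)] by (intro prod.cong) (auto simp: z_def)
    also have "\<dots> = (- 1) ^ (t - 1)" using that by (simp add: card_Diff_singleton)
    also have "\<dots> = - 1" using ev two_le_t by simp
    finally show ?thesis .
  qed
  have "Qsum 1 z = (\<Sum>i<t. \<Sum>\<Xi>\<in>Zset 1 i. - 1)"
    unfolding Qsum_def by (intro sum.cong refl prod) auto
  then have Q: "Re (Qsum 1 z) = - (\<Sum>i<t. real (card (Zset 1 i)))"
    by (simp add: sum_negf)
  \<comment> \<open>The vector orthogonal to column 0 shows that there is at least one term.\<close>
  let ?\<Xi> = "(red p 1 (\<lambda>_. - M 1 0), red p 1 (\<lambda>_. M 0 0))"
  have "?\<Xi> \<noteq> (zero_vec p 1, zero_vec p 1)"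
    using column_nonzero[of 0] two_le_t by (auto simp: red_eq_iff cong_0_iff)
  then have "?\<Xi> \<in> Zset 1 0"
    by (auto simp: Zset_def pt_red algebra_simps)
  then have "card (Zset 1 0) > 0" by (auto simp: card_gt_0_iff)
  then have "(\<Sum>i<t. real (card (Zset 1 i))) > 0"
    using two_le_t by (intro sum_pos2[of _ 0]) auto
  then show False using not_weakly_if[of 1 z] z0 herm Q assms by simp
qed

text \<open>The combination of the rows of \<open>M\<close> with coefficients \<open>\<xi>\<close>
  and \<open>\<eta>\<close> is a relation of the forms that omits form i and has equally many signs
  of each kind. Up to scaling it is the only relation among the remaining forms, since coordinate i
  can always be solved for.\<close>

lemma additive_tuple_if:
  assumes i: "i < t" and zero: "int p dvd M 0 i * \<xi> + M 1 i * \<eta>"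
    and \<tau>: "\<And>j. j < t \<Longrightarrow> j \<noteq> i \<Longrightarrow> \<tau> j \<in> {1, -1} \<and> [M 0 j * \<xi> + M 1 j * \<eta> = \<tau> j] (mod int p)"
    and bal: "(\<Sum>j\<in>{..<t}-{i}. \<tau> j) = 0"
  shows "contains_additive_tuple p t D \<Psi> (t - 1)"
proof -
  let ?S = "{..<t} - {i}" and ?k = "t - 1"
  define Pl Mi where "Pl = {j\<in>?S. \<tau> j = 1}" and "Mi = {j\<in>?S. \<tau> j = - 1}"
  have S: "?S = Pl \<union> Mi" "Pl \<inter> Mi = {}" using \<tau> by (auto simp: Pl_def Mi_def)
  have fin: "finite Pl" "finite Mi" by (auto simp: Pl_def Mi_def)
  have "(\<Sum>j\<in>?S. \<tau> j) = (\<Sum>j\<in>Pl. \<tau> j) + (\<Sum>j\<in>Mi. \<tau> j)"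
    using S fin by (simp add: sum.union_disjoint)
  also have "\<dots> = int (card Pl) - int (card Mi)" by (simp add: Pl_def Mi_def)
  finally have eq: "card Mi = card Pl" using bal by simp
  define h where "h = card Pl"
  have k: "?k = 2 * h"
  proof -
    have "?k = card ?S" using i by (simp add: card_Diff_singleton)
    also have "\<dots> = card Pl + card Mi" by (simp only: S(1) card_Un_disjoint[OF fin S(2)])
    finally show ?thesis using eq by (simp add: h_def)
  qed
  note ks = k k[unfolded One_nat_def]
  obtain f where f: "bij_betw f {..<h} Pl"
    using ex_bij_betw_nat_finite[OF fin(1)] by (auto simp: h_def lessThan_atLeast0)
  obtain g where g: "bij_betw g {..<h} Mi"
    using ex_bij_betw_nat_finite[OF fin(2)] eq by (auto simp: h_def lessThan_atLeast0)
  \<comment> \<open>Even positions run through the indices with sign 1 and odd positions through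
    those with sign -1, which makes the signs alternate.\<close>
  define \<sigma> where "\<sigma> l = (if even l then f (l div 2) else g (l div 2))" for l :: nat
  have fP: "f u \<in> Pl" if "u < h" for u using f that by (auto simp: bij_betw_def)
  have gM: "g u \<in> Mi" if "u < h" for u using g that by (auto simp: bij_betw_def)
  have bij: "bij_betw \<sigma> {..<?k} ?S"
  proof (rule bij_betw_imageI)
    show "inj_on \<sigma> {..<?k}"
    proof (rule inj_onI)
      fix a b assume ab: "a \<in> {..<?k}" "b \<in> {..<?k}" "\<sigma> a = \<sigma> b"
      then have h: "a div 2 < h" "b div 2 < h" by (auto simp: ks)
      have "even a = even b"
        using ab(3) fP[OF h(1)] fP[OF h(2)] gM[OF h(1)] gM[OF h(2)] S(2)
        by (auto simp: \<sigma>_def split: if_splits)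
      moreover from this have "a div 2 = b div 2"
        using ab(3) h f g by (auto simp: \<sigma>_def bij_betw_def inj_on_def split: if_splits)
      ultimately show "a = b" by (metis bit_eq_rec)
    qed
    show "\<sigma> ` {..<?k} = ?S"
    proof
      show "\<sigma> ` {..<?k} \<subseteq> ?S"
      proof
        fix j assume "j \<in> \<sigma> ` {..<?k}"
        then obtain l where l: "l < ?k" "j = \<sigma> l" by auto
        then have "l div 2 < h" using ks by auto
        then have "j \<in> Pl \<union> Mi" using fP gM l(2) by (auto simp: \<sigma>_def)
        then show "j \<in> ?S" using S(1) by blast
      qed
      show "?S \<subseteq> \<sigma> ` {..<?k}"
      proof
        fix j assume "j \<in> ?S"
        then consider "j \<in> Pl" | "j \<in> Mi" using S by blast
        then show "j \<in> \<sigma> ` {..<?k}"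
        proof cases
          case 1
          then obtain u where "u < h" "j = f u" using f by (auto simp: bij_betw_def)
          then show ?thesis by (intro image_eqI[of _ _ "2 * u"]) (auto simp: \<sigma>_def ks)
        next
          case 2
          then obtain u where "u < h" "j = g u" using g by (auto simp: bij_betw_def)
          then show ?thesis by (intro image_eqI[of _ _ "2 * u + 1"]) (auto simp: \<sigma>_def ks)
        qed
      qed
    qed
  qed
  have sgn: "\<tau> (\<sigma> l) = (- 1) ^ l" if "l < ?k" for l
  proof -
    have "l div 2 < h" using that ks by auto
    then show ?thesis using fP[of "l div 2"] gM[of "l div 2"] by (auto simp: \<sigma>_def Pl_def Mi_def)
  qed
  have \<sigma>t: "\<sigma> l < t" if "l < ?k" for l using bij that by (auto simp: bij_betw_def)
  have comb: "[\<xi> * (\<Sum>j\<in>?S. M 0 j * y j) + \<eta> * (\<Sum>j\<in>?S. M 1 j * y j) = (\<Sum>l<?k. (- 1) ^ l * y (\<sigma> l))] (mod int p)" for y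
  proof -
    have "\<xi> * (\<Sum>j\<in>?S. M 0 j * y j) + \<eta> * (\<Sum>j\<in>?S. M 1 j * y j) = (\<Sum>j\<in>?S. (M 0 j * \<xi> + M 1 j * \<eta>) * y j)"
      by (simp add: sum_distrib_left algebra_simps flip: sum.distrib)
    also have "[\<dots> = (\<Sum>j\<in>?S. \<tau> j * y j)] (mod int p)"
      using \<tau> by (intro cong_sum cong_mult cong_refl) auto
    also have "(\<Sum>j\<in>?S. \<tau> j * y j) = (\<Sum>l<?k. \<tau> (\<sigma> l) * y (\<sigma> l))"
      using sum.reindex_bij_betw[OF bij, of "\<lambda>j. \<tau> j * y j"] by simp
    also have "\<dots> = (\<Sum>l<?k. (- 1) ^ l * y (\<sigma> l))" using sgn by (intro sum.cong) auto
    finally show ?thesis .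
  qed
  have split: "(\<Sum>j<t. M r j * y j) = M r i * y i + (\<Sum>j\<in>?S. M r j * y j)" for r y
    using i by (subst sum.remove[of _ i]) auto
  have joint: "joint_map p ?k D (\<lambda>l. \<Psi> (\<sigma> l)) x = (\<lambda>l\<in>{..<?k}. joint_map p t D \<Psi> x (\<sigma> l))" for x
    using \<sigma>t by (auto simp: joint_map_def intro!: restrict_ext)
  have "Im_forms p ?k D (\<lambda>l. \<Psi> (\<sigma> l)) = (\<lambda>y. \<lambda>l\<in>{..<?k}. y (\<sigma> l)) ` Im_forms p t D \<Psi>"
    unfolding Im_forms_def image_image joint ..
  also have "\<dots> = (\<lambda>y. \<lambda>l\<in>{..<?k}. y (\<sigma> l)) ` kernel_mat p t M"
    by (simp add: image_eq_kernel)
  also have "\<dots> = {y \<in> Fp_vec p ?k. [(\<Sum>l<?k. (-1) ^ l * y l) = 0] (mod int p)}"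
  proof (intro equalityI subsetI)
    fix u assume "u \<in> (\<lambda>y. \<lambda>l\<in>{..<?k}. y (\<sigma> l)) ` kernel_mat p t M"
    then obtain y where y: "y \<in> kernel_mat p t M" "u = (\<lambda>l\<in>{..<?k}. y (\<sigma> l))" by blast
    have "u \<in> Fp_vec p ?k"
      using y \<sigma>t by (auto simp: kernel_mat_def Fp_vec_def PiE_def Pi_def)
    moreover have "int p dvd (\<Sum>l<?k. (-1) ^ l * y (\<sigma> l))"
    proof -
      have ry: "int p dvd (\<Sum>j<t. M r j * y j)" if "r < 2" for r
        using y(1) that by (simp add: kernel_mat_def cong_0_iff)
      have "\<xi> * (\<Sum>j\<in>?S. M 0 j * y j) + \<eta> * (\<Sum>j\<in>?S. M 1 j * y j) =
          \<xi> * (\<Sum>j<t. M 0 j * y j) + \<eta> * (\<Sum>j<t. M 1 j * y j) - y i * (M 0 i * \<xi> + M 1 i * \<eta>)"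
        unfolding split by (simp only: algebra_simps)
      also have "int p dvd \<dots>" using ry[of 0] ry[of 1] zero by simp
      finally show ?thesis using comb[of y] cong_dvd_iff by blast
    qed
    moreover have "(\<Sum>l<?k. (-1) ^ l * u l) = (\<Sum>l<?k. (-1) ^ l * y (\<sigma> l))"
      by (simp add: y(2))
    ultimately show "u \<in> {y \<in> Fp_vec p ?k. [(\<Sum>l<?k. (-1) ^ l * y l) = 0] (mod int p)}"
      by (simp add: cong_0_iff)
  next
    fix u assume "u \<in> {y \<in> Fp_vec p ?k. [(\<Sum>l<?k. (-1) ^ l * y l) = 0] (mod int p)}"
    then have u: "u \<in> Fp_vec p ?k" "int p dvd (\<Sum>l<?k. (-1) ^ l * u l)" by (auto simp: cong_0_iff)
    define v where "v j = u (the_inv_into {..<?k} \<sigma> j)" for j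
    have v\<sigma>: "v (\<sigma> l) = u l" if "l < ?k" for l
      using bij that by (simp add: v_def bij_betw_def the_inv_into_f_f)
    have "int p dvd \<xi> * (\<Sum>j\<in>?S. M 0 j * v j) + \<eta> * (\<Sum>j\<in>?S. M 1 j * v j)"
    proof -
      have "(\<Sum>l<?k. (- 1) ^ l * v (\<sigma> l)) = (\<Sum>l<?k. (- 1) ^ l * u l)"
        using v\<sigma> by (intro sum.cong) auto
      then show ?thesis using comb[of v] u(2) cong_dvd_iff by metis
    qed
    \<comment> \<open>Otherwise all combinations vanish, whereas the one at an index other than i is
      1 or -1.\<close>
    moreover have "\<not> int p dvd \<xi> \<or> \<not> int p dvd \<eta>"
    proof (rule ccontr)
      assume "\<not> ?thesis"
      then have both: "int p dvd \<xi>" "int p dvd \<eta>" by auto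
      obtain j where j: "j < t" "j \<noteq> i"
        using two_le_t by (metis less_le_trans one_less_numeral_iff pos2 semiring_norm(76) zero_neq_one)
      have "int p dvd M 0 j * \<xi> + M 1 j * \<eta>" using both by simp
      then have "int p dvd \<tau> j" using \<tau>[OF j] cong_dvd_iff by blast
      then have "int p dvd 1" using \<tau>[OF j] by auto
      then show False using prime_int not_prime_unit by blast
    qed
    moreover have "int p dvd \<xi> * M 0 i + \<eta> * M 1 i" using zero by (simp add: mult.commute)
    \<comment> \<open>Column i and the vector of partial row sums are both orthogonal to the
      coefficient vector, so some value \<open>w\<close> of coordinate i completes \<open>v\<close>
      to a kernel vector.\<close>
    ultimately obtain w where w: "int p dvd M 0 i * w + (\<Sum>j\<in>?S. M 0 j * v j)"
        "int p dvd M 1 i * w + (\<Sum>j\<in>?S. M 1 j * v j)"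
      using dependent_scalar[OF prime, of \<xi> "M 0 i" \<eta> "M 1 i"] column_nonzero[OF i] by blast
    define y where "y = red p t (v(i := w))"
    have row: "int p dvd (\<Sum>j<t. M r j * y j)" if r: "r < 2" for r
    proof -
      have "[(\<Sum>j<t. M r j * y j) = (\<Sum>j<t. M r j * (v(i := w)) j)] (mod int p)"
        by (intro cong_sum cong_mult cong_refl) (simp add: y_def cong_def)
      moreover have "(\<Sum>j<t. M r j * (v(i := w)) j) = M r i * w + (\<Sum>j\<in>?S. M r j * v j)"
        unfolding split by (auto intro!: sum.cong)
      moreover have "r = 0 \<or> r = 1" using r by auto
      ultimately show ?thesis using w cong_dvd_iff by metis
    qed
    have "y \<in> kernel_mat p t M" using row by (simp add: kernel_mat_def cong_0_iff y_def)
    moreover have "u = (\<lambda>l\<in>{..<?k}. y (\<sigma> l))"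
    proof (rule Fp_vec_eqI[OF u(1)])
      show "(\<lambda>l\<in>{..<?k}. y (\<sigma> l)) \<in> Fp_vec p ?k"
        using \<sigma>t by (auto simp: y_def Fp_vec_def)
      fix l assume l: "l < ?k"
      have "\<sigma> l \<in> ?S" using bij l by (auto simp: bij_betw_def)
      then show "[u l = (\<lambda>l\<in>{..<?k}. y (\<sigma> l)) l] (mod int p)"
        using l v\<sigma>[OF l] by (simp add: y_def cong_def)
    qed
    ultimately show "u \<in> (\<lambda>y. \<lambda>l\<in>{..<?k}. y (\<sigma> l)) ` kernel_mat p t M" by blast
  qed
  finally show ?thesis
    unfolding contains_additive_tuple_def using bij i
    by (intro exI[of _ ?S]) (auto simp: card_Diff_singleton)
qed

end

subsection \<open>Three forms\<close>

context generic_system begin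

text \<open>The cross product of the two rows of \<open>M\<close>, which spans the kernel when t =
  3.\<close>

definition dir :: "nat \<Rightarrow> int" where
  "dir i = (if i = 0 then minor 1 2 else if i = 1 then minor 2 0 else minor 0 1)"

lemma dir_ndvd:
  assumes "t = 3" "i < 3"
  shows "\<not> int p dvd dir i"
  using assms minor_ndvd[of 1 2] minor_ndvd[of 2 0] minor_ndvd[of 0 1] by (auto simp: dir_def)

lemma sum_three: "(\<Sum>i<(3::nat). h i) = h 0 + h 1 + (h 2 :: int)"
  by (simp add: numeral_3_eq_3 numeral_2_eq_2)

lemma dir_in_kernel:
  assumes "t = 3"
  shows "red p 3 (\<lambda>i. dir i * l) \<in> kernel_mat p t M"
proof -
  have "int p dvd (\<Sum>i<3. M r i * red p 3 (\<lambda>i. dir i * l) i)" if "r < 2" for r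
  proof -
    have "[(\<Sum>i<3. M r i * red p 3 (\<lambda>i. dir i * l) i) = (\<Sum>i<3. M r i * (dir i * l))] (mod int p)"
      by (intro cong_sum cong_mult cong_refl) (simp add: cong_def)
    moreover have "r = 0 \<or> r = 1" using that by auto
    then have "(\<Sum>i<3. M r i * (dir i * l)) = 0"
      unfolding sum_three by (auto simp: dir_def minor_def algebra_simps)
    ultimately show ?thesis by (simp add: cong_0_iff)
  qed
  then show ?thesis using assms by (simp add: kernel_mat_def cong_0_iff)
qed

lemma kernel_line:
  assumes t: "t = 3"
  shows "kernel_mat p t M = (\<lambda>l. red p 3 (\<lambda>i. dir i * l)) ` {0..<int p}"
proof (intro equalityI subsetI)
  fix y assume "y \<in> kernel_mat p t M"
  then have y: "y \<in> Fp_vec p 3" "\<And>r. r < 2 \<Longrightarrow> int p dvd M r 0 * y 0 + M r 1 * y 1 + M r 2 * y 2"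
    using t by (auto simp: kernel_mat_def cong_0_iff sum_three)
  obtain l where l: "l \<in> {0..<int p}" "\<And>k. k \<in> {0..<int p} \<Longrightarrow> [dir 2 * k = y 2] (mod int p) \<longleftrightarrow> k = l"
    using solve_linear_mod[OF prime dir_ndvd[OF t, of 2]] by auto
  have l2: "int p dvd dir 2 * l - y 2" using l by (simp add: cong_iff_dvd_diff)
  \<comment> \<open>The two row equations are combined so as to eliminate \<open>y 1\<close> here
    and \<open>y 0\<close> in \<open>c1\<close>.\<close>
  have c0: "dir 2 * (dir 0 * l - y 0) = dir 0 * (dir 2 * l - y 2) -
      (M 1 1 * (M 0 0 * y 0 + M 0 1 * y 1 + M 0 2 * y 2) - M 0 1 * (M 1 0 * y 0 + M 1 1 * y 1 + M 1 2 * y 2))"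
    by (simp add: dir_def minor_def algebra_simps)
  have c1: "dir 2 * (dir 1 * l - y 1) = dir 1 * (dir 2 * l - y 2) -
      (M 0 0 * (M 1 0 * y 0 + M 1 1 * y 1 + M 1 2 * y 2) - M 1 0 * (M 0 0 * y 0 + M 0 1 * y 1 + M 0 2 * y 2))"
    by (simp add: dir_def minor_def algebra_simps)
  have "int p dvd dir 2 * (dir 0 * l - y 0)" "int p dvd dir 2 * (dir 1 * l - y 1)"
    unfolding c0 c1 using l2 y(2)[of 0] y(2)[of 1] by (auto intro!: dvd_diff)
  then have "int p dvd dir 0 * l - y 0" "int p dvd dir 1 * l - y 1"
    using dir_ndvd[OF t, of 2] prime_dvd_mult_iff[OF prime_int] by auto
  then have all: "int p dvd dir i * l - y i" if "i < 3" for i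
    using l2 that by (auto simp: numeral_3_eq_3 numeral_2_eq_2 less_Suc_eq)
  have "y = red p 3 (\<lambda>i. dir i * l)"
  proof (rule Fp_vec_eqI[OF y(1)])
    fix k :: nat assume "k < 3"
    then have "[y k = dir k * l] (mod int p)" using all cong_iff_dvd_diff cong_sym by blast
    then show "[y k = red p 3 (\<lambda>i. dir i * l) k] (mod int p)"
      using \<open>k < 3\<close> by (simp add: cong_def)
  qed simp
  then show "y \<in> (\<lambda>l. red p 3 (\<lambda>i. dir i * l)) ` {0..<int p}" using l(1) by blast
qed (use dir_in_kernel[OF t] in auto)

lemma inj_line:
  assumes "t = 3"
  shows "inj_on (\<lambda>l. red p 3 (\<lambda>i. dir i * l)) {0..<int p}"
proof (rule inj_onI)
  fix k l assume kl: "k \<in> {0..<int p}" "l \<in> {0..<int p}" "red p 3 (\<lambda>i. dir i * k) = red p 3 (\<lambda>i. dir i * l)"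
  then have "[dir 0 * k = dir 0 * l] (mod int p)" by (simp add: red_eq_iff)
  then have "int p dvd dir 0 * (k - l)" by (simp add: cong_iff_dvd_diff algebra_simps)
  then have "[k = l] (mod int p)"
    using dir_ndvd[OF assms, of 0] prime_dvd_mult_iff[OF prime_int] by (simp add: cong_iff_dvd_diff)
  then show "k = l" using kl by (simp add: cong_def)
qed

text \<open>The joint map is a bijection onto a kernel with p elements, so the count is an average
  along one line through the origin.\<close>

lemma T_count_line:
  fixes g :: "int \<Rightarrow> real"
  assumes t: "t = 3" and lin: "linear_system p t D \<Psi>"
    and per: "\<And>a b. [a = b] (mod int p) \<Longrightarrow> g a = g b"
  shows "T_count p t D \<Psi> 1 (\<lambda>v. g (v 0)) =
    (\<Sum>l\<in>{0..<int p}. g (dir 0 * l) * g (dir 1 * l) * g (dir 2 * l)) / p"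
proof -
  have inj: "inj_on (joint_map p t D \<Psi>) (Fp_vec p D)"
    using lin by (simp add: linear_system_def)
  have "p ^ D = card (kernel_mat p t M)"
    using card_image[OF inj] by (simp add: card_Fp_vec Im_forms_def flip: image_eq_kernel)
  also have "\<dots> = p" by (simp add: kernel_line[OF t] card_image[OF inj_line[OF t]])
  finally have pD: "real p ^ D = p" by (metis of_nat_power)
  have "(\<Sum>x\<in>{..<D} \<rightarrow>\<^sub>E Fp_vec p 1. \<Prod>i<t. g (form_eval_vec p 1 D (\<Psi> i) x 0)) =
      (\<Sum>x\<in>Fp_vec p D. \<Prod>i<t. g (joint_map p t D \<Psi> x i))"
  proof (rule sum.reindex_bij_witness[of _ "\<lambda>x. \<lambda>j\<in>{..<D}. \<lambda>k\<in>{..<1::nat}. x j" "\<lambda>x. \<lambda>j\<in>{..<D}. x j 0"])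
    fix x assume x: "x \<in> {..<D} \<rightarrow>\<^sub>E Fp_vec p 1"
    show "(\<lambda>j\<in>{..<D}. \<lambda>k\<in>{..<1::nat}. (\<lambda>j\<in>{..<D}. x j 0) j) = x"
    proof (rule PiE_ext[OF _ x])
      fix j assume j: "j \<in> {..<D}"
      then have xj: "x j \<in> Fp_vec p 1" using x by auto
      then have "(\<lambda>k\<in>{..<1::nat}. x j 0) = x j"
        by (intro Fp_vec_eqI[of _ p 1]) (auto simp: Fp_vec_def PiE_def Pi_def)
      then show "(\<lambda>j\<in>{..<D}. \<lambda>k\<in>{..<1::nat}. (\<lambda>j\<in>{..<D}. x j 0) j) j = x j" using j by simp
    next
      show "(\<lambda>j\<in>{..<D}. \<lambda>k\<in>{..<1::nat}. (\<lambda>j\<in>{..<D}. x j 0) j) \<in> {..<D} \<rightarrow>\<^sub>E Fp_vec p 1"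
        using x by (auto simp: Fp_vec_def PiE_def Pi_def)
    qed
    show "(\<lambda>j\<in>{..<D}. x j 0) \<in> Fp_vec p D"
      using x by (auto simp: Fp_vec_def PiE_def Pi_def)
    show "(\<Prod>i<t. g (joint_map p t D \<Psi> (\<lambda>j\<in>{..<D}. x j 0) i)) =
        (\<Prod>i<t. g (form_eval_vec p 1 D (\<Psi> i) x 0))"
      by (intro prod.cong refl) (simp add: joint_map_def form_eval_vec_def form_eval_def)
  next
    fix x assume x: "x \<in> Fp_vec p D"
    show "(\<lambda>j\<in>{..<D}. (\<lambda>j\<in>{..<D}. \<lambda>k\<in>{..<1::nat}. x j) j 0) = x"
      using x by (intro Fp_vec_eqI[of _ p D]) (auto simp: Fp_vec_def PiE_def Pi_def)
    show "(\<lambda>j\<in>{..<D}. \<lambda>k\<in>{..<1::nat}. x j) \<in> {..<D} \<rightarrow>\<^sub>E Fp_vec p 1"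
      using x by (auto simp: Fp_vec_def PiE_def Pi_def)
  qed
  also have "\<dots> = (\<Sum>y\<in>kernel_mat p t M. \<Prod>i<t. g (y i))"
    unfolding image_eq_kernel[symmetric] Im_forms_def by (simp add: sum.reindex[OF inj])
  also have "\<dots> = (\<Sum>l\<in>{0..<int p}. \<Prod>i<t. g (red p 3 (\<lambda>i. dir i * l) i))"
    unfolding kernel_line[OF t] by (simp add: sum.reindex[OF inj_line[OF t]])
  also have "\<dots> = (\<Sum>l\<in>{0..<int p}. g (dir 0 * l) * g (dir 1 * l) * g (dir 2 * l))"
  proof (rule sum.cong[OF refl])
    fix l
    have "g (red p 3 (\<lambda>i. dir i * l) i) = g (dir i * l)" if "i < 3" for i
      using that by (intro per) (simp add: cong_def)
    then show "(\<Prod>i<t. g (red p 3 (\<lambda>i. dir i * l) i)) = g (dir 0 * l) * g (dir 1 * l) * g (dir 2 * l)"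
      by (simp add: t numeral_3_eq_3 numeral_2_eq_2)
  qed
  finally show ?thesis by (simp add: T_count_def pD)
qed

text \<open>In the product of three factors 1/2 + e g the linear terms average to zero, so
  \<open>S2\<close> and \<open>S3\<close> decide the sign for small e. The function tested is g/2,
  and the amplitude \<open>2 * e\<close> cancels that factor.\<close>

lemma not_weakly_line:
  fixes g :: "int \<Rightarrow> real"
  assumes t: "t = 3" and lin: "linear_system p t D \<Psi>"
    and per: "\<And>a b. [a = b] (mod int p) \<Longrightarrow> g a = g b"
    and bound: "\<And>c. \<bar>g c\<bar> \<le> 1" and mean: "\<And>i. i < 3 \<Longrightarrow> (\<Sum>l\<in>{0..<int p}. g (dir i * l)) = 0"
    and mean1: "(\<Sum>l\<in>{0..<int p}. g l) = 0"
  defines "S2 \<equiv> \<Sum>l\<in>{0..<int p}. g (dir 0 * l) * g (dir 1 * l) + g (dir 0 * l) * g (dir 2 * l) + g (dir 1 * l) * g (dir 2 * l)"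
  defines "S3 \<equiv> \<Sum>l\<in>{0..<int p}. g (dir 0 * l) * g (dir 1 * l) * g (dir 2 * l)"
  assumes neg: "S2 < 0 \<or> S2 = 0 \<and> S3 < 0"
  shows "\<not> weakly_locally_Sidorenko p t D \<Psi>"
proof
  assume W: "weakly_locally_Sidorenko p t D \<Psi>"
  have "(\<Sum>v\<in>Fp_vec p 1. g (v 0)) = (\<Sum>l\<in>{0..<int p}. g l)"
  proof (rule sum.reindex_bij_witness[of _ "\<lambda>l. \<lambda>k\<in>{..<1::nat}. l" "\<lambda>v. v 0"])
    fix v assume v: "v \<in> Fp_vec p 1"
    then show "(\<lambda>k\<in>{..<1::nat}. v 0) = v"
      by (intro Fp_vec_eqI[of _ p 1]) (auto simp: Fp_vec_def PiE_def Pi_def)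
    show "v 0 \<in> {0..<int p}" using v by (simp add: Fp_vec_range)
  qed (auto simp: Fp_vec_def)
  then have "admissible p 1 (1/2) (\<lambda>v. g (v 0) / 2)"
    using bound mean1 by (simp add: admissible_def average_def abs_le_iff minus_le_iff flip: sum_divide_distrib)
  then have "\<exists>d>0. \<forall>\<epsilon>. 0 < \<epsilon> \<and> \<epsilon> < d \<longrightarrow>
      T_count p t D \<Psi> 1 (\<lambda>v. 1/2 + \<epsilon> * (g (v 0) / 2)) \<ge> (1/2) ^ t"
    using W[unfolded weakly_locally_Sidorenko_def, rule_format, of 1 "1/2" "\<lambda>v. g (v 0) / 2"] by simp
  then obtain d where d: "d > 0" and
    T: "\<And>\<epsilon>. 0 < \<epsilon> \<Longrightarrow> \<epsilon> < d \<Longrightarrow> T_count p t D \<Psi> 1 (\<lambda>v. 1/2 + \<epsilon> * (g (v 0) / 2)) \<ge> (1/2) ^ t"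
    by blast
  have expand: "T_count p t D \<Psi> 1 (\<lambda>v. 1/2 + 2 * e * (g (v 0) / 2)) = (1/2) ^ t + e ^ 2 * (S2 / 2 + e * S3) / p" for e
  proof -
    have "T_count p t D \<Psi> 1 (\<lambda>v. 1/2 + 2 * e * (g (v 0) / 2)) =
        (\<Sum>l\<in>{0..<int p}. (1/2 + 2 * e * (g (dir 0 * l) / 2)) * (1/2 + 2 * e * (g (dir 1 * l) / 2)) *
          (1/2 + 2 * e * (g (dir 2 * l) / 2))) / p"
      by (rule T_count_line[OF t lin, of "\<lambda>c. 1/2 + 2 * e * (g c / 2)"]) (simp add: per)
    also have "(\<Sum>l\<in>{0..<int p}. (1/2 + 2 * e * (g (dir 0 * l) / 2)) * (1/2 + 2 * e * (g (dir 1 * l) / 2)) *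
          (1/2 + 2 * e * (g (dir 2 * l) / 2))) =
        (\<Sum>l\<in>{0..<int p}. 1/8 + e / 4 * g (dir 0 * l) + e / 4 * g (dir 1 * l) + e / 4 * g (dir 2 * l) +
          e ^ 2 / 2 * (g (dir 0 * l) * g (dir 1 * l) + g (dir 0 * l) * g (dir 2 * l) + g (dir 1 * l) * g (dir 2 * l)) +
          e ^ 3 * (g (dir 0 * l) * g (dir 1 * l) * g (dir 2 * l)))"
      by (intro sum.cong refl) (simp add: field_simps power2_eq_square power3_eq_cube)
    also have "\<dots> = p / 8 + e ^ 2 / 2 * S2 + e ^ 3 * S3"
      unfolding S2_def S3_def sum.distrib sum_distrib_left[symmetric]
      by (simp add: mean)
    finally show ?thesis by (simp add: t field_simps power2_eq_square power3_eq_cube)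
  qed
  obtain e where e: "0 < e" "2 * e < d" "S2 / 2 + e * S3 < 0"
  proof (cases "S2 < 0")
    case True
    define e where "e = min (d / 4) (- S2 / (4 * (\<bar>S3\<bar> + 1)))"
    have e0: "0 < e" using True d by (simp add: e_def field_simps add_pos_nonneg)
    have "e \<le> - S2 / (4 * (\<bar>S3\<bar> + 1))" by (simp add: e_def)
    then have "4 * e * (\<bar>S3\<bar> + 1) \<le> - S2" by (simp add: field_simps)
    moreover have "e * S3 \<le> e * (\<bar>S3\<bar> + 1)" using e0 by (intro mult_left_mono) auto
    ultimately have "S2 / 2 + e * S3 < 0" using True by linarith
    moreover have "e \<le> d / 4" unfolding e_def by (rule min.cobounded1)
    then have "2 * e < d" using d by simp
    ultimately show ?thesis using that e0 by blast
  next
    case False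
    then have "S2 = 0" "S3 < 0" using neg by auto
    then show ?thesis using that[of "d / 4"] d by (simp add: mult_pos_neg)
  qed
  have "(1/2) ^ t \<le> (1/2) ^ t + e ^ 2 * (S2 / 2 + e * S3) / p"
    using T[of "2 * e"] e expand[of e] by simp
  moreover have "e ^ 2 * (S2 / 2 + e * S3) / p < 0"
    using e by (intro divide_neg_pos mult_pos_neg) auto
  ultimately show False by simp
qed

text \<open>If two entries of the spanning vector differ, the difference of the point masses at them
  is a counterexample, after a change of sign when \<open>?S2\<close> vanishes and
  \<open>?S3\<close> is positive.\<close>

lemma weakly_three_imp:
  assumes t: "t = 3" and lin: "linear_system p t D \<Psi>" and W: "weakly_locally_Sidorenko p t D \<Psi>"
    and ab: "a < 3" "b < 3"
  shows "[dir a = dir b] (mod int p)"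
proof (rule ccontr)
  assume ne: "\<not> [dir a = dir b] (mod int p)"
  then have "a \<noteq> b" by auto
  \<comment> \<open>The remaining index, as 0 + 1 + 2 = 3.\<close>
  define c where "c = 3 - a - b"
  define g :: "int \<Rightarrow> real" where "g = (\<lambda>x. of_bool [x = dir a] (mod int p) - of_bool [x = dir b] (mod int p))"
  let ?S2 = "\<Sum>l\<in>{0..<int p}. g (dir 0 * l) * g (dir 1 * l) + g (dir 0 * l) * g (dir 2 * l) + g (dir 1 * l) * g (dir 2 * l)"
  let ?S3 = "\<Sum>l\<in>{0..<int p}. g (dir 0 * l) * g (dir 1 * l) * g (dir 2 * l)"
  have abc: "(a, b, c) \<in> {(0,1,2), (0,2,1), (1,0,2), (1,2,0), (2,0,1), (2,1,0)}"
    using ab \<open>a \<noteq> b\<close> by (auto simp: c_def numeral_3_eq_3 numeral_2_eq_2 less_Suc_eq)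
  then have c: "c < 3" by auto
  have "?S2 = (\<Sum>l\<in>{0..<int p}. g (dir a * l) * g (dir b * l) + g (dir a * l) * g (dir c * l) + g (dir b * l) * g (dir c * l))"
    using abc by (intro sum.cong refl) (auto simp: mult.commute)
  moreover have "?S3 = (\<Sum>l\<in>{0..<int p}. g (dir a * l) * g (dir b * l) * g (dir c * l))"
    using abc by (intro sum.cong refl) (auto simp: mult_ac)
  ultimately have S: "?S2 < 0 \<or> ?S2 = 0 \<and> ?S3 \<noteq> 0"
    unfolding g_def using point_mass_difference[OF prime dir_ndvd[OF t ab(1)] dir_ndvd[OF t ab(2)] dir_ndvd[OF t c] ne]
    by simp
  have per: "g x = g y" if "[x = y] (mod int p)" for x y
    using that by (simp add: g_def cong_def)
  have count: "(\<Sum>l\<in>{0..<int p}. of_bool [k * l = y] (mod int p)) = (1::real)" if k: "\<not> int p dvd k" for k y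
  proof -
    obtain d where d: "d \<in> {0..<int p}" "\<And>l. l \<in> {0..<int p} \<Longrightarrow> [k * l = y] (mod int p) \<longleftrightarrow> l = d"
      using solve_linear_mod[OF prime k] by blast
    have "(\<Sum>l\<in>{0..<int p}. of_bool [k * l = y] (mod int p)) = (\<Sum>l\<in>{0..<int p}. of_bool (l = d) :: real)"
      using d(2) by (intro sum.cong) auto
    then show ?thesis using d(1) by (simp add: of_bool_def)
  qed
  have mean: "(\<Sum>l\<in>{0..<int p}. g (k * l)) = 0" if "\<not> int p dvd k" for k
    using count[OF that] by (simp add: g_def sum_subtractf)
  have mean': "(\<Sum>l\<in>{0..<int p}. - g (k * l)) = 0" if "\<not> int p dvd k" for k
    using mean[OF that] by (simp add: sum_negf)
  have one: "\<not> int p dvd 1" using prime_int not_prime_unit by blast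
  have bound: "\<bar>g x\<bar> \<le> 1" for x by (simp add: g_def)
  show False
  proof (cases "?S2 < 0 \<or> ?S3 < 0")
    case True
    have "\<not> weakly_locally_Sidorenko p t D \<Psi>"
    proof (rule not_weakly_line[OF t lin, of g])
      show "?S2 < 0 \<or> ?S2 = 0 \<and> ?S3 < 0" using True S by auto
      show "(\<Sum>l\<in>{0..<int p}. g l) = 0" using mean[OF one] by simp
    qed (use per bound mean[OF dir_ndvd[OF t]] in auto)
    then show False using W by blast
  next
    case False
    then have S': "?S2 = 0" "?S3 > 0" using S by auto
    have "\<not> weakly_locally_Sidorenko p t D \<Psi>"
    proof (rule not_weakly_line[OF t lin, of "\<lambda>x. - g x"])
      show "(\<Sum>l\<in>{0..<int p}. - g l) = 0" using mean'[OF one] by simp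
      have "(\<Sum>l\<in>{0..<int p}. - g (dir 0 * l) * - g (dir 1 * l) + - g (dir 0 * l) * - g (dir 2 * l) +
          - g (dir 1 * l) * - g (dir 2 * l)) = ?S2" by (simp only: minus_mult_minus)
      moreover have "(\<Sum>l\<in>{0..<int p}. - g (dir 0 * l) * - g (dir 1 * l) * - g (dir 2 * l)) = - ?S3"
        by (simp add: sum_negf)
      ultimately show "(\<Sum>l\<in>{0..<int p}. - g (dir 0 * l) * - g (dir 1 * l) + - g (dir 0 * l) * - g (dir 2 * l) +
          - g (dir 1 * l) * - g (dir 2 * l)) < 0 \<or>
        (\<Sum>l\<in>{0..<int p}. - g (dir 0 * l) * - g (dir 1 * l) + - g (dir 0 * l) * - g (dir 2 * l) +
          - g (dir 1 * l) * - g (dir 2 * l)) = 0 \<and>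
        (\<Sum>l\<in>{0..<int p}. - g (dir 0 * l) * - g (dir 1 * l) * - g (dir 2 * l)) < 0"
        using S' by simp
      show "- g x = - g y" if "[x = y] (mod int p)" for x y using per[OF that] by simp
      show "\<bar>- g x\<bar> \<le> 1" for x using bound by simp
      show "(\<Sum>l\<in>{0..<int p}. - g (dir i * l)) = 0" if "i < 3" for i by (rule mean'[OF dir_ndvd[OF t that]])
    qed
    then show False using W by blast
  qed
qed

lemma form_thrice_if:
  assumes t: "t = 3" and eq: "\<And>a b. a < 3 \<Longrightarrow> b < 3 \<Longrightarrow> [dir a = dir b] (mod int p)"
  shows "form_thrice p t D \<Psi>"
proof -
  have "form_eval p D (\<Psi> i) x = form_eval p D (\<Psi> 0) x" if i: "i < t" and x: "x \<in> Fp_vec p D" for i x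
  proof -
    have "joint_map p t D \<Psi> x \<in> kernel_mat p t M"
      using x unfolding image_eq_kernel[symmetric] Im_forms_def by blast
    then obtain l where l: "joint_map p t D \<Psi> x = red p 3 (\<lambda>i. dir i * l)"
      unfolding kernel_line[OF t] by blast
    have "form_eval p D (\<Psi> k) x = dir k * l mod int p" if "k < 3" for k
      using fun_cong[OF l, of k] that t by (simp add: joint_map_def)
    moreover have "[dir i * l = dir 0 * l] (mod int p)"
      using eq[of i 0] i t by (intro cong_mult cong_refl) auto
    ultimately show ?thesis using i t by (simp add: cong_def)
  qed
  then show ?thesis unfolding form_thrice_def using t by blast
qed

text \<open>Forms 0 and 1 coincide. The row combination that cancels column 2 is scaled by
  \<open>l\<close> so that its other two entries become 1 and -1.\<close>

lemma additive_pair_if: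
  assumes t: "t = 3" and eq: "\<And>a b. a < 3 \<Longrightarrow> b < 3 \<Longrightarrow> [dir a = dir b] (mod int p)"
  shows "contains_additive_tuple p t D \<Psi> (t - 1)"
proof -
  obtain l where l: "l \<in> {0..<int p}" "\<And>k. k \<in> {0..<int p} \<Longrightarrow> [dir 1 * k = - 1] (mod int p) \<longleftrightarrow> k = l"
    using solve_linear_mod[OF prime dir_ndvd[OF t, of 1]] by auto
  have l1: "[dir 1 * l = - 1] (mod int p)" using l by blast
  have "[dir 0 * l = dir 1 * l] (mod int p)" using eq[of 0 1] by (intro cong_mult cong_refl) auto
  then have l0: "[dir 0 * l = - 1] (mod int p)" using l1 cong_trans by blast
  let ?\<xi> = "M 1 2 * l" and ?\<eta> = "- M 0 2 * l"
  define \<tau> where "\<tau> j = (if j = 0 then 1 else - 1 :: int)" for j :: nat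
  have v1: "M 0 1 * ?\<xi> + M 1 1 * ?\<eta> = dir 0 * l" by (simp add: dir_def minor_def algebra_simps)
  have v0: "M 0 0 * ?\<xi> + M 1 0 * ?\<eta> = - (dir 1 * l)" by (simp add: dir_def minor_def algebra_simps)
  have "[- (dir 1 * l) = - (- 1)] (mod int p)" using l1 by (subst cong_minus_minus_iff)
  then have c0: "[M 0 0 * ?\<xi> + M 1 0 * ?\<eta> = \<tau> 0] (mod int p)" unfolding v0 by (simp add: \<tau>_def)
  have c1: "[M 0 1 * ?\<xi> + M 1 1 * ?\<eta> = \<tau> 1] (mod int p)" using l0 unfolding v1 by (simp add: \<tau>_def)
  show ?thesis
  proof (rule additive_tuple_if[of 2 ?\<xi> ?\<eta> \<tau>])
    show "2 < t" using t by simp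
    show "int p dvd M 0 2 * ?\<xi> + M 1 2 * ?\<eta>" by (simp add: algebra_simps)
    have "{..<t} - {2} = {0, 1}" using t by auto
    then show "(\<Sum>j\<in>{..<t} - {2}. \<tau> j) = 0" by (simp add: \<tau>_def)
    fix j assume "j < t" "j \<noteq> 2"
    then have "j = 0 \<or> j = 1" using t by auto
    then show "\<tau> j \<in> {1, - 1} \<and> [M 0 j * ?\<xi> + M 1 j * ?\<eta> = \<tau> j] (mod int p)"
      using c0 c1 by (auto simp: \<tau>_def)
  qed
qed

end

subsection \<open>Sign patterns and quadratic relations\<close>

context generic_system begin

text \<open>The columns are distinct points of the projective line, which has p + 1 points;
  \<open>slope\<close> is the ratio of the entries, and its value p stands for the point at
  infinity.\<close>

lemma t_le_Suc_p: "t \<le> p + 1"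
proof -
  have "\<exists>d\<in>{0..int p}. (int p dvd M 0 i \<and> d = int p) \<or> (\<not> int p dvd M 0 i \<and> d < int p \<and> [M 0 i * d = M 1 i] (mod int p))" for i
  proof (cases "int p dvd M 0 i")
    case False
    obtain d where "d \<in> {0..<int p}" "\<And>l. l \<in> {0..<int p} \<Longrightarrow> [M 0 i * l = M 1 i] (mod int p) \<longleftrightarrow> l = d"
      using solve_linear_mod[OF prime False] by blast
    then show ?thesis using False by (intro bexI[of _ d]) auto
  qed auto
  then obtain slope where s: "\<And>i. slope i \<in> {0..int p}"
    "\<And>i. (int p dvd M 0 i \<and> slope i = int p) \<or> (\<not> int p dvd M 0 i \<and> slope i < int p \<and> [M 0 i * slope i = M 1 i] (mod int p))"
    by metis
  have "inj_on slope {..<t}"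
  proof (rule inj_onI, rule ccontr)
    fix i j assume ij: "i \<in> {..<t}" "j \<in> {..<t}" "slope i = slope j" "i \<noteq> j"
    show False
    proof (cases "slope i = int p")
      case True
      then have "int p dvd M 0 i" "int p dvd M 0 j" using s(2)[of i] s(2)[of j] ij(3) by auto
      then have "int p dvd minor i j" by (simp add: minor_def)
      then show False using minor_ndvd[of i j] ij by auto
    next
      case False
      then have "int p dvd M 0 i * slope i - M 1 i" "int p dvd M 0 j * slope i - M 1 j"
        using s(2)[of i] s(2)[of j] ij(3) by (auto simp: cong_iff_dvd_diff)
      moreover have "minor i j = M 0 j * (M 0 i * slope i - M 1 i) - M 0 i * (M 0 j * slope i - M 1 j)"
        by (simp add: minor_def algebra_simps)
      ultimately have "int p dvd minor i j" by simp
      then show False using minor_ndvd[of i j] ij by auto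
    qed
  qed
  then have "card {..<t} \<le> card {0..int p}"
    using s(1) by (intro card_inj_on_le[of slope]) auto
  then show ?thesis by simp
qed

section \<open>Sign patterns carried by a single frequency\<close>

definition unit_entry :: "(nat \<Rightarrow> int) \<Rightarrow> bool" where
  "unit_entry a \<longleftrightarrow> [a 0 = 1] (mod int p) \<or> [a 0 = - 1] (mod int p)"

lemma unit_entry_neg: "unit_entry (red p 1 (\<lambda>k. - a k)) \<longleftrightarrow> unit_entry a"
proof -
  have "[red p 1 (\<lambda>k. - a k) 0 = c] (mod int p) \<longleftrightarrow> [a 0 = - c] (mod int p)" for c
  proof -
    have "[red p 1 (\<lambda>k. - a k) 0 = c] (mod int p) \<longleftrightarrow> [- a 0 = - (- c)] (mod int p)"
      by (simp add: cong_def)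
    also have "\<dots> \<longleftrightarrow> [a 0 = - c] (mod int p)" by (subst cong_minus_minus_iff) simp
    finally show ?thesis .
  qed
  from this[of 1] this[of "- 1"] show ?thesis by (auto simp: unit_entry_def)
qed

text \<open>Averaging the single-frequency functions over all translations isolates the balanced sign
  patterns, so if there are none then some translate makes the sum negative.\<close>

lemma weakly_imp_additive_if_concentrated:
  assumes W: "weakly_locally_Sidorenko p t D \<Psi>" and podd: "odd p"
    and i0: "i0 < t" and \<Xi>0: "\<Xi>0 \<in> Zset 1 i0"
    and conc: "\<And>j. j < t \<Longrightarrow> j \<noteq> i0 \<Longrightarrow> unit_entry (pt 1 \<Xi>0 j)"
  shows "contains_additive_tuple p t D \<Psi> (t - 1)"
proof (rule ccontr)
  assume no: "\<not> contains_additive_tuple p t D \<Psi> (t - 1)"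
  have todd: "odd t" using W by (rule weakly_imp_odd)
  \<comment> \<open>Only these pairs survive in \<open>Qsum\<close>, because \<open>z h\<close> is
    supported on the frequencies 1 and -1; \<open>S\<close> collects their total frequency.\<close>
  define K where "K i = {\<Xi>\<in>Zset 1 i. \<forall>j\<in>{..<t}-{i}. unit_entry (pt 1 \<Xi> j)}" for i
  define S where "S i \<Xi> = (\<Sum>j\<in>{..<t}-{i}. pt 1 \<Xi> j 0)" for i \<Xi>
  \<comment> \<open>Coefficients of twice the cosine of a single frequency, translated by
    \<open>h\<close>.\<close>
  define z where "z h a = (if unit_entry a then ep p (h * a 0) else 0)" for h :: int and a :: "nat \<Rightarrow> int"
  have finK [simp]: "finite (K i)" for i by (simp add: K_def)
  have one: "\<not> int p dvd 1" using prime_int not_prime_unit by blast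
  have z0: "z h (zero_vec p 1) = 0" for h
    using one by (simp add: z_def unit_entry_def cong_iff_dvd_diff)
  have herm: "hermitian p 1 (z h)" for h
    unfolding hermitian_def
  proof
    fix a
    have "[h * red p 1 (\<lambda>k. - a k) 0 = - (h * a 0)] (mod int p)"
      by (simp add: cong_def mod_mult_right_eq)
    then have "ep p (h * red p 1 (\<lambda>k. - a k) 0) = ep p (- (h * a 0))" by (rule ep_cong[OF p_pos])
    then show "z h (red p 1 (\<lambda>k. - a k)) = cnj (z h a)"
      unfolding z_def unit_entry_neg by (simp add: cnj_ep)
  qed
  have Q: "Qsum 1 (z h) = (\<Sum>i<t. \<Sum>\<Xi>\<in>K i. ep p (S i \<Xi> * h))" for h
  proof -
    have "(\<Sum>\<Xi>\<in>Zset 1 i. \<Prod>j\<in>{..<t}-{i}. z h (pt 1 \<Xi> j)) = (\<Sum>\<Xi>\<in>K i. ep p (S i \<Xi> * h))" for i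
    proof -
      have "(\<Sum>\<Xi>\<in>Zset 1 i. \<Prod>j\<in>{..<t}-{i}. z h (pt 1 \<Xi> j)) = (\<Sum>\<Xi>\<in>K i. \<Prod>j\<in>{..<t}-{i}. z h (pt 1 \<Xi> j))"
      proof (rule sum.mono_neutral_right)
        show "\<forall>\<Xi>\<in>Zset 1 i - K i. (\<Prod>j\<in>{..<t}-{i}. z h (pt 1 \<Xi> j)) = 0"
        proof
          fix \<Xi> assume "\<Xi> \<in> Zset 1 i - K i"
          then obtain j where "j \<in> {..<t}-{i}" "\<not> unit_entry (pt 1 \<Xi> j)" by (auto simp: K_def)
          then show "(\<Prod>j\<in>{..<t}-{i}. z h (pt 1 \<Xi> j)) = 0"
            by (intro prod_zero) (auto simp: z_def)
        qed
      qed (auto simp: K_def)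
      also have "\<dots> = (\<Sum>\<Xi>\<in>K i. ep p (S i \<Xi> * h))"
      proof (rule sum.cong[OF refl])
        fix \<Xi> assume "\<Xi> \<in> K i"
        then have "(\<Prod>j\<in>{..<t}-{i}. z h (pt 1 \<Xi> j)) = (\<Prod>j\<in>{..<t}-{i}. ep p (h * pt 1 \<Xi> j 0))"
          by (intro prod.cong) (auto simp: K_def z_def)
        then show "(\<Prod>j\<in>{..<t}-{i}. z h (pt 1 \<Xi> j)) = ep p (S i \<Xi> * h)"
          by (simp add: S_def sum_distrib_left mult.commute[of _ h] flip: ep_sum)
      qed
      finally show ?thesis .
    qed
    then show ?thesis by (simp add: Qsum_def)
  qed
  have unbalanced: "\<not> int p dvd S i \<Xi>" if i: "i < t" and \<Xi>: "\<Xi> \<in> K i" for i \<Xi>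
  proof
    assume dv: "int p dvd S i \<Xi>"
    define \<tau> where "\<tau> j = (if [pt 1 \<Xi> j 0 = 1] (mod int p) then 1 else - 1 :: int)" for j
    have \<tau>: "[pt 1 \<Xi> j 0 = \<tau> j] (mod int p)" if "j \<in> {..<t}-{i}" for j
      using \<Xi> that by (auto simp: K_def unit_entry_def \<tau>_def)
    have pt0: "[pt 1 \<Xi> j 0 = M 0 j * fst \<Xi> 0 + M 1 j * snd \<Xi> 0] (mod int p)" for j
      by (simp add: pt_def cong_def)
    have "[S i \<Xi> = (\<Sum>j\<in>{..<t}-{i}. \<tau> j)] (mod int p)"
      unfolding S_def using \<tau> by (intro cong_sum)
    then have dvt: "int p dvd (\<Sum>j\<in>{..<t}-{i}. \<tau> j)" using dv cong_dvd_iff by blast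
    \<comment> \<open>A multiple of p of absolute value at most t - 1 <= p is 0, p or -p. The last
      two are odd, whereas a sum of t - 1 signs is even.\<close>
    have "\<bar>\<Sum>j\<in>{..<t}-{i}. \<tau> j\<bar> \<le> (\<Sum>j\<in>{..<t}-{i}. \<bar>\<tau> j\<bar>)" by (rule sum_abs)
    also have "\<dots> = int (t - 1)" using i by (simp add: \<tau>_def card_Diff_singleton if_distrib cong: if_cong)
    also have "\<dots> \<le> int p" using t_le_Suc_p by simp
    finally have le: "\<bar>\<Sum>j\<in>{..<t}-{i}. \<tau> j\<bar> \<le> int p" .
    have "[(\<Sum>j\<in>{..<t}-{i}. \<tau> j) = (\<Sum>j\<in>{..<t}-{i}. 1)] (mod 2)"
      by (intro cong_sum) (simp add: \<tau>_def cong_def)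
    then have "[(\<Sum>j\<in>{..<t}-{i}. \<tau> j) = int (t - 1)] (mod 2)"
      using i by (simp add: card_Diff_singleton)
    moreover have "even (int (t - 1))" using todd by simp
    ultimately have ev: "even (\<Sum>j\<in>{..<t}-{i}. \<tau> j)" using cong_dvd_iff by blast
    from dvt obtain q where q: "(\<Sum>j\<in>{..<t}-{i}. \<tau> j) = int p * q" by blast
    have "\<bar>int p * q\<bar> \<le> int p" using le q by simp
    then have "\<bar>q\<bar> \<le> 1" using p_pos by (simp add: abs_mult)
    moreover have "even q" using ev q podd by simp
    ultimately have "q = 0" by presburger
    then have bal: "(\<Sum>j\<in>{..<t}-{i}. \<tau> j) = 0" using q by simp
    have "contains_additive_tuple p t D \<Psi> (t - 1)"
    proof (rule additive_tuple_if[OF i _ _ bal])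
      have "pt 1 \<Xi> i = zero_vec p 1" using \<Xi> by (simp add: K_def Zset_def)
      then show "int p dvd M 0 i * fst \<Xi> 0 + M 1 i * snd \<Xi> 0"
        by (simp add: pt_def red_eq_iff cong_0_iff)
      fix j assume j: "j < t" "j \<noteq> i"
      have "[M 0 j * fst \<Xi> 0 + M 1 j * snd \<Xi> 0 = \<tau> j] (mod int p)"
        by (rule cong_trans[OF cong_sym[OF pt0] \<tau>]) (use j in simp)
      moreover have "\<tau> j \<in> {1, - 1}" by (simp add: \<tau>_def)
      ultimately show "\<tau> j \<in> {1, - 1} \<and> [M 0 j * fst \<Xi> 0 + M 1 j * snd \<Xi> 0 = \<tau> j] (mod int p)"
        by blast
    qed
    then show False using no by blast
  qed
  \<comment> \<open>Summing over the translations kills every term with nonzero total frequency,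
    that is, all of them. The summand at h = 0 is positive, so another one is negative.\<close>
  have "(\<Sum>h\<in>{0..<int p}. Qsum 1 (z h)) = (\<Sum>h\<in>{0..<int p}. \<Sum>i<t. \<Sum>\<Xi>\<in>K i. ep p (S i \<Xi> * h))"
    by (simp only: Q)
  also have "\<dots> = (\<Sum>i<t. \<Sum>h\<in>{0..<int p}. \<Sum>\<Xi>\<in>K i. ep p (S i \<Xi> * h))"
    by (rule sum.swap)
  also have "\<dots> = (\<Sum>i<t. \<Sum>\<Xi>\<in>K i. \<Sum>h\<in>{0..<int p}. ep p (S i \<Xi> * h))"
    by (intro sum.cong refl sum.swap)
  also have "\<dots> = 0"
    using unbalanced by (simp add: sum_ep)
  finally have sum0: "(\<Sum>h\<in>{0..<int p}. Re (Qsum 1 (z h))) = 0"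
    by (simp flip: Re_sum)
  have "Re (Qsum 1 (z 0)) = (\<Sum>i<t. real (card (K i)))" unfolding Q by simp
  also have "\<dots> > 0"
  proof (rule sum_pos2[of _ i0])
    have "\<Xi>0 \<in> K i0" using \<Xi>0 conc by (auto simp: K_def)
    then show "0 < real (card (K i0))" by (auto simp: card_gt_0_iff)
  qed (use i0 in auto)
  finally have pos: "Re (Qsum 1 (z 0)) > 0" .
  have "\<exists>h\<in>{0..<int p}. Re (Qsum 1 (z h)) < 0"
  proof (rule ccontr)
    assume "\<not> ?thesis"
    then have "(\<Sum>h\<in>{0..<int p}. Re (Qsum 1 (z h))) > 0"
      using pos by (intro sum_pos2[of _ 0]) (auto simp: not_less)
    then show False using sum0 by simp
  qed
  then obtain h where "Re (Qsum 1 (z h)) < 0" by blast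
  then show False using not_weakly_if[of 1 "z h"] z0 herm W by simp
qed

text \<open>The coefficients come from expanding a Vandermonde determinant.\<close>

lemma four_term_relation:
  "minor b c * minor b d * minor c d * (M r a * M r' a) - minor a c * minor a d * minor c d * (M r b * M r' b) +
    minor a b * minor a d * minor b d * (M r c * M r' c) - minor a b * minor a c * minor b c * (M r d * M r' d) = 0"
  if "r < 2" "r' < 2"
proof -
  have "r = 0 \<or> r = 1" "r' = 0 \<or> r' = 1" using that by auto
  then show ?thesis unfolding minor_def by (elim disjE) (simp_all add: algebra_simps)
qed

lemma exists_four:
  assumes "u < t" "t \<ge> 4"
  obtains b c d where "b < t" "c < t" "d < t" "distinct [u, b, c, d]"
proof -
  have "card ({..<t} - {u}) \<ge> 3" using assms by simp
  then obtain T where T: "T \<subseteq> {..<t} - {u}" "card T = 3"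
    using obtain_subset_with_card_n by metis
  then obtain b c d where "T = {b, c, d}" "b \<noteq> c" "b \<noteq> d" "c \<noteq> d"
    by (auto simp: card_3_iff)
  then show ?thesis using that[of b c d] T by auto
qed

text \<open>The tensors v_l (x) v_l lie in the three-dimensional space of symmetric tensors, so any
  four of them are dependent; by genericity all four coefficients are nonzero.\<close>

lemma small_relation:
  assumes "u < t" "t \<ge> 4"
  obtains s B where "finite B" "card B = 3" "B \<subseteq> {..<t}" "u \<notin> B"
    "\<And>l. l \<in> insert u B \<Longrightarrow> \<not> int p dvd s l" "\<And>l. l \<notin> insert u B \<Longrightarrow> s l = 0"
    "\<And>r r'. r < 2 \<Longrightarrow> r' < 2 \<Longrightarrow> (\<Sum>l<t. s l * (M r l * M r' l)) = 0"
proof -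
  obtain b c d where bcd: "b < t" "c < t" "d < t" "distinct [u, b, c, d]"
    using exists_four[OF assms] by blast
  define s where "s l = (if l = u then minor b c * minor b d * minor c d
    else if l = b then - (minor u c * minor u d * minor c d)
    else if l = c then minor u b * minor u d * minor b d
    else if l = d then - (minor u b * minor u c * minor b c) else 0)" for l
  have nd: "\<not> int p dvd s l" if "l \<in> insert u {b, c, d}" for l
  proof -
    have "\<not> int p dvd x * y * w" if "\<not> int p dvd x" "\<not> int p dvd y" "\<not> int p dvd w" for x y w
      using that by (simp add: prime_dvd_mult_iff[OF prime_int])
    moreover have "\<not> int p dvd minor x y" if "x \<in> {u, b, c, d}" "y \<in> {u, b, c, d}" "x \<noteq> y" for x y
      using that bcd assms(1) by (intro minor_ndvd) auto
    ultimately show ?thesis using that bcd(4) by (auto simp: s_def)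
  qed
  have rel: "(\<Sum>l<t. s l * (M r l * M r' l)) = 0" if "r < 2" "r' < 2" for r r'
  proof -
    have "(\<Sum>l<t. s l * (M r l * M r' l)) = (\<Sum>l\<in>{u, b, c, d}. s l * (M r l * M r' l))"
      using bcd assms(1) by (intro sum.mono_neutral_right) (auto simp: s_def)
    also have "\<dots> = 0"
      using bcd(4) four_term_relation[OF that, of b c d u] by (simp add: s_def)
    finally show ?thesis .
  qed
  show ?thesis
    by (rule that[of "{b, c, d}" s]) (use bcd nd rel in \<open>auto simp: s_def\<close>)
qed

text \<open>Coefficients are made nonzero one index at a time by adding a multiple \<open>k\<close>
  of a relation on u and three further indices. Each of these four indices rules out at most one
  \<open>k\<close>, so p >= 5 leaves a choice.\<close>

lemma full_relation:
  assumes "t \<ge> 4" "p \<ge> 5"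
  obtains s where "\<And>l. l < t \<Longrightarrow> \<not> int p dvd s l"
    "\<And>r r'. r < 2 \<Longrightarrow> r' < 2 \<Longrightarrow> int p dvd (\<Sum>l<t. s l * (M r l * M r' l))"
proof -
  have "u \<le> t \<Longrightarrow> \<exists>s. (\<forall>l<u. \<not> int p dvd s l) \<and>
      (\<forall>r<2. \<forall>r'<2. int p dvd (\<Sum>l<t. s l * (M r l * M r' l)))" for u
  proof (induction u)
    case 0
    show ?case by (intro exI[of _ "\<lambda>_. 0"]) auto
  next
    case (Suc u)
    then obtain s where s: "\<And>l. l < u \<Longrightarrow> \<not> int p dvd s l"
      "\<And>r r'. r < 2 \<Longrightarrow> r' < 2 \<Longrightarrow> int p dvd (\<Sum>l<t. s l * (M r l * M r' l))" by auto
    show ?case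
    proof (cases "int p dvd s u")
      case False
      then show ?thesis using s by (intro exI[of _ s]) (auto simp: less_Suc_eq)
    next
      case True
      have "u < t" using Suc.prems by simp
      obtain s' B where B: "finite B" "card B = 3" "B \<subseteq> {..<t}" "u \<notin> B"
        and s': "\<And>l. l \<in> insert u B \<Longrightarrow> \<not> int p dvd s' l" "\<And>l. l \<notin> insert u B \<Longrightarrow> s' l = 0"
        "\<And>r r'. r < 2 \<Longrightarrow> r' < 2 \<Longrightarrow> (\<Sum>l<t. s' l * (M r l * M r' l)) = 0"
        by (rule small_relation[OF \<open>u < t\<close> assms(1)], rule that, assumption+)
      define bad where "bad l = {k\<in>{0..<int p}. int p dvd s l + k * s' l}" for l
      have bad1: "card (bad l) \<le> 1" if l: "l \<in> insert u B" for l
      proof -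
        obtain e where e: "\<And>k. k \<in> {0..<int p} \<Longrightarrow> [s' l * k = - s l] (mod int p) \<longleftrightarrow> k = e"
          using solve_linear_mod[OF prime s'(1)[OF l], of "- s l"] by blast
        have "bad l \<subseteq> {e}"
        proof
          fix k assume k: "k \<in> bad l"
          then have "[s' l * k = - s l] (mod int p)"
            by (auto simp: bad_def cong_iff_dvd_diff algebra_simps)
          then show "k \<in> {e}" using e k by (auto simp: bad_def)
        qed
        then show ?thesis using card_mono[of "{e}" "bad l"] by simp
      qed
      have "card (\<Union>l\<in>insert u B. bad l) \<le> (\<Sum>l\<in>insert u B. card (bad l))"
        using B(1) by (intro card_UN_le) auto
      also have "\<dots> \<le> (\<Sum>l\<in>insert u B. 1)" by (intro sum_mono bad1)
      also have "\<dots> = 4" using B by simp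
      also have "4 < card {0..<int p}" using assms(2) by simp
      finally have small: "card (\<Union>l\<in>insert u B. bad l) < card {0..<int p}" .
      have "finite (bad l)" for l
        unfolding bad_def by (rule finite_subset[of _ "{0..<int p}"]) auto
      then have "finite (\<Union>l\<in>insert u B. bad l)" using B(1) by simp
      then have "\<not> {0..<int p} \<subseteq> (\<Union>l\<in>insert u B. bad l)"
        using card_mono small by (metis leD)
      then obtain k where "k \<in> {0..<int p}" "k \<notin> (\<Union>l\<in>insert u B. bad l)" by blast
      then have k: "\<not> int p dvd s l + k * s' l" if "l \<in> insert u B" for l
        using that unfolding bad_def by blast
      have nd: "\<not> int p dvd s l + k * s' l" if "l < Suc u" for l
      proof (cases "l \<in> insert u B")
        case True then show ?thesis using k by blast
      next
        case False
        then have "l < u" using that by (auto simp: less_Suc_eq)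
        then show ?thesis using s(1) s'(2)[OF False] by simp
      qed
      have "int p dvd (\<Sum>l<t. (s l + k * s' l) * (M r l * M r' l))" if "r < 2" "r' < 2" for r r'
      proof -
        have "(\<Sum>l<t. (s l + k * s' l) * (M r l * M r' l)) =
            (\<Sum>l<t. s l * (M r l * M r' l)) + k * (\<Sum>l<t. s' l * (M r l * M r' l))"
          by (simp add: sum_distrib_left algebra_simps sum.distrib)
        then show ?thesis using s(2)[OF that] s'(3)[OF that] by simp
      qed
      then show ?thesis using nd by (intro exI[of _ "\<lambda>l. s l + k * s' l"]) auto
    qed
  qed
  from this[of t] show ?thesis using that by blast
qed

end

subsection \<open>Bilinear phases\<close>

definition join :: "nat \<Rightarrow> nat \<Rightarrow> (nat \<Rightarrow> int) \<Rightarrow> (nat \<Rightarrow> int) \<Rightarrow> nat \<Rightarrow> int" where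
  "join r s a b = (\<lambda>k\<in>{..<r + s}. if k < r then a k else b (k - r))"

lemma join_left [simp]: "k < r \<Longrightarrow> join r s a b k = a k"
  by (simp add: join_def)

lemma join_right [simp]: "k < s \<Longrightarrow> join r s a b (r + k) = b k"
  by (simp add: join_def)

lemma join_two_right [simp]: "k < s \<Longrightarrow> join 2 s a b (Suc (Suc k)) = b k"
  using join_right[of k s 2 a b] by simp

lemma sum_Fp_vec_add:
  "(\<Sum>a\<in>Fp_vec p (r + s). F a) = (\<Sum>b\<in>Fp_vec p r. \<Sum>c\<in>Fp_vec p s. F (join r s b c))"
proof -
  have "(\<Sum>a\<in>Fp_vec p (r + s). F a) = (\<Sum>(b, c)\<in>Fp_vec p r \<times> Fp_vec p s. F (join r s b c))"
  proof (rule sum.reindex_bij_witness[of _ "\<lambda>(b, c). join r s b c" "\<lambda>a. (\<lambda>k\<in>{..<r}. a k, \<lambda>k\<in>{..<s}. a (r + k))"])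
    fix a assume a: "a \<in> Fp_vec p (r + s)"
    show eq: "(case (\<lambda>k\<in>{..<r}. a k, \<lambda>k\<in>{..<s}. a (r + k)) of (b, c) \<Rightarrow> join r s b c) = a"
    proof
      fix k
      show "(case (\<lambda>k\<in>{..<r}. a k, \<lambda>k\<in>{..<s}. a (r + k)) of (b, c) \<Rightarrow> join r s b c) k = a k"
        using a by (cases "k < r + s") (auto simp: join_def Fp_vec_def PiE_def extensional_def)
    qed
    show "(\<lambda>k\<in>{..<r}. a k, \<lambda>k\<in>{..<s}. a (r + k)) \<in> Fp_vec p r \<times> Fp_vec p s"
      using a by (auto simp: Fp_vec_def PiE_def Pi_def)
    show "(case (\<lambda>k\<in>{..<r}. a k, \<lambda>k\<in>{..<s}. a (r + k)) of (b, c) \<Rightarrow> F (join r s b c)) = F a"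
      using eq by simp
  next
    fix x assume x: "x \<in> Fp_vec p r \<times> Fp_vec p s"
    obtain b c where bc: "x = (b, c)" by (cases x)
    have "(\<lambda>k\<in>{..<r}. join r s b c k) = b" "(\<lambda>k\<in>{..<s}. join r s b c (r + k)) = c"
      using x by (auto simp: bc Fp_vec_def PiE_def extensional_def)
    then show "(\<lambda>k\<in>{..<r}. (case x of (b, c) \<Rightarrow> join r s b c) k,
        \<lambda>k\<in>{..<s}. (case x of (b, c) \<Rightarrow> join r s b c) (r + k)) = x"
      by (simp add: bc)
    show "(case x of (b, c) \<Rightarrow> join r s b c) \<in> Fp_vec p (r + s)"
      using x by (auto simp: bc join_def Fp_vec_def PiE_def Pi_def)
  qed
  then show ?thesis by (simp add: sum.cartesian_product)
qed

lemma sum_lessThan_add: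
  fixes f :: "nat \<Rightarrow> 'a :: comm_monoid_add"
  shows "(\<Sum>k<r + s. f k) = (\<Sum>k<r. f k) + (\<Sum>k<s. f (r + k))"
  by (induction s) (simp_all add: add.assoc)

text \<open>The cast from the reals makes it visible that the sum is nonnegative, as needed in
  \<open>Re_Rsum_phase_ge\<close>.\<close>

lemma sum_ep_vec_of_real: "p > 0 \<Longrightarrow>
  (\<Sum>x\<in>Fp_vec p n. ep p (\<Sum>k<n. c k * x k)) = of_real (if \<forall>k<n. int p dvd c k then real p ^ n else 0)"
  by (simp add: sum_ep_vec)

text \<open>\<open>s_rel\<close> is the tensor relation: the sum of s_l v_l (x) v_l vanishes modulo
  p.\<close>

locale phase_system = generic_system +
  fixes s :: "nat \<Rightarrow> int"
  assumes p_odd: "odd p"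
    and s_ndvd: "\<And>l. l < t \<Longrightarrow> \<not> int p dvd s l"
    and s_rel: "\<And>r r'. r < 2 \<Longrightarrow> r' < 2 \<Longrightarrow> int p dvd (\<Sum>l<t. s l * (M r l * M r' l))"
begin

text \<open>An odd function on the plane, supported on the columns of \<open>M\<close> and their
  negatives; see \<open>P_col\<close> for its values. Oddness makes \<open>phase\<close>
  Hermitian.\<close>

definition P :: "int \<Rightarrow> int \<Rightarrow> int" where
  "P x y = (\<Sum>l<t. s l * (of_bool ([x = M 0 l] (mod int p) \<and> [y = M 1 l] (mod int p)) -
    of_bool ([x = - M 0 l] (mod int p) \<and> [y = - M 1 l] (mod int p))))"

lemma P_cong: "[x = x'] (mod int p) \<Longrightarrow> [y = y'] (mod int p) \<Longrightarrow> P x y = P x' y'"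
  by (simp add: P_def cong_def)

lemma P_neg: "P (- x) (- y) = - P x y"
proof -
  have *: "[- a = b] (mod int p) \<longleftrightarrow> [a = - b] (mod int p)" for a b
    using cong_minus_minus_iff[of a "- b" "int p"] by simp
  show ?thesis
    unfolding P_def sum_negf[symmetric] by (intro sum.cong refl) (auto simp: *)
qed

text \<open>Column l is no multiple of another column and, as p is odd, differs from its own
  negative, so a single indicator is nonzero.\<close>

lemma P_col:
  assumes "l < t"
  shows "P (M 0 l) (M 1 l) = s l"
proof -
  have neq: "\<not> ([M 0 l = c * M 0 k] (mod int p) \<and> [M 1 l = c * M 1 k] (mod int p))" if k: "k < t" "k \<noteq> l" for c k
  proof
    assume "[M 0 l = c * M 0 k] (mod int p) \<and> [M 1 l = c * M 1 k] (mod int p)"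
    then have "int p dvd M 0 l - c * M 0 k" "int p dvd M 1 l - c * M 1 k"
      by (auto simp: cong_iff_dvd_diff)
    moreover have "minor l k = (M 0 l - c * M 0 k) * M 1 k - M 0 k * (M 1 l - c * M 1 k)"
      by (simp add: minor_def algebra_simps)
    ultimately have "int p dvd minor l k" by simp
    then show False using minor_ndvd[of l k] assms k by simp
  qed
  have neg: "\<not> ([M 0 l = - M 0 l] (mod int p) \<and> [M 1 l = - M 1 l] (mod int p))"
  proof
    assume "[M 0 l = - M 0 l] (mod int p) \<and> [M 1 l = - M 1 l] (mod int p)"
    then have "int p dvd 2 * M 0 l" "int p dvd 2 * M 1 l" by (auto simp: cong_iff_dvd_diff)
    moreover have "\<not> int p dvd 2"
    proof
      assume "int p dvd 2"
      then have "p dvd 2" by (metis of_nat_dvd_iff of_nat_numeral)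
      then show False using p_odd prime by (metis dvd_refl primes_dvd_imp_eq two_is_prime_nat)
    qed
    ultimately show False
      using column_nonzero[OF assms] prime_dvd_mult_iff[OF prime_int] by blast
  qed
  have "P (M 0 l) (M 1 l) = (\<Sum>k<t. if k = l then s l else 0)"
    unfolding P_def
  proof (rule sum.cong[OF refl])
    fix k assume "k \<in> {..<t}"
    then show "s k * (of_bool ([M 0 l = M 0 k] (mod int p) \<and> [M 1 l = M 1 k] (mod int p)) -
        of_bool ([M 0 l = - M 0 k] (mod int p) \<and> [M 1 l = - M 1 k] (mod int p))) = (if k = l then s l else 0)"
      using neq[of k 1] neq[of k "- 1"] neg by auto
  qed
  then show ?thesis using assms by simp
qed

lemma P_support:
  assumes "\<not> int p dvd P x y"
  obtains l \<sigma> where "l < t" "\<sigma> \<in> {1, - 1}" "[x = \<sigma> * M 0 l] (mod int p)" "[y = \<sigma> * M 1 l] (mod int p)"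
proof -
  have "\<exists>l<t. ([x = M 0 l] (mod int p) \<and> [y = M 1 l] (mod int p)) \<or> ([x = - M 0 l] (mod int p) \<and> [y = - M 1 l] (mod int p))"
  proof (rule ccontr)
    assume "\<not> ?thesis"
    then have "P x y = 0" unfolding P_def by (intro sum.neutral) auto
    then show False using assms by simp
  qed
  then show ?thesis using that[of _ 1] that[of _ "- 1"] by auto
qed

lemma card_support: "card {a \<in> Fp_vec p 2. \<not> int p dvd P (a 0) (a 1)} \<le> 2 * t"
proof -
  let ?f = "\<lambda>\<sigma> l. red p 2 (\<lambda>r. \<sigma> * M r l)"
  have "{a \<in> Fp_vec p 2. \<not> int p dvd P (a 0) (a 1)} \<subseteq> ?f 1 ` {..<t} \<union> ?f (- 1) ` {..<t}"
  proof
    fix a assume a: "a \<in> {a \<in> Fp_vec p 2. \<not> int p dvd P (a 0) (a 1)}"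
    then obtain l \<sigma> where l: "l < t" "\<sigma> \<in> {1, - 1}" "[a 0 = \<sigma> * M 0 l] (mod int p)" "[a 1 = \<sigma> * M 1 l] (mod int p)"
      using P_support by blast
    have "a = ?f \<sigma> l"
    proof (rule Fp_vec_eqI[of _ p 2])
      fix k :: nat assume "k < 2"
      then have "k = 0 \<or> k = 1" by auto
      then show "[a k = ?f \<sigma> l k] (mod int p)" using l by (auto simp: cong_def)
    qed (use a in auto)
    then show "a \<in> ?f 1 ` {..<t} \<union> ?f (- 1) ` {..<t}" using l(1,2) by blast
  qed
  then have "card {a \<in> Fp_vec p 2. \<not> int p dvd P (a 0) (a 1)} \<le> card (?f 1 ` {..<t} \<union> ?f (- 1) ` {..<t})"
    by (intro card_mono) auto
  also have "\<dots> \<le> card (?f 1 ` {..<t}) + card (?f (- 1) ` {..<t})" by (rule card_Un_le)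
  also have "\<dots> \<le> t + t" using card_image_le[of "{..<t}"] by (intro add_mono) fastforce+
  finally show ?thesis by simp
qed

text \<open>Frequencies are triples \<open>(a, u, w)\<close> with \<open>a\<close> of length 2 and \<open>u\<close>, \<open>w\<close> of length \<open>m\<close>. The two
  leading coordinates select the coefficient of the bilinear phase.\<close>

definition dim :: "nat \<Rightarrow> nat" where
  "dim m = 2 + (m + m)"

lemma dim_gt [simp]: "0 < dim m" "1 < dim m" "Suc 0 < dim m"
  by (simp_all add: dim_def)

lemma sum_Fp_vec_dim: "(\<Sum>a\<in>Fp_vec p (dim m). F a) =
    (\<Sum>a\<in>Fp_vec p 2. \<Sum>u\<in>Fp_vec p m. \<Sum>w\<in>Fp_vec p m. F (join 2 (m + m) a (join m m u w)))"
  unfolding dim_def sum_Fp_vec_add ..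

lemma sum_lessThan_dim:
  fixes f :: "nat \<Rightarrow> int"
  shows "(\<Sum>k<dim m. f k) = (\<Sum>k<2. f k) + ((\<Sum>k<m. f (2 + k)) + (\<Sum>k<m. f (2 + (m + k))))"
  unfolding dim_def sum_lessThan_add ..

text \<open>Where \<open>P\<close> vanishes the value is 0 instead of \<open>ep p 0\<close>, which
  confines the support to leading coordinates that are a column of \<open>M\<close> or its
  negative.\<close>

definition phase :: "nat \<Rightarrow> (nat \<Rightarrow> int) \<Rightarrow> complex" where
  "phase m a = (if int p dvd P (a 0) (a 1) then 0
    else ep p (P (a 0) (a 1) * (\<Sum>k<m. a (2 + k) * a (2 + (m + k)))))"

lemma norm_phase_le: "norm (phase m a) \<le> 1"
  by (simp add: phase_def)

lemma phase_cong:
  assumes "\<And>k. k < dim m \<Longrightarrow> [a k = b k] (mod int p)"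
  shows "phase m a = phase m b"
proof -
  have P: "P (a 0) (a 1) = P (b 0) (b 1)" using assms[of 0] assms[of 1] by (intro P_cong) auto
  have "[P (b 0) (b 1) * (\<Sum>k<m. a (2 + k) * a (2 + (m + k))) =
      P (b 0) (b 1) * (\<Sum>k<m. b (2 + k) * b (2 + (m + k)))] (mod int p)"
    using assms by (intro cong_mult cong_sum cong_refl) (auto simp: dim_def)
  then show ?thesis unfolding phase_def P by (simp add: ep_cong[OF p_pos])
qed

lemma phase_red: "phase m (red p (dim m) a) = phase m a"
  by (rule phase_cong) (simp add: cong_def)

lemma phase_zero: "phase m (zero_vec p (dim m)) = 0"
proof -
  have "P 0 0 = 0" using P_neg[of 0 0] by simp
  then show ?thesis unfolding phase_red by (simp add: phase_def)
qed

lemma hermitian_phase: "hermitian p (dim m) (phase m)"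
  unfolding hermitian_def phase_red by (simp add: phase_def P_neg cnj_ep)

text \<open>For fixed leading coordinates the sum over w is a complete character sum that pins down
  u, so each of the at most 2t supported choices contributes at most p^m rather than p^(2m).\<close>

lemma norm_trig_phase_le: "norm (trig p (dim m) (phase m) y) \<le> 2 * t * real p ^ m"
proof -
  let ?A = "Fp_vec p 2" and ?U = "Fp_vec p m"
  let ?supp = "{a \<in> ?A. \<not> int p dvd P (a 0) (a 1)}"
  define G where "G a = (\<Sum>u\<in>?U. \<Sum>w\<in>?U. phase m (join 2 (m + m) a (join m m u w)) *
      ep p (\<Sum>k<dim m. join 2 (m + m) a (join m m u w) k * y k))" for a
  have G: "norm (G a) \<le> (if int p dvd P (a 0) (a 1) then 0 else real p ^ m)" for a
  proof (cases "int p dvd P (a 0) (a 1)")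
    case True
    then show ?thesis by (simp add: G_def phase_def)
  next
    case False
    let ?P = "P (a 0) (a 1)"
    let ?good = "\<lambda>u. \<forall>k<m. int p dvd ?P * u k + y (2 + (m + k))"
    have split: "phase m (join 2 (m + m) a (join m m u w)) * ep p (\<Sum>k<dim m. join 2 (m + m) a (join m m u w) k * y k) =
        ep p ((\<Sum>k<2. a k * y k) + (\<Sum>k<m. u k * y (2 + k))) * ep p (\<Sum>k<m. (?P * u k + y (2 + (m + k))) * w k)" for u w
    proof -
      have "phase m (join 2 (m + m) a (join m m u w)) = ep p (?P * (\<Sum>k<m. u k * w k))"
        using False by (simp add: phase_def)
      moreover have "(\<Sum>k<dim m. join 2 (m + m) a (join m m u w) k * y k) =
          (\<Sum>k<2. a k * y k) + ((\<Sum>k<m. u k * y (2 + k)) + (\<Sum>k<m. w k * y (2 + (m + k))))"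
        unfolding sum_lessThan_dim by simp
      moreover have "(\<Sum>k<m. (?P * u k + y (2 + (m + k))) * w k) =
          ?P * (\<Sum>k<m. u k * w k) + (\<Sum>k<m. w k * y (2 + (m + k)))"
        unfolding sum_distrib_left sum.distrib[symmetric]
        by (intro sum.cong refl) (simp add: algebra_simps)
      ultimately show ?thesis by (simp add: ep_add)
    qed
    have "G a = (\<Sum>u\<in>?U. ep p ((\<Sum>k<2. a k * y k) + (\<Sum>k<m. u k * y (2 + k))) *
        (if ?good u then of_nat p ^ m else 0))"
      unfolding G_def split sum_distrib_left[symmetric] by (simp only: sum_ep_vec[OF p_pos])
    then have "norm (G a) \<le> (\<Sum>u\<in>?U. norm (ep p ((\<Sum>k<2. a k * y k) + (\<Sum>k<m. u k * y (2 + k))) *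
        (if ?good u then of_nat p ^ m else 0)))"
      by (simp only: norm_sum)
    also have "\<dots> = (\<Sum>u\<in>?U. if ?good u then real p ^ m else 0)"
      by (intro sum.cong refl)
        (auto simp only: norm_mult norm_ep norm_power norm_of_nat norm_zero mult_1_left split: if_split)
    also have "\<dots> = (\<Sum>u\<in>{u\<in>?U. ?good u}. real p ^ m)"
      by (rule sum.inter_filter[symmetric]) simp
    also have "\<dots> = real (card {u\<in>?U. ?good u}) * real p ^ m" by simp
    also have "card {u\<in>?U. ?good u} \<le> 1"
    proof -
      have "u = v" if "u \<in> {u\<in>?U. ?good u}" "v \<in> {u\<in>?U. ?good u}" for u v
      proof (rule Fp_vec_eqI[of _ p m])
        fix k assume "k < m"
        then have "int p dvd (?P * u k + y (2 + (m + k))) - (?P * v k + y (2 + (m + k)))"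
          using that by (intro dvd_diff) auto
        then have "int p dvd ?P * (u k - v k)" by (simp add: algebra_simps)
        then show "[u k = v k] (mod int p)"
          using False prime_dvd_mult_iff[OF prime_int] by (simp add: cong_iff_dvd_diff)
      qed (use that in auto)
      then show ?thesis by (simp add: card_le_Suc0_iff_eq)
    qed
    then have "real (card {u\<in>?U. ?good u}) * real p ^ m \<le> 1 * real p ^ m"
      by (intro mult_right_mono) auto
    finally show ?thesis using False by simp
  qed
  have "trig p (dim m) (phase m) y = (\<Sum>a\<in>?A. G a)"
    unfolding trig_def sum_Fp_vec_dim G_def ..
  then have "norm (trig p (dim m) (phase m) y) \<le> (\<Sum>a\<in>?A. norm (G a))" by (simp add: norm_sum)
  also have "\<dots> \<le> (\<Sum>a\<in>?A. if int p dvd P (a 0) (a 1) then 0 else real p ^ m)"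
    by (intro sum_mono G)
  also have "\<dots> = (\<Sum>a\<in>?supp. real p ^ m)"
    by (subst sum.inter_filter) (auto intro!: sum.cong)
  also have "\<dots> = real (card ?supp) * real p ^ m" by simp
  also have "\<dots> \<le> real (2 * t) * real p ^ m"
    using card_support by (intro mult_right_mono) (simp_all only: of_nat_le_iff zero_le_power of_nat_0_le_iff)
  finally show ?thesis by simp
qed

text \<open>A pair in \<open>Zset\<close> at i is determined by its combination with one further
  column j, which must lie in the support of \<open>phase\<close>; all coefficients have modulus at
  most 1.\<close>

lemma norm_Qsum_phase_le: "norm (Qsum (dim m) (phase m)) \<le> 2 * t ^ 2 * real p ^ (2 * m)"
proof -
  let ?S = "{a \<in> Fp_vec p (dim m). \<not> int p dvd P (a 0) (a 1)}"
  have card: "card ?S \<le> 2 * t * p ^ (2 * m)"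
  proof -
    have "card ?S = (\<Sum>a\<in>?S. 1)" by simp
    also have "\<dots> = (\<Sum>a\<in>Fp_vec p (dim m). if \<not> int p dvd P (a 0) (a 1) then 1 else 0)"
      by (rule sum.inter_filter) simp
    also have "\<dots> = (\<Sum>a\<in>Fp_vec p 2. if \<not> int p dvd P (a 0) (a 1) then p ^ (2 * m) else 0)"
      unfolding sum_Fp_vec_dim by (intro sum.cong refl) (simp add: card_Fp_vec mult_2 power_add)
    also have "\<dots> = (\<Sum>a\<in>{a \<in> Fp_vec p 2. \<not> int p dvd P (a 0) (a 1)}. p ^ (2 * m))"
      by (rule sum.inter_filter[symmetric]) simp
    also have "\<dots> \<le> 2 * t * p ^ (2 * m)"
      using card_support by simp
    finally show ?thesis .
  qed
  have each: "norm (\<Sum>\<Xi>\<in>Zset (dim m) i. \<Prod>j\<in>{..<t}-{i}. phase m (pt (dim m) \<Xi> j)) \<le> 2 * t * real p ^ (2 * m)"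
    if i: "i < t" for i
  proof -
    obtain j where j: "j < t" "j \<noteq> i"
      using two_le_t by (metis less_le_trans one_less_numeral_iff pos2 semiring_norm(76) zero_neq_one)
    let ?Z = "{\<Xi> \<in> Zset (dim m) i. pt (dim m) \<Xi> j \<in> ?S}"
    have "norm (\<Sum>\<Xi>\<in>Zset (dim m) i. \<Prod>j\<in>{..<t}-{i}. phase m (pt (dim m) \<Xi> j)) \<le>
        (\<Sum>\<Xi>\<in>Zset (dim m) i. norm (\<Prod>j\<in>{..<t}-{i}. phase m (pt (dim m) \<Xi> j)))"
      by (rule norm_sum)
    also have "\<dots> \<le> (\<Sum>\<Xi>\<in>Zset (dim m) i. if pt (dim m) \<Xi> j \<in> ?S then 1 else 0)"
    proof (rule sum_mono)
      fix \<Xi>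
      show "norm (\<Prod>j\<in>{..<t}-{i}. phase m (pt (dim m) \<Xi> j)) \<le> (if pt (dim m) \<Xi> j \<in> ?S then 1 else 0)"
      proof (cases "pt (dim m) \<Xi> j \<in> ?S")
        case True
        have "(\<Prod>j\<in>{..<t}-{i}. norm (phase m (pt (dim m) \<Xi> j))) \<le> 1"
          by (intro prod_le_1) (auto simp: norm_phase_le)
        then show ?thesis using True by (simp add: prod_norm)
      next
        case False
        then have "phase m (pt (dim m) \<Xi> j) = 0" by (auto simp: phase_def)
        then have "(\<Prod>j\<in>{..<t}-{i}. phase m (pt (dim m) \<Xi> j)) = 0"
          using j by (intro prod_zero) auto
        then show ?thesis using False by simp
      qed
    qed
    also have "\<dots> = real (card ?Z)"
      by (subst sum.inter_filter[symmetric]) auto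
    also have "card ?Z \<le> card ?S"
    proof (rule card_inj_on_le)
      show "inj_on (\<lambda>\<Xi>. pt (dim m) \<Xi> j) ?Z"
        using i j by (intro inj_onI pt_inj[of _ "dim m" _ i j]) (auto simp: Zset_def)
    qed auto
    also have "card ?S \<le> 2 * t * p ^ (2 * m)" by (rule card)
    finally show ?thesis by simp
  qed
  have "norm (Qsum (dim m) (phase m)) \<le>
      (\<Sum>i<t. norm (\<Sum>\<Xi>\<in>Zset (dim m) i. \<Prod>j\<in>{..<t}-{i}. phase m (pt (dim m) \<Xi> j)))"
    unfolding Qsum_def by (rule norm_sum)
  also have "\<dots> \<le> (\<Sum>i<t. 2 * t * real p ^ (2 * m))" using each by (intro sum_mono) auto
  finally show ?thesis by (simp add: power2_eq_square)
qed

text \<open>In a nonvanishing term the leading coordinates of every combination with j different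
  from i are a signed column. As column i annihilates the pair, all these columns are the same one,
  and a nonzero coordinate of it, rescaled to 1, yields a sign pattern in dimension 1, against
  \<open>noconc\<close>.\<close>

lemma Qsum_phase_eq_0:
  assumes noconc: "\<And>i \<Xi>. i < t \<Longrightarrow> \<Xi> \<in> Zset 1 i \<Longrightarrow> \<exists>j<t. j \<noteq> i \<and> \<not> unit_entry (pt 1 \<Xi> j)"
  shows "Qsum (dim m) (phase m) = 0"
proof -
  have "\<exists>j\<in>{..<t}-{i}. phase m (pt (dim m) \<Xi> j) = 0" if i: "i < t" and \<Xi>: "\<Xi> \<in> Zset (dim m) i" for i \<Xi>
  proof (rule ccontr)
    assume no: "\<not> ?thesis"
    define X where "X r j = M 0 j * fst \<Xi> r + M 1 j * snd \<Xi> r" for r j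
    have ptX: "[pt (dim m) \<Xi> j r = X r j] (mod int p)" if "r < 2" for j r
    proof -
      have "r < dim m" using that by (simp add: dim_def)
      then show ?thesis by (simp add: pt_def X_def cong_def)
    qed
    have "\<exists>l \<sigma>. l < t \<and> \<sigma> \<in> {1, - 1} \<and> (\<forall>r<2. [X r j = \<sigma> * M r l] (mod int p))" if j: "j < t" "j \<noteq> i" for j
    proof -
      have "phase m (pt (dim m) \<Xi> j) \<noteq> 0" using no j by blast
      then have "\<not> int p dvd P (pt (dim m) \<Xi> j 0) (pt (dim m) \<Xi> j 1)"
        by (rule contrapos_nn) (simp add: phase_def)
      moreover have "P (pt (dim m) \<Xi> j 0) (pt (dim m) \<Xi> j 1) = P (X 0 j) (X 1 j)"
        by (intro P_cong ptX) auto
      ultimately have "\<not> int p dvd P (X 0 j) (X 1 j)" by simp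
      then obtain l \<sigma> where "l < t" "\<sigma> \<in> {1, - 1}" "[X 0 j = \<sigma> * M 0 l] (mod int p)" "[X 1 j = \<sigma> * M 1 l] (mod int p)"
        using P_support by blast
      then show ?thesis by (auto simp: numeral_2_eq_2 less_Suc_eq)
    qed
    then obtain L \<sigma> where L: "\<And>j. j < t \<Longrightarrow> j \<noteq> i \<Longrightarrow> L j < t \<and> \<sigma> j \<in> {1, - 1} \<and>
        (\<forall>r<2. [X r j = \<sigma> j * M r (L j)] (mod int p))" by metis
    have X0: "int p dvd X r i" if "r < 2" for r
    proof -
      have "pt (dim m) \<Xi> i = zero_vec p (dim m)" using \<Xi> by (simp add: Zset_def)
      moreover have "r < dim m" using that by (simp add: dim_def)
      ultimately show ?thesis by (simp add: pt_def red_eq_iff X_def cong_0_iff)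
    qed
    \<comment> \<open>The two leading coordinates of the pair form a 2 x 2 matrix annihilated by the
      nonzero column i.\<close>
    have det: "int p dvd fst \<Xi> 0 * snd \<Xi> 1 - fst \<Xi> 1 * snd \<Xi> 0"
    proof -
      let ?d = "fst \<Xi> 0 * snd \<Xi> 1 - fst \<Xi> 1 * snd \<Xi> 0"
      have "M 0 i * ?d = snd \<Xi> 1 * X 0 i - snd \<Xi> 0 * X 1 i" "M 1 i * ?d = fst \<Xi> 0 * X 1 i - fst \<Xi> 1 * X 0 i"
        by (simp_all add: X_def algebra_simps)
      then have "int p dvd M 0 i * ?d" "int p dvd M 1 i * ?d" using X0[of 0] X0[of 1] by auto
      then show ?thesis using column_nonzero[OF i] prime_dvd_mult_iff[OF prime_int] by blast
    qed
    \<comment> \<open>The leading parts are all combinations of the rows of a singular matrix, hence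
      pairwise proportional, while distinct columns of \<open>M\<close> are independent.\<close>
    have same: "L j = L k" if jk: "j < t" "j \<noteq> i" "k < t" "k \<noteq> i" for j k
    proof (rule ccontr)
      assume ne: "L j \<noteq> L k"
      have "X 0 j * X 1 k - X 0 k * X 1 j = minor j k * (fst \<Xi> 0 * snd \<Xi> 1 - fst \<Xi> 1 * snd \<Xi> 0)"
        by (simp add: X_def minor_def algebra_simps)
      then have "int p dvd X 0 j * X 1 k - X 0 k * X 1 j" using det by simp
      moreover have "[X 0 j * X 1 k - X 0 k * X 1 j =
          (\<sigma> j * M 0 (L j)) * (\<sigma> k * M 1 (L k)) - (\<sigma> k * M 0 (L k)) * (\<sigma> j * M 1 (L j))] (mod int p)"
        using L[OF jk(1,2)] L[OF jk(3,4)] by (intro cong_diff cong_mult) auto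
      ultimately have "int p dvd (\<sigma> j * M 0 (L j)) * (\<sigma> k * M 1 (L k)) - (\<sigma> k * M 0 (L k)) * (\<sigma> j * M 1 (L j))"
        using cong_dvd_iff by blast
      also have "\<dots> = \<sigma> j * \<sigma> k * minor (L j) (L k)" by (simp add: minor_def algebra_simps)
      finally have "int p dvd minor (L j) (L k)" using L[OF jk(1,2)] L[OF jk(3,4)] by auto
      then show False using minor_ndvd[OF _ _ ne] L[OF jk(1,2)] L[OF jk(3,4)] by blast
    qed
    obtain j0 where j0: "j0 < t" "j0 \<noteq> i"
      using two_le_t by (metis less_le_trans one_less_numeral_iff pos2 semiring_norm(76) zero_neq_one)
    define l where "l = L j0"
    have "l < t" using L[OF j0] by (simp add: l_def)
    then obtain r where r: "r < 2" "\<not> int p dvd M r l"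
      using column_nonzero[of l] by (metis one_less_numeral_iff pos2 semiring_norm(76))
    then have "coprime (M r l) (int p)"
      using prime_imp_coprime[OF prime_int r(2)] by (simp add: coprime_commute)
    then obtain e where e: "[M r l * e = 1] (mod int p)" using cong_solve_coprime_int by blast
    \<comment> \<open>Coordinate r of the original pair, normalized by the inverse of
      \<open>M r l\<close>.\<close>
    let ?\<Theta> = "(red p 1 (\<lambda>_. fst \<Xi> r * e), red p 1 (\<lambda>_. snd \<Xi> r * e))"
    have pt\<Theta>: "pt 1 ?\<Theta> j = red p 1 (\<lambda>_. X r j * e)" for j
      unfolding pt_red by (intro red_cong) (simp add: X_def algebra_simps)
    have unit: "unit_entry (pt 1 ?\<Theta> j)" if j: "j < t" "j \<noteq> i" for j
    proof -
      have Lj: "L j = l" using same[OF j j0] by (simp add: l_def)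
      have "[X r j * e = (\<sigma> j * M r l) * e] (mod int p)"
        using L[OF j] r(1) Lj by (intro cong_mult cong_refl) auto
      also have "(\<sigma> j * M r l) * e = \<sigma> j * (M r l * e)" by simp
      also have "[\<sigma> j * (M r l * e) = \<sigma> j * 1] (mod int p)" by (intro cong_mult cong_refl e)
      finally have "[pt 1 ?\<Theta> j 0 = \<sigma> j] (mod int p)" unfolding pt\<Theta> by (simp add: cong_def)
      then show ?thesis using L[OF j] by (auto simp: unit_entry_def)
    qed
    have "?\<Theta> \<in> Zset 1 i"
      unfolding Zset_def
    proof (intro CollectI conjI)
      show "pt 1 ?\<Theta> i = zero_vec p 1"
        unfolding pt\<Theta> using X0[OF r(1)] by (intro red_cong) (simp add: cong_0_iff)
      show "?\<Theta> \<noteq> (zero_vec p 1, zero_vec p 1)"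
      proof
        assume "?\<Theta> = (zero_vec p 1, zero_vec p 1)"
        then have "pt 1 ?\<Theta> j0 = zero_vec p 1" by (simp only: pt_zero)
        then have "unit_entry (zero_vec p 1)" using unit[OF j0] by simp
        then have "int p dvd 1" by (simp add: unit_entry_def cong_iff_dvd_diff)
        then show False using prime_int not_prime_unit by blast
      qed
    qed simp
    then show False using noconc[OF i] unit by blast
  qed
  then show ?thesis unfolding Qsum_def by (intro sum.neutral ballI prod_zero) auto
qed

text \<open>For fixed a, b, u, v the total phase is linear in w and w', so summing over these gives
  a nonnegative number. For the two unit vectors as a and b the linear form vanishes by
  \<open>s_rel\<close> whatever u and v are, and this choice alone gives p^(4m).\<close>

lemma Re_Rsum_phase_ge: "Re (Rsum (dim m) (phase m)) \<ge> real p ^ (4 * m)"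
proof -
  let ?A = "Fp_vec p 2" and ?U = "Fp_vec p m"
  let ?J = "\<lambda>a u w. join 2 (m + m) a (join m m u w)"
  define W where "W a u b v = (\<Sum>w\<in>?U. \<Sum>w'\<in>?U. \<Prod>i<t. phase m (pt (dim m) (?J a u w, ?J b v w') i))" for a u b v
  define PP where "PP a b i = P (M 0 i * a 0 + M 1 i * b 0) (M 0 i * a 1 + M 1 i * b 1)" for a b :: "nat \<Rightarrow> int" and i
  \<comment> \<open>The coefficients of \<open>w k\<close> (for r = 0) and of \<open>w' k\<close>
    (for r = 1) in the total phase.\<close>
  define C where "C r a u b v k = (\<Sum>i<t. PP a b i * (M 0 i * u k + M 1 i * v k) * M r i)" for r and a u b v :: "nat \<Rightarrow> int" and k :: nat
  have W: "W a u b v = (if \<exists>i<t. int p dvd PP a b i then 0 else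
      of_real (if \<forall>k<m. int p dvd C 0 a u b v k then real p ^ m else 0) *
      of_real (if \<forall>k<m. int p dvd C 1 a u b v k then real p ^ m else 0))" for a u b v
  proof -
    have ph: "phase m (pt (dim m) (?J a u w, ?J b v w') i) = (if int p dvd PP a b i then 0
        else ep p (PP a b i * (\<Sum>k<m. (M 0 i * u k + M 1 i * v k) * (M 0 i * w k + M 1 i * w' k))))" for w w' i
      unfolding pt_def phase_red by (simp add: phase_def PP_def)
    show ?thesis
    proof (cases "\<exists>i<t. int p dvd PP a b i")
      case True
      then obtain i where i: "i < t" "int p dvd PP a b i" by blast
      have "(\<Prod>i<t. phase m (pt (dim m) (?J a u w, ?J b v w') i)) = 0" for w w'
        using i by (intro prod_zero bexI[of _ i]) (auto simp: ph)
      then have "W a u b v = 0" unfolding W_def by (simp only: sum.neutral_const)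
      then show ?thesis using True by simp
    next
      case False
      have "(\<Prod>i<t. phase m (pt (dim m) (?J a u w, ?J b v w') i)) =
          ep p (\<Sum>k<m. C 0 a u b v k * w k) * ep p (\<Sum>k<m. C 1 a u b v k * w' k)" for w w'
      proof -
        have "(\<Prod>i<t. phase m (pt (dim m) (?J a u w, ?J b v w') i)) =
            ep p (\<Sum>i<t. PP a b i * (\<Sum>k<m. (M 0 i * u k + M 1 i * v k) * (M 0 i * w k + M 1 i * w' k)))"
          using False by (simp add: ph ep_sum)
        also have "(\<Sum>i<t. PP a b i * (\<Sum>k<m. (M 0 i * u k + M 1 i * v k) * (M 0 i * w k + M 1 i * w' k))) =
            (\<Sum>i<t. \<Sum>k<m. PP a b i * (M 0 i * u k + M 1 i * v k) * M 0 i * w k +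
              PP a b i * (M 0 i * u k + M 1 i * v k) * M 1 i * w' k)"
          unfolding sum_distrib_left by (intro sum.cong refl) (simp add: algebra_simps)
        also have "\<dots> = (\<Sum>k<m. \<Sum>i<t. PP a b i * (M 0 i * u k + M 1 i * v k) * M 0 i * w k +
              PP a b i * (M 0 i * u k + M 1 i * v k) * M 1 i * w' k)"
          by (rule sum.swap)
        also have "\<dots> = (\<Sum>k<m. C 0 a u b v k * w k) + (\<Sum>k<m. C 1 a u b v k * w' k)"
          by (simp add: C_def sum.distrib sum_distrib_right)
        finally show ?thesis by (simp add: ep_add)
      qed
      then have "W a u b v = (\<Sum>w\<in>?U. ep p (\<Sum>k<m. C 0 a u b v k * w k)) * (\<Sum>w'\<in>?U. ep p (\<Sum>k<m. C 1 a u b v k * w' k))"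
        by (simp add: W_def sum_product)
      then show ?thesis using False by (simp only: sum_ep_vec_of_real[OF p_pos] if_False)
    qed
  qed
  have W0: "Re (W a u b v) \<ge> 0" for a u b v unfolding W by simp
  have "Rsum (dim m) (phase m) =
      (\<Sum>\<xi>\<in>Fp_vec p (dim m). \<Sum>\<eta>\<in>Fp_vec p (dim m). \<Prod>i<t. phase m (pt (dim m) (\<xi>, \<eta>) i))"
    by (simp add: Rsum_def sum.cartesian_product)
  also have "\<dots> = (\<Sum>a\<in>?A. \<Sum>u\<in>?U. \<Sum>w\<in>?U. \<Sum>b\<in>?A. \<Sum>v\<in>?U. \<Sum>w'\<in>?U.
      \<Prod>i<t. phase m (pt (dim m) (?J a u w, ?J b v w') i))"
    unfolding sum_Fp_vec_dim ..
  \<comment> \<open>The sums over \<open>w\<close> and \<open>w'\<close> are moved inside to form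
    \<open>W\<close>.\<close>
  also have "\<dots> = (\<Sum>a\<in>?A. \<Sum>u\<in>?U. \<Sum>b\<in>?A. \<Sum>w\<in>?U. \<Sum>v\<in>?U. \<Sum>w'\<in>?U.
      \<Prod>i<t. phase m (pt (dim m) (?J a u w, ?J b v w') i))"
    by (intro sum.cong refl sum.swap)
  also have "\<dots> = (\<Sum>a\<in>?A. \<Sum>u\<in>?U. \<Sum>b\<in>?A. \<Sum>v\<in>?U. W a u b v)"
    unfolding W_def by (intro sum.cong refl sum.swap)
  finally have R: "Re (Rsum (dim m) (phase m)) = (\<Sum>a\<in>?A. \<Sum>u\<in>?U. \<Sum>b\<in>?A. \<Sum>v\<in>?U. Re (W a u b v))"
    by simp
  \<comment> \<open>With these leading coordinates the combination with column i begins with column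
    i itself, so its phase has coefficient \<open>s i\<close>.\<close>
  define e where "e c = red p 2 (\<lambda>k. of_bool (k = c))" for c :: nat
  have e: "e c \<in> ?A" for c by (simp add: e_def)
  have PPe: "PP (e 0) (e 1) i = s i" if "i < t" for i
  proof -
    have "PP (e 0) (e 1) i = P (M 0 i) (M 1 i)"
      unfolding PP_def using prime_gt_1_nat[OF prime]
      by (intro P_cong) (simp_all add: e_def)
    then show ?thesis using P_col[OF that] by simp
  qed
  have We: "Re (W (e 0) u (e 1) v) = real p ^ (2 * m)" for u v
  proof -
    have "int p dvd C r (e 0) u (e 1) v k" if "r < 2" for r k
    proof -
      have "C r (e 0) u (e 1) v k = (\<Sum>i<t. s i * (M 0 i * u k + M 1 i * v k) * M r i)"
        unfolding C_def by (intro sum.cong refl) (simp only: PPe lessThan_iff)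
      also have "\<dots> = u k * (\<Sum>i<t. s i * (M 0 i * M r i)) + v k * (\<Sum>i<t. s i * (M 1 i * M r i))"
        by (simp add: sum_distrib_left algebra_simps sum.distrib)
      also have "int p dvd \<dots>" using s_rel[of 0 r] s_rel[of 1 r] that by simp
      finally show ?thesis .
    qed
    moreover have "\<not> (\<exists>i<t. int p dvd PP (e 0) (e 1) i)" using PPe s_ndvd by simp
    moreover have "\<forall>k<m. int p dvd C r (e 0) u (e 1) v k" if "r < 2" for r
      using calculation(1) that by blast
    ultimately have "W (e 0) u (e 1) v = of_real (real p ^ m) * of_real (real p ^ m)"
      unfolding W by (simp only: if_False if_True HOL.simp_thms one_less_numeral_iff semiring_norm pos2)
    then show ?thesis by (simp add: mult_2 power_add)
  qed
  have "real p ^ (4 * m) = (\<Sum>u\<in>?U. \<Sum>v\<in>?U. Re (W (e 0) u (e 1) v))"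
  proof -
    have "4 * m = m + (m + 2 * m)" by simp
    then show ?thesis by (simp only: We sum_constant card_Fp_vec power_add of_nat_power)
  qed
  also have "\<dots> \<le> (\<Sum>u\<in>?U. \<Sum>b\<in>?A. \<Sum>v\<in>?U. Re (W (e 0) u b v))"
    using e W0 by (intro sum_mono member_le_sum sum_nonneg) auto
  also have "\<dots> \<le> (\<Sum>a\<in>?A. \<Sum>u\<in>?U. \<Sum>b\<in>?A. \<Sum>v\<in>?U. Re (W a u b v))"
    using e W0 by (intro member_le_sum[of "e 0"] sum_nonneg) auto
  finally show ?thesis by (simp add: R)
qed

end

subsection \<open>Comparison of the two terms\<close>

lemma trig_neg: "trig p n (\<lambda>a. - z a) y = - trig p n z y"
  by (simp add: trig_def sum_negf)

lemma hermitian_neg: "hermitian p n z \<Longrightarrow> hermitian p n (\<lambda>a. - z a)"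
  by (simp add: hermitian_def)

lemma prod_neg: "(\<Prod>i\<in>A. - f i) = (- 1) ^ card A * (\<Prod>i\<in>A. f i :: complex)"
  by (induction A rule: infinite_finite_induct) simp_all

context generic_system begin

text \<open>The products in \<open>Qsum\<close> have t - 1 factors, an even number; those in
  \<open>Rsum\<close> have t.\<close>

lemma Qsum_neg: "odd t \<Longrightarrow> Qsum n (\<lambda>a. - z a) = Qsum n z"
  by (simp add: Qsum_def prod_neg card_Diff_singleton)

lemma Rsum_neg: "odd t \<Longrightarrow> Rsum n (\<lambda>a. - z a) = - Rsum n z"
  by (simp add: Rsum_def prod_neg sum_negf)

end

context phase_system begin

text \<open>The case m = 0 suffices: there the coefficients are the indicator of the signed columns.
  Without a concentrated pair \<open>Qsum\<close> vanishes while \<open>Rsum\<close> is positive,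
  and the negated function is a counterexample.\<close>

lemma weakly_imp_concentrated:
  assumes "weakly_locally_Sidorenko p t D \<Psi>"
  shows "\<exists>i<t. \<exists>\<Xi>\<in>Zset 1 i. \<forall>j<t. j \<noteq> i \<longrightarrow> unit_entry (pt 1 \<Xi> j)"
proof (rule ccontr)
  assume "\<not> ?thesis"
  then have "Qsum (dim 0) (phase 0) = 0" by (intro Qsum_phase_eq_0) blast
  moreover have "Re (Rsum (dim 0) (phase 0)) \<ge> 1" using Re_Rsum_phase_ge[of 0] by simp
  ultimately show False
    using not_weakly_if[of "dim 0" "\<lambda>a. - phase 0 a"] weakly_imp_odd[OF assms] assms phase_zero[of 0]
      hermitian_neg[OF hermitian_phase[of 0]] by (simp add: Qsum_neg Rsum_neg dim_def)
qed

text \<open>The coefficients of \<open>phase m\<close> have modulus at most 1 while its values are \<open>O(p\<^sup>m)\<close>. After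
  normalization the main term thus exceeds the lower order terms by a factor of order \<open>p\<^sup>m\<close>, which
  makes up for any fixed \<open>\<epsilon>\<close>.\<close>

lemma not_locally:
  assumes "odd t"
  shows "\<not> locally_Sidorenko p t D \<Psi>"
proof (rule not_locally_if)
  fix \<epsilon> :: real assume \<epsilon>: "\<epsilon> > 0"
  have "real p > 1" using prime_gt_1_nat[OF prime] by simp
  \<comment> \<open>With the bounds below, \<open>B\<close> times \<open>Qsum\<close> is at most 4
    t^3 p^(3m), against \<epsilon> p^(4m) from \<open>Rsum\<close>.\<close>
  then obtain m where m: "4 * real t ^ 3 / \<epsilon> < real p ^ m"
    using real_arch_pow by blast
  define B where "B = 2 * t * real p ^ m"
  define z where "z = (\<lambda>a. - phase m a)"
  have B: "B > 0" using two_le_t by (simp add: B_def)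
  have Q: "Re (Qsum (dim m) z) \<le> 2 * t ^ 2 * real p ^ (2 * m)"
    using norm_Qsum_phase_le[of m] complex_Re_le_cmod[of "Qsum (dim m) (phase m)"] Qsum_neg[OF assms]
    by (simp add: z_def)
  have R: "Re (Rsum (dim m) z) \<le> - (real p ^ (4 * m))"
    using Re_Rsum_phase_ge[of m] Rsum_neg[OF assms] by (simp add: z_def)
  have "B * Re (Qsum (dim m) z) + \<epsilon> * Re (Rsum (dim m) z) \<le>
      B * (2 * t ^ 2 * real p ^ (2 * m)) + \<epsilon> * (- (real p ^ (4 * m)))"
    using B \<epsilon> Q R by (intro add_mono mult_left_mono) auto
  also have "\<dots> = real p ^ (3 * m) * (4 * real t ^ 3 - \<epsilon> * real p ^ m)"
  proof -
    have "real p ^ (4 * m) = real p ^ (3 * m) * real p ^ m" "real p ^ (3 * m) = real p ^ m * real p ^ (2 * m)"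
      by (simp_all flip: power_add)
    then show ?thesis by (simp add: B_def algebra_simps power2_eq_square power3_eq_cube)
  qed
  also have "\<dots> < 0"
    using m \<epsilon> p_pos by (intro mult_pos_neg) (auto simp: field_simps)
  finally show "\<exists>n\<ge>1. \<exists>z B. z (zero_vec p n) = 0 \<and> hermitian p n z \<and> B > 0 \<and>
      (\<forall>y. norm (trig p n z y) \<le> B) \<and> B * Re (Qsum n z) + \<epsilon> * Re (Rsum n z) < 0"
    using B phase_zero[of m] hermitian_neg[OF hermitian_phase[of m]] norm_trig_phase_le[of m]
    by (intro exI[of _ "dim m"] conjI exI[of _ z] exI[of _ B])
      (auto simp: z_def B_def trig_neg dim_def)
qed

end

section \<open>Assembly of the cases\<close>

context generic_system begin

text \<open>An odd t >= 2 other than 3 is at least 5, and then t <= p + 1 forces p >= 5, as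
  \<open>full_relation\<close> requires.\<close>

lemma phase_system_exists:
  assumes "odd t" "t \<noteq> 3"
  obtains s where "phase_system p t D \<Psi> M s"
proof -
  have "t \<ge> 5"
  proof (rule ccontr)
    assume "\<not> t \<ge> 5"
    then have "t \<in> {2, 3, 4}" using two_le_t by auto
    then show False using assms by auto
  qed
  then have "p \<ge> 4" using t_le_Suc_p by simp
  then have "p > 2" by simp
  then have podd: "odd p" using prime prime_odd_nat by blast
  with \<open>p \<ge> 4\<close> have "p \<ge> 5" by (cases "p = 4") auto
  have "t \<ge> 4" using \<open>t \<ge> 5\<close> by simp
  obtain s where "\<And>l. l < t \<Longrightarrow> \<not> int p dvd s l"
    "\<And>r r'. r < 2 \<Longrightarrow> r' < 2 \<Longrightarrow> int p dvd (\<Sum>l<t. s l * (M r l * M r' l))"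
    by (rule full_relation[OF \<open>t \<ge> 4\<close> \<open>p \<ge> 5\<close>], rule that, assumption+)
  then have "phase_system p t D \<Psi> M s"
    using podd by unfold_locales auto
  then show ?thesis by (rule that)
qed

lemma not_locally_unless_thrice:
  assumes "linear_system p t D \<Psi>" "\<not> form_thrice p t D \<Psi>"
  shows "\<not> locally_Sidorenko p t D \<Psi>"
proof
  assume L: "locally_Sidorenko p t D \<Psi>"
  then have W: "weakly_locally_Sidorenko p t D \<Psi>" by (rule locally_imp_weakly)
  show False
  proof (cases "t = 3")
    case True
    then show False using form_thrice_if weakly_three_imp[OF True assms(1) W] assms(2) by blast
  next
    case False
    then obtain s where "phase_system p t D \<Psi> M s" using phase_system_exists weakly_imp_odd[OF W] by blast
    then show False using phase_system.not_locally weakly_imp_odd[OF W] L by blast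
  qed
qed

lemma weakly_imp_additive:
  assumes "linear_system p t D \<Psi>" "weakly_locally_Sidorenko p t D \<Psi>"
  shows "contains_additive_tuple p t D \<Psi> (t - 1)"
proof (cases "t = 3")
  case True
  then show ?thesis using additive_pair_if weakly_three_imp[OF True assms] by blast
next
  case False
  then obtain s where "phase_system p t D \<Psi> M s"
    using phase_system_exists weakly_imp_odd[OF assms(2)] by blast
  then interpret phase_system p t D \<Psi> M s .
  show ?thesis
    using weakly_imp_concentrated[OF assms(2)] weakly_imp_additive_if_concentrated[OF assms(2) p_odd] by blast
qed

end

theorem theorem1p1:
  "\<exists>P0 :: nat \<Rightarrow> nat. \<forall>(p::nat) (t::nat) (D::nat) (\<Psi> :: nat \<Rightarrow> nat \<Rightarrow> int).
     prime p \<and> linear_system p t D \<Psi> \<and> codimension_two p t D \<Psi> \<and> linearly_generic p t D \<Psi> \<longrightarrow>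
       (\<not> form_thrice p t D \<Psi> \<longrightarrow> \<not> locally_Sidorenko p t D \<Psi> \<and> \<not> Sidorenko p t D \<Psi>) \<and>
       (weakly_locally_Sidorenko p t D \<Psi> \<longrightarrow>
          odd t \<and> (p \<ge> P0 t \<longrightarrow> contains_additive_tuple p t D \<Psi> (t - 1)))"
proof (intro exI[of _ "\<lambda>_. 0"] allI impI)
  \<comment> \<open>The threshold is the constant 0: the lower bound on p that the argument uses is
    \<open>t_le_Suc_p\<close>.\<close>
  fix p t D :: nat and \<Psi> :: "nat \<Rightarrow> nat \<Rightarrow> int"
  assume H: "prime p \<and> linear_system p t D \<Psi> \<and> codimension_two p t D \<Psi> \<and> linearly_generic p t D \<Psi>"
  then obtain M where "generic_system p t D \<Psi> M"
    unfolding linearly_generic_def generic_system_def by blast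
  then interpret generic_system p t D \<Psi> M .
  show "(\<not> form_thrice p t D \<Psi> \<longrightarrow> \<not> locally_Sidorenko p t D \<Psi> \<and> \<not> Sidorenko p t D \<Psi>) \<and>
       (weakly_locally_Sidorenko p t D \<Psi> \<longrightarrow>
          odd t \<and> (p \<ge> 0 \<longrightarrow> contains_additive_tuple p t D \<Psi> (t - 1)))"
    using H not_locally_unless_thrice Sidorenko_imp_locally[OF p_pos] weakly_imp_odd weakly_imp_additive
    by blast
qed

end
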